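(* Assume that $s\geq 10$ and fix $(t_0,x_0)\in\mathbb{R}\times\mathbb{T}^3$. Let $u(t,x,\omega)$ be the solution of $i\partial_tu+\Delta u=|u|^4u$ on $\mathbb{R}\times\mathbb{T}^3$ with initial data $u(0,x,\omega)=\phi^\omega(x)$. Then the law of the complex random variable $\omega\mapsto u(t_0,x_0,\omega)$ has a density with respect to the Lebesgue measure on $\mathbb{C}$.
   Context: Let $\mathbb{T}^3=\mathbb{R}^3/(2\pi\mathbb{Z})^3$. The random initial datum is $\phi^\omega(x)=\sum_{k\in\mathbb{Z}^3}\frac{g_k(\omega)}{\sqrt{1+|k|^{2s}}}e^{ik\cdot x}$, where $(g_k)_{k\in\mathbb{Z}^3}$ are independent, identically distributed standard complex Gaussian random variables. Almost surely $\phi^\omega\in\bigcap_{\sigma<s-\frac32}H^\sigma(\mathbb{T}^3)$. The equation is globally well posed in $H^\sigma(\mathbb{T}^3)$ for every $\sigma\ge1$ (Ionescu–Pausader), with solutions in $C(\mathbb{R};H^\sigma(\mathbb{T}^3))$. *)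

theory Defs
  imports "HOL-Probability.Probability"
begin

text \<open>
  Functions on the torus R^3/(2 pi Z)^3 are functions on \<open>real^3\<close> that are
  2 pi-periodic in every coordinate; a point of the torus is given by any representative.
\<close>

definition lattice_vec :: "int ^ 3 \<Rightarrow> real ^ 3" where
  "lattice_vec k = (\<chi> j. real_of_int (k $ j))"

definition torus_periodic :: "(real ^ 3 \<Rightarrow> complex) \<Rightarrow> bool" where
  "torus_periodic f \<longleftrightarrow> (\<forall>x n. f (x + (2 * pi) *\<^sub>R lattice_vec n) = f x)"

definition torus_cell :: "(real ^ 3) set" where
  "torus_cell = cbox 0 (\<chi> j. 2 * pi)"

definition character :: "int ^ 3 \<Rightarrow> real ^ 3 \<Rightarrow> complex" where
  "character k x = exp (\<i> * complex_of_real (lattice_vec k \<bullet> x))"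

definition fourier_coeff :: "(real ^ 3 \<Rightarrow> complex) \<Rightarrow> int ^ 3 \<Rightarrow> complex" where
  "fourier_coeff f k =
     (LINT x:torus_cell|lebesgue. f x * cnj (character k x)) / complex_of_real ((2 * pi) ^ 3)"

definition torus_L2 :: "(real ^ 3 \<Rightarrow> complex) set" where
  "torus_L2 = {f. torus_periodic f \<and> f \<in> borel_measurable lebesgue \<and>
                  set_integrable lebesgue torus_cell (\<lambda>x. (norm (f x))\<^sup>2)}"

text \<open>
  Sobolev spaces of order \<open>\<sigma> \<ge> 0\<close>, as spaces of square integrable functions. (For negative order
  they would have to contain distributions, which this definition does not cover.)
\<close>

definition sobolev_weight :: "real \<Rightarrow> (real ^ 3 \<Rightarrow> complex) \<Rightarrow> int ^ 3 \<Rightarrow> real" where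
  "sobolev_weight \<sigma> f k =
     (1 + (norm (lattice_vec k))\<^sup>2) powr \<sigma> * (norm (fourier_coeff f k))\<^sup>2"

definition sobolev :: "real \<Rightarrow> (real ^ 3 \<Rightarrow> complex) set" where
  "sobolev \<sigma> = {f \<in> torus_L2. sobolev_weight \<sigma> f summable_on UNIV}"

definition sobolev_norm :: "real \<Rightarrow> (real ^ 3 \<Rightarrow> complex) \<Rightarrow> real" where
  "sobolev_norm \<sigma> f = sqrt (\<Sum>\<^sub>\<infinity>k. sobolev_weight \<sigma> f k)"

definition continuous_into_sobolev :: "real \<Rightarrow> (real \<Rightarrow> real ^ 3 \<Rightarrow> complex) \<Rightarrow> bool" where
  "continuous_into_sobolev \<sigma> v \<longleftrightarrow>
     (\<forall>t. v t \<in> sobolev \<sigma> \<and>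
          ((\<lambda>\<tau>. sobolev_norm \<sigma> (\<lambda>x. v \<tau> x - v t x)) \<longlongrightarrow> 0) (at t))"

definition has_partial_deriv ::
    "3 \<Rightarrow> (real ^ 3 \<Rightarrow> complex) \<Rightarrow> (real ^ 3 \<Rightarrow> complex) \<Rightarrow> bool" where
  "has_partial_deriv j f f' \<longleftrightarrow>
     (\<forall>x. ((\<lambda>h. f (x + h *\<^sub>R axis j 1)) has_vector_derivative f' x) (at 0))"

definition has_laplacian :: "(real ^ 3 \<Rightarrow> complex) \<Rightarrow> (real ^ 3 \<Rightarrow> complex) \<Rightarrow> bool" where
  "has_laplacian f L \<longleftrightarrow>
     (\<exists>D D2. (\<forall>j. has_partial_deriv j f (D j) \<and> has_partial_deriv j (D j) (D2 j)) \<and>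
             L = (\<lambda>x. \<Sum>j\<in>UNIV. D2 j x))"

definition quintic_nls :: "(real \<Rightarrow> real ^ 3 \<Rightarrow> complex) \<Rightarrow> bool" where
  "quintic_nls v \<longleftrightarrow>
     (\<forall>t. \<exists>vt L. has_laplacian (v t) L \<and>
        (\<forall>x. ((\<lambda>\<tau>. v \<tau> x) has_vector_derivative vt x) (at t) \<and>
             \<i> * vt x + L x = complex_of_real ((norm (v t x)) ^ 4) * v t x))"

text \<open>
  The global solution issued from a datum that belongs to \<open>H^\<sigma>\<close> for all \<open>\<sigma> < \<sigma>max\<close>.
  It is only used with \<open>\<sigma>max > 7/2\<close>: then elements of \<open>C(R; H^\<sigma>)\<close> with \<open>7/2 < \<sigma> < \<sigma>max\<close> are
  twice continuously differentiable in space, a distributional (equivalently, Duhamel) solution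
  in that class is continuously differentiable in time and satisfies the equation classically,
  and there is at most one solution for each datum. Continuity of \<open>v t\<close> selects
  the continuous representative, so that point values are meaningful.
\<close>

definition nls_solution ::
    "real \<Rightarrow> (real ^ 3 \<Rightarrow> complex) \<Rightarrow> (real \<Rightarrow> real ^ 3 \<Rightarrow> complex) \<Rightarrow> bool" where
  "nls_solution \<sigma>max \<phi> v \<longleftrightarrow>
     (\<forall>\<sigma>. 1 \<le> \<sigma> \<and> \<sigma> < \<sigma>max \<longrightarrow> continuous_into_sobolev \<sigma> v) \<and>
     (\<forall>t. continuous_on UNIV (v t)) \<and>
     quintic_nls v \<and>
     v 0 = \<phi>"

text \<open>
  Normalisation: mean zero and \<open>E |g|^2 = 1\<close>, i.e. real and imaginary part are independent
  centred Gaussians of variance 1/2.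
\<close>

definition std_complex_gaussian_density :: "complex \<Rightarrow> real" where
  "std_complex_gaussian_density z = exp (- (norm z)\<^sup>2) / pi"

definition random_datum ::
    "real \<Rightarrow> (int ^ 3 \<Rightarrow> 'a \<Rightarrow> complex) \<Rightarrow> 'a \<Rightarrow> real ^ 3 \<Rightarrow> complex" where
  "random_datum s g \<omega> x =
     (\<Sum>\<^sub>\<infinity>k. g k \<omega> / complex_of_real (sqrt (1 + norm (lattice_vec k) powr (2 * s)))
            * character k x)"

end

theory Submission
  imports Defs
begin

text \<open>
  A solution of class \<open>C(R; H\<^sup>8)\<close> has absolutely summable Fourier coefficients, and in the interaction
  picture \<open>e\<^sup>-\<^sup>i\<^sup>t\<^sup>\<Delta> u(t)\<close> these solve an ordinary differential equation with a polynomial field in the Banach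
  space \<open>\<ell>\<^sup>1\<close>. So \<open>u(t\<^sub>0, x\<^sub>0)\<close> is a function \<open>F\<close> of the initial coefficients, defined on an open set that contains
  almost every datum, and differentiable there. Its derivative is onto \<open>\<complex>\<close>, because the linearised equation can be
  solved backwards in time. As trigonometric polynomials are dense, the derivative is already invertible on the
  plane of two coordinate directions. On the planes parallel to it, the preimage under \<open>F\<close> of a Lebesgue null set is
  therefore null; by Tonelli almost all translates of this preimage within the plane have probability zero, and hence
  so has the preimage itself, since the law of the datum is quasi-invariant under translation of a coordinate.
  Thus the law of \<open>u(t\<^sub>0, x\<^sub>0)\<close> is absolutely continuous.
\<close>

section \<open>The Banach space of absolutely summable families\<close>

text \<open>Absolutely summable coefficients make each ingredient elementary: convolution is bounded
  on them, so |u|^4 u becomes polynomial; point evaluation is a bounded functional; the Schroedinger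
  group acts by isometries. The Laplacian is met only on the way from the classical equation to
  coefficients, and Sobolev order 8 < 10 - 3/2 pays for it. Global existence enters through the
  hypothesis that almost every datum has a solution. Because of the conjugation the derivative is
  only real linear; hence both directions 1 and i of every coefficient are tested, and independence
  is a real determinant. The main obstacle is measurability, as the plane on which the derivative is
  invertible varies with the datum. Countably many Borel sets, on each of which F expands distances
  along one fixed coordinate plane, settle this: a Lipschitz inverse takes the place of a change of
  variables. Translating one Gaussian coordinate preserves null sets because its density is
  positive, and a step in a plane is two such translations. As u is controlled only almost surely,
  its law is taken over the completion.\<close>

typedef 'k ell1 = "{a :: 'k \<Rightarrow> complex. (\<lambda>k. norm (a k)) summable_on UNIV}"
  morphisms coef Ell1
  by (rule exI[of _ "\<lambda>_. 0"]) simp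

setup_lifting type_definition_ell1

lemma abs_summable_onI_bound:
  fixes a :: "'k \<Rightarrow> 'b :: real_normed_vector"
  assumes "\<And>F. finite F \<Longrightarrow> (\<Sum>k\<in>F. norm (a k)) \<le> B"
  shows "(\<lambda>k. norm (a k)) summable_on UNIV"
  by (subst abs_summable_iff_bdd_above) (use assms in \<open>auto intro!: bdd_aboveI\<close>)

lemma infsum_le_bound:
  fixes a :: "'k \<Rightarrow> 'b :: real_normed_vector"
  assumes "\<And>F. finite F \<Longrightarrow> (\<Sum>k\<in>F. norm (a k)) \<le> B"
  shows "(\<Sum>\<^sub>\<infinity>k. norm (a k)) \<le> B"
  by (rule infsum_le_finite_sums[OF abs_summable_onI_bound]) (use assms in auto)

lemma abs_summable_coef [simp]: "(\<lambda>k. norm (coef a k)) summable_on UNIV"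
  using coef[of a] by simp

lemma ell1_eqI: "(\<And>k. coef a k = coef b k) \<Longrightarrow> a = b"
  by (simp add: coef_inject[symmetric] fun_eq_iff)

lemma abs_summable_add:
  fixes a b :: "'k \<Rightarrow> 'b :: real_normed_vector"
  assumes "(\<lambda>k. norm (a k)) summable_on UNIV" "(\<lambda>k. norm (b k)) summable_on UNIV"
  shows "(\<lambda>k. norm (a k + b k)) summable_on UNIV"
  by (rule summable_on_comparison_test[OF summable_on_add[OF assms]])
     (auto intro: norm_triangle_ineq)

instantiation ell1 :: (type) real_vector
begin

lift_definition zero_ell1 :: "'a ell1" is "\<lambda>_. 0" by simp
lift_definition plus_ell1 :: "'a ell1 \<Rightarrow> 'a ell1 \<Rightarrow> 'a ell1" is "\<lambda>a b k. a k + b k"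
  by (rule abs_summable_add)
lift_definition uminus_ell1 :: "'a ell1 \<Rightarrow> 'a ell1" is "\<lambda>a k. - a k" by simp
lift_definition minus_ell1 :: "'a ell1 \<Rightarrow> 'a ell1 \<Rightarrow> 'a ell1" is "\<lambda>a b k. a k - b k"
proof -
  fix a b :: "'a \<Rightarrow> complex"
  assume "(\<lambda>k. norm (a k)) summable_on UNIV" "(\<lambda>k. norm (b k)) summable_on UNIV"
  then show "(\<lambda>k. norm (a k - b k)) summable_on UNIV"
    using abs_summable_add[of a "\<lambda>k. - b k"] by simp
qed
lift_definition scaleR_ell1 :: "real \<Rightarrow> 'a ell1 \<Rightarrow> 'a ell1" is "\<lambda>r a k. r *\<^sub>R a k"
  by (simp add: summable_on_cmult_right)

instance
  by standard (transfer; simp add: algebra_simps)+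

end

lemma coef_simps [simp]:
  "coef 0 k = 0" "coef (a + b) k = coef a k + coef b k" "coef (a - b) k = coef a k - coef b k"
  "coef (- a) k = - coef a k" "coef (r *\<^sub>R a) k = r *\<^sub>R coef a k"
  by (transfer; simp)+

instantiation ell1 :: (type) real_normed_vector
begin

definition norm_ell1 :: "'a ell1 \<Rightarrow> real" where "norm_ell1 a = (\<Sum>\<^sub>\<infinity>k. norm (coef a k))"
definition dist_ell1 :: "'a ell1 \<Rightarrow> 'a ell1 \<Rightarrow> real" where "dist_ell1 a b = norm (a - b)"
definition sgn_ell1 :: "'a ell1 \<Rightarrow> 'a ell1" where "sgn_ell1 a = inverse (norm a) *\<^sub>R a"
definition uniformity_ell1 :: "('a ell1 \<times> 'a ell1) filter"
  where "uniformity_ell1 = (INF e\<in>{0 <..}. principal {(x, y). dist x y < e})"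
definition open_ell1 :: "'a ell1 set \<Rightarrow> bool"
  where "open_ell1 S = (\<forall>x\<in>S. \<forall>\<^sub>F (x', y) in uniformity. x' = x \<longrightarrow> y \<in> S)"

instance
proof
  fix a b :: "'a ell1" and r :: real
  show "norm a = 0 \<longleftrightarrow> a = 0"
  proof
    assume "norm a = 0"
    then have "norm (coef a k) = 0" for k
      using nonneg_infsum_le_0D[of "\<lambda>k. norm (coef a k)" UNIV k] by (simp add: norm_ell1_def)
    then show "a = 0" by (intro ell1_eqI) simp
  qed (simp add: norm_ell1_def)
  have "norm (a + b) \<le> (\<Sum>\<^sub>\<infinity>k. cmod (coef a k) + cmod (coef b k))"
    unfolding norm_ell1_def
    by (rule infsum_mono[OF abs_summable_coef summable_on_add[OF abs_summable_coef abs_summable_coef]])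
       (simp add: norm_triangle_ineq)
  also have "\<dots> = norm a + norm b"
    unfolding norm_ell1_def by (rule infsum_add) simp_all
  finally show "norm (a + b) \<le> norm a + norm b" .
  show "norm (r *\<^sub>R a) = \<bar>r\<bar> * norm a"
    by (simp add: norm_ell1_def infsum_cmult_right')
qed (rule dist_ell1_def sgn_ell1_def uniformity_ell1_def open_ell1_def)+

end

lemma coef_Ell1: "(\<lambda>k. norm (a k)) summable_on UNIV \<Longrightarrow> coef (Ell1 a) k = a k"
  by (simp add: Ell1_inverse)

lemma sum_coef_le_norm: "finite F \<Longrightarrow> (\<Sum>k\<in>F. norm (coef a k)) \<le> norm a"
  unfolding norm_ell1_def by (rule finite_sum_le_infsum) auto

lemma norm_coef_le: "norm (coef a k) \<le> norm a"
  using sum_coef_le_norm[of "{k}" a] by simp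

lemma norm_ell1_leI: "(\<And>F. finite F \<Longrightarrow> (\<Sum>k\<in>F. norm (coef a k)) \<le> B) \<Longrightarrow> norm a \<le> B"
  unfolding norm_ell1_def by (rule infsum_le_bound)

lemma bounded_linear_coef: "bounded_linear (\<lambda>a. coef a k)"
  by (rule bounded_linear_intro[where K=1]) (auto simp: norm_coef_le)

text \<open>Coordinatewise limits exist because \<open>complex\<close> is complete. The Cauchy
  estimate for finite partial sums passes to these limits, which gives both summability of the limit
  family and convergence in norm.\<close>

instance ell1 :: (type) banach
proof
  fix X :: "nat \<Rightarrow> 'a ell1"
  assume X: "Cauchy X"
  have "Cauchy (\<lambda>n. coef (X n) k)" for k
    using bounded_linear.Cauchy[OF bounded_linear_coef X] .
  then have "\<exists>l. (\<lambda>n. coef (X n) k) \<longlonglongrightarrow> l" for k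
    by (simp add: Cauchy_convergent_iff convergent_def)
  then obtain l where l: "\<And>k. (\<lambda>n. coef (X n) k) \<longlonglongrightarrow> l k"
    by metis
  have tail: "\<exists>N. \<forall>n\<ge>N. \<forall>F. finite F \<longrightarrow> (\<Sum>k\<in>F. norm (coef (X n) k - l k)) \<le> e" if "e > 0" for e
  proof -
    obtain N where N: "\<And>m n. m \<ge> N \<Longrightarrow> n \<ge> N \<Longrightarrow> norm (X m - X n) < e"
      using CauchyD[OF X \<open>e > 0\<close>] by blast
    have "(\<Sum>k\<in>F. norm (coef (X n) k - l k)) \<le> e" if "n \<ge> N" "finite F" for n F
    proof (rule tendsto_upperbound)
      show "(\<lambda>m. \<Sum>k\<in>F. norm (coef (X n) k - coef (X m) k)) \<longlonglongrightarrow> (\<Sum>k\<in>F. norm (coef (X n) k - l k))"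
        by (intro tendsto_intros l)
      show "\<forall>\<^sub>F m in sequentially. (\<Sum>k\<in>F. norm (coef (X n) k - coef (X m) k)) \<le> e"
        using eventually_ge_at_top[of N]
      proof eventually_elim
        case (elim m)
        have "(\<Sum>k\<in>F. norm (coef (X n - X m) k)) \<le> norm (X n - X m)"
          by (rule sum_coef_le_norm) fact
        also have "\<dots> \<le> e" using N[of n m] that elim by simp
        finally show ?case by simp
      qed
    qed simp
    then show ?thesis by blast
  qed
  obtain N where N: "\<And>F. finite F \<Longrightarrow> (\<Sum>k\<in>F. norm (coef (X N) k - l k)) \<le> 1"
    using tail[of 1] by auto
  have "(\<lambda>k. norm (coef (X N) k + (- (coef (X N) k - l k)))) summable_on UNIV"
    by (intro abs_summable_add abs_summable_coef abs_summable_onI_bound[of _ 1])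
       (use N in \<open>simp add: norm_minus_commute\<close>)
  then have sl: "(\<lambda>k. norm (l k)) summable_on UNIV" by simp
  have "X \<longlonglongrightarrow> Ell1 l"
  proof (rule LIMSEQ_I)
    fix e :: real assume "e > 0"
    then obtain N where N: "\<And>n F. n \<ge> N \<Longrightarrow> finite F \<Longrightarrow> (\<Sum>k\<in>F. norm (coef (X n) k - l k)) \<le> e / 2"
      using tail[of "e/2"] by auto
    have "norm (X n - Ell1 l) \<le> e / 2" if "n \<ge> N" for n
      by (rule norm_ell1_leI) (use N that in \<open>simp add: coef_Ell1[OF sl]\<close>)
    moreover have "e / 2 < e" using \<open>e > 0\<close> by simp
    ultimately show "\<exists>no. \<forall>n\<ge>no. norm (X n - Ell1 l) < e"
      by (meson le_less_trans)
  qed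
  then show "convergent X" by (auto simp: convergent_def)
qed

definition ell1_single :: "'k \<Rightarrow> complex \<Rightarrow> 'k ell1" where
  "ell1_single k z = Ell1 (\<lambda>j. if j = k then z else 0)"

lemma sum_norm_if_le: "finite F \<Longrightarrow> (\<Sum>j\<in>F. norm (if j = k then z else 0)) \<le> norm (z :: complex)"
  by (simp add: if_distrib[of norm] cong: if_cong)

lemma coef_ell1_single [simp]: "coef (ell1_single k z) j = (if j = k then z else 0)"
  unfolding ell1_single_def by (subst coef_Ell1) (auto intro: abs_summable_onI_bound sum_norm_if_le)

lemma norm_ell1_single [simp]: "norm (ell1_single k z) = norm z"
proof (rule antisym)
  show "norm (ell1_single k z) \<le> norm z"
    by (rule norm_ell1_leI) (simp add: sum_norm_if_le)
  show "norm z \<le> norm (ell1_single k z)"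
    using norm_coef_le[of "ell1_single k z" k] by simp
qed

lemma bounded_linear_ell1_single: "bounded_linear (ell1_single k)"
  by (rule bounded_linear_intro[where K=1]) (auto intro!: ell1_eqI)

lemma coef_sum: "coef (\<Sum>i\<in>I. f i) k = (\<Sum>i\<in>I. coef (f i) k)"
  by (rule linear_sum[OF bounded_linear.linear[OF bounded_linear_coef]])

text \<open>Absolute convergence in a Banach space provides some sum, and the bounded coordinate
  functionals identify it. The resulting density of finite families underlies separability,
  measurability and every test of a bounded linear map on single coefficients.\<close>

lemma has_sum_ell1_single: "((\<lambda>k. ell1_single k (coef a k)) has_sum a) UNIV"
proof -
  have "\<exists>l. ((\<lambda>k. ell1_single k (coef a k)) has_sum l) UNIV"
    using abs_summable_summable[of "\<lambda>k. ell1_single k (coef a k)" UNIV] abs_summable_coef[of a]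
    by (simp add: summable_on_def[where f="\<lambda>k. ell1_single k (coef a k)"])
  then obtain l where l: "((\<lambda>k. ell1_single k (coef a k)) has_sum l) UNIV" ..
  have "coef l j = coef a j" for j
  proof -
    have "((\<lambda>k. coef (ell1_single k (coef a k)) j) has_sum coef l j) UNIV"
      by (rule has_sum_bounded_linear[OF bounded_linear_coef l])
    moreover have "((\<lambda>k. coef (ell1_single k (coef a k)) j) has_sum coef a j) UNIV"
      by (rule has_sum_finite_neutralI[of "{j}"]) auto
    ultimately show ?thesis by (rule has_sum_unique)
  qed
  then show ?thesis using l ell1_eqI by metis
qed

lemma ell1_finite_approximation:
  assumes "e > 0"
  obtains F where "finite F" "norm (a - (\<Sum>k\<in>F. ell1_single k (coef a k))) < e"
proof -
  obtain F where "finite F" "dist (\<Sum>k\<in>F. ell1_single k (coef a k)) a \<le> e / 2"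
    using has_sum_finite_approximation[OF has_sum_ell1_single, of "e/2" a] assms by auto
  then show ?thesis using assms that[of F] by (simp add: dist_norm norm_minus_commute)
qed

text \<open>\<open>T\<close> is linear over the reals, so the test runs over all complex values z at
  each index.\<close>

lemma bounded_linear_ell1_eq_0:
  assumes "bounded_linear T" "\<And>k z. T (ell1_single k z) = 0"
  shows "T a = 0"
proof -
  have "((\<lambda>k. T (ell1_single k (coef a k))) has_sum T a) UNIV"
    by (rule has_sum_bounded_linear[OF assms(1) has_sum_ell1_single])
  then have "((\<lambda>k :: 'a. 0) has_sum T a) UNIV" by (simp add: assms(2))
  then show ?thesis using has_sum_unique[OF has_sum_0_simp] by metis
qed

section \<open>Coefficient multipliers\<close>

definition mult_coef :: "('k \<Rightarrow> complex) \<Rightarrow> 'k ell1 \<Rightarrow> 'k ell1" where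
  "mult_coef m a = Ell1 (\<lambda>k. m k * coef a k)"

lemma sum_mult_coef_le:
  assumes "\<And>k. norm (m k) \<le> B" "finite F"
  shows "(\<Sum>k\<in>F. norm (m k * coef a k)) \<le> B * norm a"
proof -
  have "(\<Sum>k\<in>F. norm (m k * coef a k)) \<le> (\<Sum>k\<in>F. B * norm (coef a k))"
    by (intro sum_mono) (auto simp: norm_mult intro!: mult_right_mono assms)
  also have "\<dots> \<le> B * norm a"
    using order_trans[OF norm_ge_zero assms(1)]
    by (auto simp: sum_distrib_left[symmetric] intro!: mult_left_mono sum_coef_le_norm assms)
  finally show ?thesis .
qed

text \<open>A bounded symbol keeps the family summable, so that \<open>Ell1\<close> is applied
  inside its range; this is why a bound accompanies every use of \<open>mult_coef\<close>.\<close>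

lemma coef_mult_coef:
  assumes "\<And>k. norm (m k) \<le> B"
  shows "coef (mult_coef m a) k = m k * coef a k"
  unfolding mult_coef_def
  by (rule coef_Ell1, rule abs_summable_onI_bound, rule sum_mult_coef_le) (use assms in auto)

lemma norm_mult_coef_le:
  assumes "\<And>k. norm (m k) \<le> B"
  shows "norm (mult_coef m a) \<le> B * norm a"
  by (rule norm_ell1_leI) (simp add: coef_mult_coef[of m, OF assms] sum_mult_coef_le assms)

lemma bounded_linear_mult_coef:
  assumes "\<And>k. norm (m k) \<le> B"
  shows "bounded_linear (mult_coef m)"
proof (rule bounded_linear_intro[where K=B])
  show "norm (mult_coef m x) \<le> norm x * B" for x
    using norm_mult_coef_le[of m, OF assms] by (simp add: mult.commute)
qed (auto intro!: ell1_eqI simp: coef_mult_coef[of m, OF assms] algebra_simps)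

text \<open>The symbols converge for each k but not uniformly in k, as with the phases of the
  Schroedinger group, so operator norms need not converge. Truncating the limit \<open>a\<close>
  leaves finitely many symbols to control.\<close>

lemma tendsto_mult_coef:
  assumes b: "(b \<longlongrightarrow> a) F" and m: "\<And>k. ((\<lambda>x. m x k) \<longlongrightarrow> m0 k) F"
    and B: "\<And>x k. norm (m x k) \<le> B" and B0: "\<And>k. norm (m0 k) \<le> B"
  shows "((\<lambda>x. mult_coef (m x) (b x)) \<longlongrightarrow> mult_coef m0 a) F"
proof (rule tendstoI)
  fix e :: real assume e: "e > 0"
  have B_nonneg: "B \<ge> 0" using B0 norm_ge_zero order_trans by blast
  \<comment> \<open>The errors outside the truncation amount to \<open>3 * (B * d)\<close>, and this
    d makes \<open>B * d\<close> at most \<open>e / 4\<close>; the last quarter is left for the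
    finite sum. The summand 1 covers B = 0.\<close>
  define d where "d = e / (4 * (B + 1))"
  have d: "d > 0" using e B_nonneg by (simp add: d_def)
  obtain G where G: "finite G" "norm (a - (\<Sum>k\<in>G. ell1_single k (coef a k))) < d"
    using ell1_finite_approximation[OF d] .
  define a' where "a' = (\<Sum>k\<in>G. ell1_single k (coef a k))"
  have "((\<lambda>x. \<Sum>k\<in>G. norm (m x k - m0 k) * norm (coef a k)) \<longlongrightarrow> (\<Sum>k\<in>G. norm (m0 k - m0 k) * norm (coef a k))) F"
    by (intro tendsto_intros m)
  then have ev1: "\<forall>\<^sub>F x in F. (\<Sum>k\<in>G. norm (m x k - m0 k) * norm (coef a k)) < e / 4"
    by (rule order_tendstoD) (use e in simp)
  have ev2: "\<forall>\<^sub>F x in F. dist (b x) a < d"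
    by (rule tendstoD[OF b d])
  show "\<forall>\<^sub>F x in F. dist (mult_coef (m x) (b x)) (mult_coef m0 a) < e"
    using ev1 ev2
  proof eventually_elim
    case (elim x)
    have bd: "norm (m x k - m0 k) \<le> 2 * B" for k
      using norm_triangle_ineq4[of "m x k" "m0 k"] B[of x k] B0[of k] by linarith
    have eq: "mult_coef (m x) (b x) - mult_coef m0 a = mult_coef (m x) (b x - a)
       + (mult_coef (\<lambda>k. m x k - m0 k) (a - a') + mult_coef (\<lambda>k. m x k - m0 k) a')"
      by (rule ell1_eqI)
         (simp add: coef_mult_coef[of "m x", OF B] coef_mult_coef[of m0, OF B0] coef_mult_coef[of "\<lambda>k. m x k - m0 k", OF bd] algebra_simps)
    have n1: "norm (mult_coef (m x) (b x - a)) \<le> B * d"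
      using norm_mult_coef_le[of "m x", OF B, of "b x - a"] elim(2) B_nonneg
      by (intro order_trans[OF _ mult_left_mono[of "norm (b x - a)" d B]]) (auto simp: dist_norm)
    have n2: "norm (mult_coef (\<lambda>k. m x k - m0 k) (a - a')) \<le> 2 * B * d"
      using norm_mult_coef_le[of "\<lambda>k. m x k - m0 k", OF bd, of "a - a'"] G(2) B_nonneg
      by (intro order_trans[OF _ mult_left_mono[of "norm (a - a')" d "2 * B"]]) (auto simp: a'_def)
    have "mult_coef (\<lambda>k. m x k - m0 k) a' = (\<Sum>k\<in>G. ell1_single k ((m x k - m0 k) * coef a k))"
      using G(1) by (intro ell1_eqI) (simp add: coef_mult_coef[of "\<lambda>k. m x k - m0 k", OF bd] a'_def coef_sum)
    then have "norm (mult_coef (\<lambda>k. m x k - m0 k) a') \<le> (\<Sum>k\<in>G. norm (m x k - m0 k) * norm (coef a k))"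
      using norm_sum[of "\<lambda>k. ell1_single k ((m x k - m0 k) * coef a k)" G] by (simp add: norm_mult)
    with elim(1) have n3: "norm (mult_coef (\<lambda>k. m x k - m0 k) a') < e / 4" by simp
    have "norm (mult_coef (m x) (b x) - mult_coef m0 a) < B * d + (2 * B * d + e / 4)"
      unfolding eq
      by (rule norm_triangle_lt, rule add_le_less_mono[OF n1], rule norm_triangle_lt, rule add_le_less_mono[OF n2 n3])
    also have "\<dots> = 3 * (B * d) + e / 4" by simp
    also have "B * d \<le> e / 4"
    proof -
      have "B * d = (B / (B + 1)) * (e / 4)" by (simp add: d_def)
      also have "\<dots> \<le> 1 * (e / 4)"
        using B_nonneg e by (intro mult_right_mono) auto
      finally show ?thesis by simp
    qed
    finally show ?case by (simp add: dist_norm)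
  qed
qed

lemma continuous_on_mult_coef:
  assumes "continuous_on S b" "\<And>k. continuous_on S (\<lambda>x. m x k)" "\<And>x k. norm (m x k) \<le> B"
  shows "continuous_on S (\<lambda>x. mult_coef (m x) (b x))"
  unfolding continuous_on_def
proof
  fix x assume "x \<in> S"
  then show "((\<lambda>x. mult_coef (m x) (b x)) \<longlongrightarrow> mult_coef (m x) (b x)) (at x within S)"
    using assms by (intro tendsto_mult_coef[where B=B]) (simp_all add: continuous_on_def)
qed

text \<open>Second countability makes addition measurable on the product of the Borel
  sigma-algebras, which the independence argument uses. The countable dense set consists of finite
  families with values in a countable dense subset of the plane.\<close>

instance ell1 :: (countable) second_countable_topology
proof
  obtain Q :: "complex set" where Q: "countable Q" "\<And>X. open X \<Longrightarrow> X \<noteq> {} \<Longrightarrow> \<exists>d\<in>Q. d \<in> X"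
    using countable_dense_exists by blast
  define D where "D = (\<lambda>l. \<Sum>(k, z)\<leftarrow>l. ell1_single k z) ` lists ((UNIV :: 'a set) \<times> Q)"
  have D: "countable D" unfolding D_def by (intro countable_image countable_lists countable_SIGMA Q) auto
  have dense: "\<exists>d\<in>D. norm (a - d) < e" if e: "e > 0" for a :: "'a ell1" and e
  proof -
    obtain F where F: "finite F" "norm (a - (\<Sum>k\<in>F. ell1_single k (coef a k))) < e / 2"
      using ell1_finite_approximation[of "e/2" a] e by auto
    \<comment> \<open>Truncation uses up e / 2, and rounding \<open>card F\<close> coefficients by
      less than r each uses at most the other half; the 1 covers an empty F.\<close>
    define r where "r = e / (2 * (real (card F) + 1))"
    have r: "r > 0" using e by (simp add: r_def)
    have "\<exists>z\<in>Q. z \<in> ball (coef a k) r" for k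
      using Q(2)[of "ball (coef a k) r"] r by auto
    then obtain z where z: "\<And>k. z k \<in> Q" "\<And>k. norm (coef a k - z k) < r"
      by (metis mem_ball dist_norm)
    obtain xs where xs: "set xs = F" "distinct xs" using finite_distinct_list[OF F(1)] by blast
    have "(\<Sum>k\<in>F. ell1_single k (z k)) = (\<Sum>(k, z)\<leftarrow>map (\<lambda>k. (k, z k)) xs. ell1_single k z)"
      using xs by (simp add: sum_list_distinct_conv_sum_set comp_def)
    moreover have "map (\<lambda>k. (k, z k)) xs \<in> lists (UNIV \<times> Q)"
      using z by auto
    ultimately have inD: "(\<Sum>k\<in>F. ell1_single k (z k)) \<in> D"
      unfolding D_def by blast
    have "norm ((\<Sum>k\<in>F. ell1_single k (coef a k)) - (\<Sum>k\<in>F. ell1_single k (z k)))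
        = norm (\<Sum>k\<in>F. ell1_single k (coef a k - z k))"
      by (simp add: sum_subtractf linear_diff[OF bounded_linear.linear[OF bounded_linear_ell1_single]])
    also have "\<dots> \<le> (\<Sum>k\<in>F. r)"
      by (rule sum_norm_le) (use z(2) less_imp_le in auto)
    also have "\<dots> \<le> e / 2"
      using e by (simp add: r_def field_simps)
    finally have "norm (a - (\<Sum>k\<in>F. ell1_single k (z k))) < e"
      using F(2) by norm
    then show ?thesis using inD by blast
  qed
  have "topological_basis ((\<lambda>(d, n). ball d (1 / real (Suc n))) ` (D \<times> UNIV))"
  proof (rule topological_basisI)
    fix U and a :: "'a ell1"
    assume "open U" "a \<in> U"
    then obtain e where e: "e > 0" "ball a e \<subseteq> U" by (meson openE)
    obtain n where n: "1 / real (Suc n) < e / 2"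
      using e(1) nat_approx_posE[of "e/2"] by auto
    obtain d where d: "d \<in> D" "norm (a - d) < 1 / real (Suc n)"
      using dense[of "1 / real (Suc n)" a] by auto
    have "ball d (1 / real (Suc n)) \<subseteq> ball a e"
    proof
      fix y assume "y \<in> ball d (1 / real (Suc n))"
      then have "dist a d + dist d y < e"
        using n d(2) by (simp add: dist_norm)
      then show "y \<in> ball a e"
        using dist_triangle[of a y d] by simp
    qed
    then show "\<exists>B'\<in>(\<lambda>(d, n). ball d (1 / real (Suc n))) ` (D \<times> UNIV). a \<in> B' \<and> B' \<subseteq> U"
    proof (intro bexI conjI)
      show "a \<in> ball d (1 / real (Suc n))"
        using d(2) by (simp add: dist_norm norm_minus_commute)
      show "ball d (1 / real (Suc n)) \<in> (\<lambda>(d, n). ball d (1 / real (Suc n))) ` (D \<times> UNIV)"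
        using d(1) by blast
    qed (use e(2) in blast)
  qed (auto simp: image_iff)
  note basis = topological_basis_imp_subbasis[OF this]
  show "\<exists>B :: 'a ell1 set set. countable B \<and> open = generate_topology B"
    by (rule exI, rule conjI[OF _ basis]) (rule countable_image[OF countable_SIGMA[OF D]], simp)
qed

section \<open>Differential equations in Banach spaces\<close>

text \<open>The integral form asks only continuity of b. The interval is fixed, since the final time
  is absorbed into the field.\<close>

definition is_sol :: "(real \<Rightarrow> 'a \<Rightarrow> 'a::banach) \<Rightarrow> 'a \<Rightarrow> (real \<Rightarrow> 'a) \<Rightarrow> bool" where
  "is_sol f x b \<longleftrightarrow> continuous_on {0..1} b \<and>
     (\<forall>t\<in>{0..1}. b t = x + integral {0..t} (\<lambda>\<tau>. f \<tau> (b \<tau>)))"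

lemma is_sol_0: "is_sol f x b \<Longrightarrow> b 0 = x"
  unfolding is_sol_def by (auto dest: bspec[of _ _ 0])

lemma is_solI:
  assumes "\<And>t. t \<in> {0..1} \<Longrightarrow> (b has_vector_derivative f t (b t)) (at t within {0..1})"
  shows "is_sol f (b 0) b"
  unfolding is_sol_def
proof (intro conjI ballI)
  show "continuous_on {0..1} b"
    using assms by (meson continuous_on_eq_continuous_within has_vector_derivative_continuous)
  fix t :: real assume t: "t \<in> {0..1}"
  have "((\<lambda>\<tau>. f \<tau> (b \<tau>)) has_integral (b t - b 0)) {0..t}"
    using t by (intro fundamental_theorem_of_calculus has_vector_derivative_within_subset[OF assms]) auto
  then show "b t = b 0 + integral {0..t} (\<lambda>\<tau>. f \<tau> (b \<tau>))"
    by (simp add: integral_unique)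
qed

lemma is_solD:
  assumes "is_sol f x b" "continuous_on {0..1} (\<lambda>\<tau>. f \<tau> (b \<tau>))" "t \<in> {0..1}"
  shows "(b has_vector_derivative f t (b t)) (at t within {0..1})"
proof -
  have "((\<lambda>t. x + integral {0..t} (\<lambda>\<tau>. f \<tau> (b \<tau>))) has_vector_derivative (0 + f t (b t))) (at t within {0..1})"
    using assms by (intro has_vector_derivative_add has_vector_derivative_const integral_has_vector_derivative) auto
  then show ?thesis
    using assms(1,3) unfolding is_sol_def
    by (intro has_vector_derivative_transform[of t "{0..1}" b "\<lambda>t. x + integral {0..t} (\<lambda>\<tau>. f \<tau> (b \<tau>))"]) auto
qed

text \<open>The exponent is the weight l = 2 L + 1, for which L / l <= 1/2; the factor 2 comes from
  absorbing half of a weighted maximum.\<close>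

definition gronwall_const :: "real \<Rightarrow> real" where "gronwall_const L = 2 * exp (2 * L + 1)"

lemma gronwall_const_pos: "gronwall_const L > 0"
  by (simp add: gronwall_const_def)

lemma integral_exp_le:
  assumes "l > 0" "s \<ge> (0::real)"
  shows "integral {0..s} (\<lambda>\<tau>. exp (l * \<tau>)) \<le> exp (l * s) / l"
proof -
  have "((\<lambda>\<tau>. exp (l * \<tau>)) has_integral (exp (l * s) / l - exp (l * 0) / l)) {0..s}"
    using assms by (intro fundamental_theorem_of_calculus)
       (auto simp: has_real_derivative_iff_has_vector_derivative[symmetric] intro!: derivative_eq_intros)
  then show ?thesis using assms by (simp add: integral_unique)
qed

text \<open>Let M be the maximum of exp (- l t) * norm (e t), attained at s. The integral term at s
  contributes at most M * L / l <= M / 2, so M <= A + M / 2.\<close>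

lemma gronwall:
  fixes e :: "real \<Rightarrow> 'a::banach"
  assumes e: "continuous_on {0..1} e" and L: "L \<ge> 0"
    and le: "\<And>t. t \<in> {0..1} \<Longrightarrow> norm (e t) \<le> A + L * integral {0..t} (\<lambda>\<tau>. norm (e \<tau>))"
    and t: "t \<in> {0..1}"
  shows "norm (e t) \<le> gronwall_const L * A"
proof -
  define l where "l = 2 * L + 1"
  have l: "l > 0" "L / l \<le> 1 / 2" using L by (auto simp: l_def field_simps)
  have "continuous_on {0..1} (\<lambda>t. exp (- l * t) * norm (e t))"
    by (intro continuous_intros e)
  from continuous_attains_sup[OF compact_Icc _ this]
  obtain s where s: "s \<in> {0..1}" "\<And>t. t \<in> {0..1} \<Longrightarrow> exp (- l * t) * norm (e t) \<le> exp (- l * s) * norm (e s)"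
    by auto
  define M where "M = exp (- l * s) * norm (e s)"
  have M: "norm (e t) \<le> M * exp (l * t)" if "t \<in> {0..1}" for t
  proof -
    have "norm (e t) = (exp (- l * t) * norm (e t)) * exp (l * t)"
      by (simp add: exp_minus field_simps)
    also have "\<dots> \<le> M * exp (l * t)"
      unfolding M_def by (intro mult_right_mono s that) auto
    finally show ?thesis .
  qed
  have M0: "M \<ge> 0" by (simp add: M_def)
  have A: "A \<ge> 0" using order_trans[OF norm_ge_zero le[of 0]] by simp
  have "integral {0..s} (\<lambda>\<tau>. norm (e \<tau>)) \<le> integral {0..s} (\<lambda>\<tau>. M * exp (l * \<tau>))"
  proof (rule integral_le)
    show "(\<lambda>\<tau>. norm (e \<tau>)) integrable_on {0..s}"
      using s(1) by (intro integrable_continuous_interval continuous_on_norm continuous_on_subset[OF e]) auto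
    show "(\<lambda>\<tau>. M * exp (l * \<tau>)) integrable_on {0..s}"
      by (intro integrable_continuous_interval continuous_intros)
  qed (use M s(1) in auto)
  also have "\<dots> = M * integral {0..s} (\<lambda>\<tau>. exp (l * \<tau>))" by simp
  also have "\<dots> \<le> M * (exp (l * s) / l)"
    using M0 integral_exp_le[OF l(1)] s(1) by (intro mult_left_mono) auto
  finally have I: "integral {0..s} (\<lambda>\<tau>. norm (e \<tau>)) \<le> M * (exp (l * s) / l)" .
  have "M \<le> exp (- l * s) * (A + L * (M * (exp (l * s) / l)))"
    unfolding M_def[symmetric]
    by (subst M_def) (intro mult_left_mono order_trans[OF le[OF s(1)]] add_left_mono I L, simp)
  also have "\<dots> = exp (- l * s) * A + M * (L / l)"
    by (simp add: exp_minus field_simps)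
  also have "\<dots> \<le> 1 * A + M * (1 / 2)"
    using A M0 l s(1) by (intro add_mono mult_right_mono mult_left_mono) auto
  finally have M2: "M \<le> 2 * A" by simp
  have "norm (e t) \<le> M * exp (l * t)" using M[OF t] .
  also have "\<dots> \<le> (2 * A) * exp (l * 1)"
    using M2 A l t by (intro mult_mono) auto
  finally show ?thesis by (simp add: gronwall_const_def l_def mult_ac)
qed

text \<open>A single estimate for stability and differentiability: d = 0 compares two solutions, and
  d quadratic in the change of datum controls the linearisation error. As the interval has length 1,
  d integrates to at most d.\<close>

lemma gronwall_integral_eq:
  fixes e r :: "real \<Rightarrow> 'a::banach"
  assumes e: "continuous_on {0..1} e" and r: "continuous_on {0..1} r" and L: "L \<ge> 0"
    and eq: "\<And>t. t \<in> {0..1} \<Longrightarrow> e t = e0 + integral {0..t} r"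
    and le: "\<And>t. t \<in> {0..1} \<Longrightarrow> norm (r t) \<le> L * norm (e t) + d"
    and d: "d \<ge> 0" and t: "t \<in> {0..1}"
  shows "norm (e t) \<le> gronwall_const L * (norm e0 + d)"
proof (rule gronwall[OF e L _ t])
  fix t :: real assume t: "t \<in> {0..1}"
  have ce: "continuous_on {0..t} (\<lambda>\<tau>. norm (e \<tau>))"
    using t by (intro continuous_on_norm continuous_on_subset[OF e]) auto
  have "norm (integral {0..t} r) \<le> integral {0..t} (\<lambda>\<tau>. L * norm (e \<tau>) + d)"
    using t le by (intro integral_norm_bound_integral integrable_continuous_interval continuous_intros ce continuous_on_subset[OF r]) auto
  also have "\<dots> = L * integral {0..t} (\<lambda>\<tau>. norm (e \<tau>)) + t * d"
    using t by (subst integral_add) (auto intro!: integrable_continuous_interval continuous_intros ce)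
  finally have "norm (e t) \<le> norm e0 + (L * integral {0..t} (\<lambda>\<tau>. norm (e \<tau>)) + t * d)"
    unfolding eq[OF t] by (rule norm_triangle_le[OF add_left_mono])
  moreover have "t * d \<le> 1 * d"
    using t d by (intro mult_right_mono) auto
  ultimately show "norm (e t) \<le> norm e0 + d + L * integral {0..t} (\<lambda>\<tau>. norm (e \<tau>))"
    by linarith
qed

text \<open>The fixed point is sought among bounded continuous functions on the whole line;
  continuing a curve by its endpoint values places it there.\<close>

lemma clamp_bcontfun:
  fixes h :: "real \<Rightarrow> 'a::real_normed_vector"
  assumes h: "continuous_on {0..1} h"
  shows "(\<lambda>t. h (max 0 (min 1 t))) \<in> bcontfun"
proof -
  have "continuous_on UNIV (\<lambda>t::real. h (max 0 (min 1 t)))"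
    by (intro continuous_on_compose2[OF h] continuous_intros) auto
  moreover have "bounded (range (\<lambda>t::real. h (max 0 (min 1 t))))"
    by (rule bounded_subset[OF compact_imp_bounded[OF compact_continuous_image[OF h compact_Icc]]]) auto
  ultimately show ?thesis by (simp add: bcontfun_def)
qed

lemma lipschitz_ode_exists:
  fixes f :: "real \<Rightarrow> 'a::banach \<Rightarrow> 'a"
  assumes cont: "\<And>b. continuous_on {0..1} b \<Longrightarrow> continuous_on {0..1} (\<lambda>\<tau>. f \<tau> (b \<tau>))"
    and lip: "\<And>\<tau> x y. \<tau> \<in> {0..1} \<Longrightarrow> norm (f \<tau> x - f \<tau> y) \<le> L * norm (x - y)" and L: "L \<ge> 0"
  obtains b where "is_sol f x b"
proof -
  define l where "l = 2 * L + 1"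
  have l: "l > 0" "L / l \<le> 1 / 2" using L by (auto simp: l_def field_simps)
  \<comment> \<open>with the weight \<open>e\<^sup>-\<^sup>l\<^sup>t\<close> the Picard map is a contraction on the whole interval\<close>
  define h where "h v t = exp (- l * t) *\<^sub>R (x + integral {0..t} (\<lambda>\<tau>. f \<tau> (exp (l * \<tau>) *\<^sub>R v \<tau>)))"
    for v :: "real \<Rightarrow> 'a" and t
  have cf: "continuous_on {0..1} (\<lambda>\<tau>. f \<tau> (exp (l * \<tau>) *\<^sub>R apply_bcontfun v \<tau>))" for v :: "real \<Rightarrow>\<^sub>C 'a"
    by (intro cont continuous_intros continuous_on_apply_bcontfun)
  have ch: "continuous_on {0..1} (h (apply_bcontfun v))" for v :: "real \<Rightarrow>\<^sub>C 'a"
    unfolding h_def by (intro continuous_intros indefinite_integral_continuous_1 integrable_continuous_interval cf)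
  define P where "P v = Bcontfun (\<lambda>t. h (apply_bcontfun v) (max 0 (min 1 t)))" for v :: "real \<Rightarrow>\<^sub>C 'a"
  have P: "apply_bcontfun (P v) t = h (apply_bcontfun v) (max 0 (min 1 t))" for v t
    unfolding P_def by (subst Bcontfun_inverse) (auto intro: clamp_bcontfun ch)
  have "dist (P v) (P w) \<le> 1 / 2 * dist v w" for v w
  proof (rule dist_bound)
    fix t :: real
    define s where "s = max 0 (min 1 t)"
    have s: "s \<in> {0..1}" by (auto simp: s_def)
    define D where "D = dist v w"
    have D: "norm (apply_bcontfun v \<tau> - apply_bcontfun w \<tau>) \<le> D" for \<tau>
      unfolding D_def dist_norm[symmetric] by (rule dist_bounded)
    let ?F = "\<lambda>v \<tau>. f \<tau> (exp (l * \<tau>) *\<^sub>R apply_bcontfun v \<tau>)"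
    have int: "?F v integrable_on {0..s}" for v
      using s by (intro integrable_continuous_interval continuous_on_subset[OF cf]) auto
    have "norm (integral {0..s} (\<lambda>\<tau>. ?F v \<tau> - ?F w \<tau>)) \<le> integral {0..s} (\<lambda>\<tau>. (L * D) * exp (l * \<tau>))"
    proof (rule integral_norm_bound_integral)
      show "(\<lambda>\<tau>. ?F v \<tau> - ?F w \<tau>) integrable_on {0..s}"
        by (intro integrable_diff int)
      show "(\<lambda>\<tau>. (L * D) * exp (l * \<tau>)) integrable_on {0..s}"
        by (intro integrable_continuous_interval continuous_intros)
      fix \<tau> assume \<tau>: "\<tau> \<in> {0..s}"
      have "norm (?F v \<tau> - ?F w \<tau>) \<le> L * norm (exp (l * \<tau>) *\<^sub>R (apply_bcontfun v \<tau> - apply_bcontfun w \<tau>))"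
        using lip[of \<tau>] \<tau> s by (simp add: scaleR_diff_right)
      also have "\<dots> \<le> L * (exp (l * \<tau>) * D)"
        using L D by (intro mult_left_mono) auto
      finally show "norm (?F v \<tau> - ?F w \<tau>) \<le> (L * D) * exp (l * \<tau>)" by (simp add: mult_ac)
    qed
    also have "\<dots> = (L * D) * integral {0..s} (\<lambda>\<tau>. exp (l * \<tau>))" by simp
    also have "\<dots> \<le> (L * D) * (exp (l * s) / l)"
      using s L by (intro mult_left_mono integral_exp_le l) (auto simp: D_def)
    finally have I: "norm (integral {0..s} (\<lambda>\<tau>. ?F v \<tau> - ?F w \<tau>)) \<le> (L * D) * (exp (l * s) / l)" .
    have "h (apply_bcontfun v) s - h (apply_bcontfun w) s = exp (- l * s) *\<^sub>R integral {0..s} (\<lambda>\<tau>. ?F v \<tau> - ?F w \<tau>)"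
      unfolding h_def integral_diff[OF int int, of v w] scaleR_diff_right[symmetric] by simp
    then have "dist (P v t) (P w t) = exp (- l * s) * norm (integral {0..s} (\<lambda>\<tau>. ?F v \<tau> - ?F w \<tau>))"
      by (simp add: P s_def[symmetric] dist_norm)
    also have "\<dots> \<le> exp (- l * s) * ((L * D) * (exp (l * s) / l))"
      by (intro mult_left_mono I) auto
    also have "\<dots> = (L / l) * D" by (simp add: exp_minus field_simps)
    also have "\<dots> \<le> 1 / 2 * D" using l by (intro mult_right_mono) (auto simp: D_def)
    finally show "dist (P v t) (P w t) \<le> 1 / 2 * dist v w" by (simp add: D_def)
  qed
  then obtain v where v: "P v = v"
    using banach_fix_type[of "1/2" P] by auto
  have "is_sol f x (\<lambda>t. exp (l * t) *\<^sub>R apply_bcontfun v t)"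
    unfolding is_sol_def
  proof (intro conjI ballI)
    show "continuous_on {0..1} (\<lambda>t. exp (l * t) *\<^sub>R apply_bcontfun v t)"
      by (intro continuous_intros continuous_on_apply_bcontfun)
    fix t :: real assume t: "t \<in> {0..1}"
    then have "apply_bcontfun v t = h (apply_bcontfun v) t"
      using P[of v t] v by simp
    then show "exp (l * t) *\<^sub>R apply_bcontfun v t = x + integral {0..t} (\<lambda>\<tau>. f \<tau> (exp (l * \<tau>) *\<^sub>R apply_bcontfun v \<tau>))"
      by (simp add: h_def exp_minus)
  qed
  then show ?thesis by (rule that)
qed

text \<open>Precomposition with the radial projection makes a locally Lipschitz field globally Lipschitz.\<close>

definition ball_proj :: "real \<Rightarrow> 'a \<Rightarrow> 'a::real_normed_vector" where
  "ball_proj R x = (R / max R (norm x)) *\<^sub>R x"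

lemma ball_proj_id: "R > 0 \<Longrightarrow> norm x \<le> R \<Longrightarrow> ball_proj R x = x"
  by (simp add: ball_proj_def max_def)

lemma norm_ball_proj_le: "R > 0 \<Longrightarrow> norm (ball_proj R x) \<le> R"
  by (auto simp: ball_proj_def max_def field_simps)

text \<open>In a general normed space the radial projection need not be nonexpansive: moving the
  point and changing the scaling factor each contribute up to \<open>norm (x - y)\<close>, whence
  the 2.\<close>

lemma ball_proj_lipschitz:
  assumes R: "R > 0"
  shows "norm (ball_proj R x - ball_proj R y) \<le> 2 * norm (x - y)"
proof -
  define m where "m x = max R (norm x)" for x :: 'a
  have m: "m x \<ge> R" "m x \<ge> norm x" "m x > 0" for x using R by (auto simp: m_def)
  have "\<bar>m y - m x\<bar> \<le> norm (x - y)"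
    using norm_triangle_ineq2[of x y] norm_triangle_ineq2[of y x] by (auto simp: m_def norm_minus_commute)
  have "ball_proj R x - ball_proj R y = (R / m x) *\<^sub>R (x - y) + (R / m x - R / m y) *\<^sub>R y"
    by (simp add: ball_proj_def m_def algebra_simps)
  moreover have "norm ((R / m x) *\<^sub>R (x - y)) \<le> 1 * norm (x - y)"
    unfolding norm_scaleR using R m[of x] by (intro mult_right_mono) auto
  moreover have "norm ((R / m x - R / m y) *\<^sub>R y) \<le> norm (x - y)"
  proof -
    have "R / m x - R / m y = (R / m x) * ((m y - m x) / m y)"
      using m(3)[of x] m(3)[of y] by (simp add: field_simps)
    then have "norm ((R / m x - R / m y) *\<^sub>R y) = (R / m x) * (\<bar>m y - m x\<bar> * (norm y / m y))"
      using m(3)[of x] m(3)[of y] R by (simp add: abs_mult)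
    also have "\<dots> \<le> 1 * (norm (x - y) * 1)"
      using m[of x] m[of y] R \<open>\<bar>m y - m x\<bar> \<le> norm (x - y)\<close> by (intro mult_mono) auto
    finally show ?thesis by simp
  qed
  ultimately show ?thesis
    using norm_triangle_ineq[of "(R / m x) *\<^sub>R (x - y)" "(R / m x - R / m y) *\<^sub>R y"] by simp
qed

lemma continuous_on_ball_proj:
  assumes "R > 0" "continuous_on S b"
  shows "continuous_on S (\<lambda>t. ball_proj R (b t))"
  unfolding ball_proj_def using assms by (intro continuous_intros) auto

text \<open>Continuity is required along curves, which is how it enters the integral equation and
  what a strongly continuous propagator provides. The quadratic remainder, uniform in time and on
  balls, stands for a locally Lipschitz derivative; it yields both local Lipschitz bounds and
  differentiability of the flow.\<close>

locale c11_field =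
  fixes f :: "real \<Rightarrow> 'a::banach \<Rightarrow> 'a" and f' :: "real \<Rightarrow> 'a \<Rightarrow> 'a \<Rightarrow> 'a"
  assumes cont: "continuous_on {0..1} b \<Longrightarrow> continuous_on {0..1} (\<lambda>\<tau>. f \<tau> (b \<tau>))"
    and cont': "continuous_on {0..1} b \<Longrightarrow> continuous_on {0..1} w \<Longrightarrow>
      continuous_on {0..1} (\<lambda>\<tau>. f' \<tau> (b \<tau>) (w \<tau>))"
    and lin: "linear (f' \<tau> x)"
    and bound: "\<exists>C\<ge>0. \<forall>\<tau>\<in>{0..1}. \<forall>x y w. norm x \<le> R \<longrightarrow> norm y \<le> R \<longrightarrow>
      norm (f' \<tau> x w) \<le> C * norm w \<and> norm (f \<tau> y - f \<tau> x - f' \<tau> x (y - x)) \<le> C * (norm (y - x))\<^sup>2"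
begin

text \<open>On a ball \<open>norm (y - x)\<close> is at most twice the radius, which turns the
  quadratic remainder into a linear bound.\<close>

lemma lipschitz:
  obtains L where "L \<ge> 0" "\<And>\<tau> x y. \<tau> \<in> {0..1} \<Longrightarrow> norm x \<le> R \<Longrightarrow> norm y \<le> R \<Longrightarrow> norm (f \<tau> x - f \<tau> y) \<le> L * norm (x - y)"
proof -
  from bound[of R] obtain C where C: "C \<ge> 0" "\<And>\<tau> x w. \<tau> \<in> {0..1} \<Longrightarrow> norm x \<le> R \<Longrightarrow> norm (f' \<tau> x w) \<le> C * norm w"
    "\<And>\<tau> x y. \<tau> \<in> {0..1} \<Longrightarrow> norm x \<le> R \<Longrightarrow> norm y \<le> R \<Longrightarrow> norm (f \<tau> y - f \<tau> x - f' \<tau> x (y - x)) \<le> C * (norm (y - x))\<^sup>2"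
    by metis
  have "norm (f \<tau> y - f \<tau> x) \<le> (C + C * (2 * \<bar>R\<bar>)) * norm (y - x)" if "\<tau> \<in> {0..1}" "norm x \<le> R" "norm y \<le> R" for \<tau> x y
  proof -
    have "norm (y - x) \<le> 2 * \<bar>R\<bar>" using norm_triangle_ineq4[of y x] that by linarith
    then have "C * (norm (y - x))\<^sup>2 \<le> C * (2 * \<bar>R\<bar> * norm (y - x))"
      unfolding power2_eq_square using C(1) by (intro mult_left_mono mult_right_mono) auto
    then have "norm (f \<tau> y - f \<tau> x) \<le> C * (2 * \<bar>R\<bar> * norm (y - x)) + C * norm (y - x)"
      using C(3)[OF that] C(2)[OF that(1,2), of "y - x"] norm_triangle_sub[of "f \<tau> y - f \<tau> x" "f' \<tau> x (y - x)"] by linarith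
    then show ?thesis by (simp add: algebra_simps)
  qed
  then show ?thesis using that[of "C + C * (2 * \<bar>R\<bar>)"] C(1) by (metis add_nonneg_nonneg mult_nonneg_nonneg abs_ge_zero zero_le_numeral)
qed

lemma sol_bounded:
  assumes "is_sol f x b"
  obtains R where "R > 0" "\<And>t. t \<in> {0..1} \<Longrightarrow> norm (b t) \<le> R"
proof -
  have "bounded (b ` {0..1})"
    using assms unfolding is_sol_def by (blast intro: compact_imp_bounded compact_continuous_image)
  then obtain R where "R > 0" "\<And>y. y \<in> b ` {0..1} \<Longrightarrow> norm y \<le> R"
    by (meson bounded_pos)
  then show ?thesis using that by auto
qed

lemma sol_stable:
  assumes b: "is_sol f x b" and c: "is_sol f y c"
    and R: "\<And>t. t \<in> {0..1} \<Longrightarrow> norm (b t) \<le> R" "\<And>t. t \<in> {0..1} \<Longrightarrow> norm (c t) \<le> R"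
    and L: "L \<ge> 0" "\<And>\<tau> x y. \<tau> \<in> {0..1} \<Longrightarrow> norm x \<le> R \<Longrightarrow> norm y \<le> R \<Longrightarrow> norm (f \<tau> x - f \<tau> y) \<le> L * norm (x - y)"
    and t: "t \<in> {0..1}"
  shows "norm (c t - b t) \<le> gronwall_const L * norm (y - x)"
proof -
  have int: "(\<lambda>\<tau>. f \<tau> (b \<tau>)) integrable_on {0..t}" if "is_sol f x b" "t \<in> {0..1}" for x b t
    using that by (intro integrable_continuous_interval continuous_on_subset[OF cont]) (auto simp: is_sol_def)
  have "norm (c t - b t) \<le> gronwall_const L * (norm (y - x) + 0)"
  proof (rule gronwall_integral_eq[of "\<lambda>t. c t - b t" "\<lambda>\<tau>. f \<tau> (c \<tau>) - f \<tau> (b \<tau>)"])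
    show "continuous_on {0..1} (\<lambda>t. c t - b t)" "continuous_on {0..1} (\<lambda>\<tau>. f \<tau> (c \<tau>) - f \<tau> (b \<tau>))"
      using b c by (auto simp: is_sol_def intro!: continuous_intros cont)
    fix t :: real assume t: "t \<in> {0..1}"
    show "norm (f t (c t) - f t (b t)) \<le> L * norm (c t - b t) + 0"
      using L(2)[OF t R(2) R(1)] t by simp
    show "c t - b t = y - x + integral {0..t} (\<lambda>\<tau>. f \<tau> (c \<tau>) - f \<tau> (b \<tau>))"
      using b c t by (subst integral_diff[OF int[OF c t] int[OF b t]]) (simp add: is_sol_def)
  qed (use L t in auto)
  then show ?thesis by simp
qed

lemma sol_unique:
  assumes b: "is_sol f x b" and c: "is_sol f x c" and t: "t \<in> {0..1}"
  shows "c t = b t"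
proof -
  obtain R1 where R1: "\<And>t. t \<in> {0..1} \<Longrightarrow> norm (b t) \<le> R1" using sol_bounded[OF b] by blast
  obtain R2 where R2: "\<And>t. t \<in> {0..1} \<Longrightarrow> norm (c t) \<le> R2" using sol_bounded[OF c] by blast
  define R where "R = max R1 R2"
  obtain L where L: "L \<ge> 0" "\<And>\<tau> x y. \<tau> \<in> {0..1} \<Longrightarrow> norm x \<le> R \<Longrightarrow> norm y \<le> R \<Longrightarrow> norm (f \<tau> x - f \<tau> y) \<le> L * norm (x - y)"
    using lipschitz by blast
  have "norm (c t - b t) \<le> gronwall_const L * norm (x - x)"
    by (rule sol_stable[OF b c, of R, OF _ _ L t]) (simp_all add: R_def R1 R2 le_max_iff_disj)
  then show ?thesis by simp
qed

text \<open>The truncated field has a solution from y on the whole interval, and Gronwall compares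
  it with b, along which truncation changes nothing. For y close to x it stays in the ball where
  both fields agree, so it solves the original equation up to time 1 with no continuation
  argument.\<close>

lemma sol_nearby:
  assumes b: "is_sol f x b"
  obtains \<delta> K R where "\<delta> > 0" "K > 0" "\<And>t. t \<in> {0..1} \<Longrightarrow> norm (b t) \<le> R"
    "\<And>y. norm (y - x) < \<delta> \<Longrightarrow> \<exists>c. is_sol f y c \<and> (\<forall>t\<in>{0..1}. norm (c t) \<le> R \<and> norm (c t - b t) \<le> K * norm (y - x))"
proof -
  obtain R0 where R0: "R0 > 0" "\<And>t. t \<in> {0..1} \<Longrightarrow> norm (b t) \<le> R0" using sol_bounded[OF b] by blast
  \<comment> \<open>The margin 1 is the deviation from b granted to neighbouring solutions; the
    radius \<open>1 / K\<close> below enforces it.\<close>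
  define R where "R = R0 + 1"
  have R: "R > 0" using R0 by (simp add: R_def)
  obtain L where L: "L \<ge> 0" "\<And>\<tau> x y. \<tau> \<in> {0..1} \<Longrightarrow> norm x \<le> R \<Longrightarrow> norm y \<le> R \<Longrightarrow> norm (f \<tau> x - f \<tau> y) \<le> L * norm (x - y)"
    using lipschitz by blast
  define g where "g \<tau> x = f \<tau> (ball_proj R x)" for \<tau> x
  have cg: "continuous_on {0..1} (\<lambda>\<tau>. g \<tau> (b \<tau>))" if "continuous_on {0..1} b" for b
    unfolding g_def by (intro cont continuous_on_ball_proj R that)
  have lg: "norm (g \<tau> x - g \<tau> y) \<le> (2 * L) * norm (x - y)" if "\<tau> \<in> {0..1}" for \<tau> x y
  proof -
    have "norm (g \<tau> x - g \<tau> y) \<le> L * norm (ball_proj R x - ball_proj R y)"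
      unfolding g_def by (intro L that norm_ball_proj_le R)
    also have "\<dots> \<le> L * (2 * norm (x - y))"
      by (intro mult_left_mono L ball_proj_lipschitz R)
    finally show ?thesis by simp
  qed
  \<comment> \<open>The rate is doubled by the Lipschitz constant 2 of the radial
    projection.\<close>
  define K where "K = gronwall_const (2 * L)"
  have K: "K > 0" by (simp add: K_def gronwall_const_pos)
  have ex: "\<exists>c. is_sol f y c \<and> (\<forall>t\<in>{0..1}. norm (c t) \<le> R \<and> norm (c t - b t) \<le> K * norm (y - x))"
    if y: "norm (y - x) < 1 / K" for y
  proof -
    obtain c where c: "is_sol g y c"
      using lipschitz_ode_exists[of g "2 * L" y] cg lg L(1) by auto
    have bg: "g \<tau> (b \<tau>) = f \<tau> (b \<tau>)" if "\<tau> \<in> {0..1}" for \<tau>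
      unfolding g_def using R0(2)[OF that] by (subst ball_proj_id[OF R]) (auto simp: R_def)
    have cb: "continuous_on {0..1} b" "continuous_on {0..1} c" using b c by (auto simp: is_sol_def)
    have diff: "norm (c t - b t) \<le> K * (norm (y - x) + 0)" if t: "t \<in> {0..1}" for t
      unfolding K_def
    proof (rule gronwall_integral_eq[of "\<lambda>t. c t - b t" "\<lambda>\<tau>. g \<tau> (c \<tau>) - g \<tau> (b \<tau>)"])
      show "continuous_on {0..1} (\<lambda>t. c t - b t)" "continuous_on {0..1} (\<lambda>\<tau>. g \<tau> (c \<tau>) - g \<tau> (b \<tau>))"
        by (intro continuous_intros cg cb)+
      fix t :: real assume t: "t \<in> {0..1}"
      show "norm (g t (c t) - g t (b t)) \<le> (2 * L) * norm (c t - b t) + 0"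
        using lg[OF t] by simp
      have i: "(\<lambda>\<tau>. g \<tau> (u \<tau>)) integrable_on {0..t}" if "continuous_on {0..1} u" for u
        using t by (intro integrable_continuous_interval continuous_on_subset[OF cg[OF that]]) auto
      have "integral {0..t} (\<lambda>\<tau>. g \<tau> (b \<tau>)) = integral {0..t} (\<lambda>\<tau>. f \<tau> (b \<tau>))"
        using t by (intro integral_cong bg) auto
      then show "c t - b t = y - x + integral {0..t} (\<lambda>\<tau>. g \<tau> (c \<tau>) - g \<tau> (b \<tau>))"
        using b c t by (subst integral_diff[OF i[OF cb(2)] i[OF cb(1)]]) (simp add: is_sol_def)
    qed (use L t in auto)
    have cR: "norm (c t) \<le> R" if t: "t \<in> {0..1}" for t
    proof -
      have "K * norm (y - x) \<le> 1" using y K by (simp add: field_simps)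
      then show ?thesis
        using diff[OF t] R0(2)[OF t] norm_triangle_sub[of "c t" "b t"] by (simp add: R_def)
    qed
    have "is_sol f y c"
      unfolding is_sol_def
    proof (intro conjI ballI cb)
      fix t :: real assume t: "t \<in> {0..1}"
      have "integral {0..t} (\<lambda>\<tau>. g \<tau> (c \<tau>)) = integral {0..t} (\<lambda>\<tau>. f \<tau> (c \<tau>))"
        unfolding g_def using t cR by (intro integral_cong) (simp add: ball_proj_id[OF R])
      then show "c t = y + integral {0..t} (\<lambda>\<tau>. f \<tau> (c \<tau>))"
        using c t by (simp add: is_sol_def)
    qed
    then show ?thesis using cR diff by auto
  qed
  show ?thesis
    by (rule that[of "1 / K" K R]) (use K R0 ex in \<open>auto simp: R_def intro: order_trans add_increasing2\<close>)
qed

definition flow_dom :: "'a set" where "flow_dom = {x. \<exists>b. is_sol f x b}"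

text \<open>Meaningful on \<open>flow_dom\<close>, where uniqueness makes the choice of b
  immaterial.\<close>

definition time_one :: "'a \<Rightarrow> 'a" where "time_one x = (SOME b. is_sol f x b) 1"

lemma time_one_eq:
  assumes "is_sol f x b"
  shows "time_one x = b 1"
  unfolding time_one_def by (rule sol_unique[OF assms someI[of "is_sol f x", OF assms]]) simp

lemma open_flow_dom: "open flow_dom"
  unfolding open_dist
proof
  fix x assume "x \<in> flow_dom"
  then obtain b where "is_sol f x b" by (auto simp: flow_dom_def)
  from sol_nearby[OF this] obtain \<delta> where "\<delta> > 0" "\<And>y. norm (y - x) < \<delta> \<Longrightarrow> \<exists>c. is_sol f y c"
    by metis
  then show "\<exists>e>0. \<forall>y. dist y x < e \<longrightarrow> y \<in> flow_dom"
    by (auto simp: flow_dom_def dist_norm)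
qed

end

section \<open>The linearised equation\<close>

lemma linear_ode:
  fixes A :: "real \<Rightarrow> 'a::banach \<Rightarrow> 'a"
  assumes cont: "\<And>w. continuous_on {0..1} w \<Longrightarrow> continuous_on {0..1} (\<lambda>\<tau>. A \<tau> (w \<tau>))"
    and lin: "\<And>\<tau>. \<tau> \<in> {0..1} \<Longrightarrow> linear (A \<tau>)"
    and C: "C \<ge> 0" "\<And>\<tau> w. \<tau> \<in> {0..1} \<Longrightarrow> norm (A \<tau> w) \<le> C * norm w"
  shows linear_ode_exists: "\<exists>w. is_sol A h w"
    and linear_ode_unique: "is_sol A h w \<Longrightarrow> is_sol A h w' \<Longrightarrow> t \<in> {0..1} \<Longrightarrow> w t = w' t"
    and linear_ode_bound: "is_sol A h w \<Longrightarrow> t \<in> {0..1} \<Longrightarrow> norm (w t) \<le> gronwall_const C * norm h"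
    and linear_ode_combination: "is_sol A h w \<Longrightarrow> is_sol A k v \<Longrightarrow>
      is_sol A (r *\<^sub>R h + q *\<^sub>R k) (\<lambda>t. r *\<^sub>R w t + q *\<^sub>R v t)"
proof -
  show "\<exists>w. is_sol A h w"
    using lipschitz_ode_exists[of A C h] cont C lin by (metis linear_diff)
  have int: "(\<lambda>\<tau>. A \<tau> (w \<tau>)) integrable_on {0..t}" if "is_sol A h w" "t \<in> {0..1}" for h w t
    using that by (intro integrable_continuous_interval continuous_on_subset[OF cont]) (auto simp: is_sol_def)
  have bd: "norm (w t) \<le> gronwall_const C * norm h" if "is_sol A h w" "t \<in> {0..1}" for h w t
    using gronwall_integral_eq[of w "\<lambda>\<tau>. A \<tau> (w \<tau>)" C h 0 t] that cont C by (simp add: is_sol_def)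
  then show "is_sol A h w \<Longrightarrow> t \<in> {0..1} \<Longrightarrow> norm (w t) \<le> gronwall_const C * norm h" .
  have comb: "is_sol A (r *\<^sub>R h + q *\<^sub>R k) (\<lambda>t. r *\<^sub>R w t + q *\<^sub>R v t)"
    if w: "is_sol A h w" and v: "is_sol A k v" for r q h k w v
    unfolding is_sol_def
  proof (intro conjI ballI)
    show "continuous_on {0..1} (\<lambda>t. r *\<^sub>R w t + q *\<^sub>R v t)"
      using w v by (auto simp: is_sol_def intro!: continuous_intros)
    fix t :: real assume t: "t \<in> {0..1}"
    have "integral {0..t} (\<lambda>\<tau>. A \<tau> (r *\<^sub>R w \<tau> + q *\<^sub>R v \<tau>)) = integral {0..t} (\<lambda>\<tau>. r *\<^sub>R A \<tau> (w \<tau>) + q *\<^sub>R A \<tau> (v \<tau>))"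
      using t by (intro integral_cong) (auto simp: linear_add[OF lin] linear_scale[OF lin])
    also have "\<dots> = r *\<^sub>R integral {0..t} (\<lambda>\<tau>. A \<tau> (w \<tau>)) + q *\<^sub>R integral {0..t} (\<lambda>\<tau>. A \<tau> (v \<tau>))"
      using int[OF w t] int[OF v t] by (subst integral_add) (auto intro: integrable_cmul)
    finally show "r *\<^sub>R w t + q *\<^sub>R v t = r *\<^sub>R h + q *\<^sub>R k + integral {0..t} (\<lambda>\<tau>. A \<tau> (r *\<^sub>R w \<tau> + q *\<^sub>R v \<tau>))"
      using w v t by (simp add: is_sol_def scaleR_add_right)
  qed
  then show "is_sol A h w \<Longrightarrow> is_sol A k v \<Longrightarrow>
      is_sol A (r *\<^sub>R h + q *\<^sub>R k) (\<lambda>t. r *\<^sub>R w t + q *\<^sub>R v t)" .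
  \<comment> \<open>Uniqueness is the bound applied to the difference of two solutions, which starts
    at 0.\<close>
  show "is_sol A h w \<Longrightarrow> is_sol A h w' \<Longrightarrow> t \<in> {0..1} \<Longrightarrow> w t = w' t"
    using bd[OF comb[of h w h w' 1 "- 1"], of t] by simp
qed

lemma linear_ode_surj:
  fixes A :: "real \<Rightarrow> 'a::banach \<Rightarrow> 'a"
  assumes cont: "\<And>w. continuous_on {0..1} w \<Longrightarrow> continuous_on {0..1} (\<lambda>\<tau>. A \<tau> (w \<tau>))"
    and lin: "\<And>\<tau>. \<tau> \<in> {0..1} \<Longrightarrow> linear (A \<tau>)"
    and C: "C \<ge> 0" "\<And>\<tau> w. \<tau> \<in> {0..1} \<Longrightarrow> norm (A \<tau> w) \<le> C * norm w"
  obtains h w where "is_sol A h w" "w 1 = z"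
proof -
  \<comment> \<open>If v solves the equation of B, then v (1 - t) solves that of A; a prescribed
    value at time 1 thus becomes an initial value.\<close>
  define B where "B \<tau> w = - A (1 - \<tau>) w" for \<tau> w
  have cB: "continuous_on {0..1} (\<lambda>\<tau>. B \<tau> (w \<tau>))" if w: "continuous_on {0..1} w" for w
  proof -
    \<comment> \<open>The hypothesis on A keeps the time of A and of the curve equal, so the
      reflected curve is inserted first and the result is reflected back.\<close>
    have "continuous_on {0..1} (\<lambda>\<tau>. A \<tau> (w (1 - \<tau>)))"
      by (intro cont continuous_on_compose2[OF w] continuous_intros) auto
    then have "continuous_on {0..1} (\<lambda>\<tau>. A (1 - \<tau>) (w (1 - (1 - \<tau>))))"
      by (rule continuous_on_compose2) (auto intro!: continuous_intros)
    then show ?thesis unfolding B_def by (intro continuous_intros) simp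
  qed
  have "\<exists>v. is_sol B z v"
  proof (rule linear_ode_exists[OF cB _ C(1)])
    fix \<tau> :: real assume "\<tau> \<in> {0..1}"
    then show "linear (B \<tau>)" "norm (B \<tau> w) \<le> C * norm w" for w
      using linear_compose_neg[OF lin[of "1 - \<tau>"]] C(2)[of "1 - \<tau>"] by (auto simp: B_def[abs_def])
  qed
  then obtain v where v: "is_sol B z v" ..
  then have cv: "continuous_on {0..1} v" by (simp add: is_sol_def)
  have "is_sol A (v (1 - 0)) (\<lambda>t. v (1 - t))"
  proof (rule is_solI)
    fix t :: real assume t: "t \<in> {0..1}"
    have "(v has_vector_derivative B (1 - t) (v (1 - t))) (at (1 - t) within {0..1})"
      using t by (intro is_solD[OF v cB[OF cv]]) auto
    then have "(v has_vector_derivative B (1 - t) (v (1 - t))) (at (1 - t) within (\<lambda>t. 1 - t) ` {0..1})"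
      by (rule has_vector_derivative_within_subset) auto
    moreover have "((\<lambda>t. 1 - t) has_vector_derivative - 1) (at t within {0..1})"
      by (auto intro!: derivative_eq_intros)
    ultimately have "(v \<circ> (\<lambda>t. 1 - t) has_vector_derivative (- 1) *\<^sub>R B (1 - t) (v (1 - t))) (at t within {0..1})"
      by (intro vector_diff_chain_within)
    then show "((\<lambda>t. v (1 - t)) has_vector_derivative A t (v (1 - t))) (at t within {0..1})"
      by (simp add: o_def B_def)
  qed
  moreover have "v (1 - 1) = z" using is_sol_0[OF v] by simp
  ultimately show ?thesis using that[of "v (1 - 0)" "\<lambda>t. v (1 - t)"] by simp
qed

context c11_field begin

text \<open>The derivative sends h to the value at time 1 of the linearised solution from h. The
  error c - b - w satisfies the linearised equation up to a quadratic Taylor remainder and starts at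
  0, so Gronwall bounds it by a multiple of the square of \<open>norm (y - x)\<close>.\<close>

theorem time_one_has_surj_derivative:
  assumes "x \<in> flow_dom"
  obtains U where "(time_one has_derivative U) (at x)" "surj U"
proof -
  obtain b where b: "is_sol f x b" using assms by (auto simp: flow_dom_def)
  then have cb: "continuous_on {0..1} b" by (simp add: is_sol_def)
  obtain \<delta> K R where \<delta>: "\<delta> > 0" and K: "K > 0" and bR: "\<And>t. t \<in> {0..1} \<Longrightarrow> norm (b t) \<le> R"
    and near: "\<And>y. norm (y - x) < \<delta> \<Longrightarrow> \<exists>c. is_sol f y c \<and> (\<forall>t\<in>{0..1}. norm (c t) \<le> R \<and> norm (c t - b t) \<le> K * norm (y - x))"
    by (rule sol_nearby[OF b]) blast
  from bound[of R] obtain C where C: "C \<ge> 0" "\<And>\<tau> x w. \<tau> \<in> {0..1} \<Longrightarrow> norm x \<le> R \<Longrightarrow> norm (f' \<tau> x w) \<le> C * norm w"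
    "\<And>\<tau> x y. \<tau> \<in> {0..1} \<Longrightarrow> norm x \<le> R \<Longrightarrow> norm y \<le> R \<Longrightarrow> norm (f \<tau> y - f \<tau> x - f' \<tau> x (y - x)) \<le> C * (norm (y - x))\<^sup>2"
    by metis
  define A where "A \<tau> = f' \<tau> (b \<tau>)" for \<tau>
  have A: "\<And>w. continuous_on {0..1} w \<Longrightarrow> continuous_on {0..1} (\<lambda>\<tau>. A \<tau> (w \<tau>))"
    "\<And>\<tau>. \<tau> \<in> {0..1} \<Longrightarrow> linear (A \<tau>)" "C \<ge> 0" "\<And>\<tau> w. \<tau> \<in> {0..1} \<Longrightarrow> norm (A \<tau> w) \<le> C * norm w"
    unfolding A_def by (auto intro!: cont' cb lin C bR)
  define W where "W h = (SOME w. is_sol A h w)" for h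
  have W: "is_sol A h (W h)" for h
    unfolding W_def using linear_ode_exists[OF A] by (rule someI_ex)
  define U where "U h = W h 1" for h
  have lc: "U (r *\<^sub>R h + q *\<^sub>R k) = r *\<^sub>R U h + q *\<^sub>R U k" for r q h k
    unfolding U_def using linear_ode_unique[OF A W linear_ode_combination[OF A W W], of 1] by simp
  have "bounded_linear U"
  proof (rule bounded_linear_intro)
    show "U (h + k) = U h + U k" for h k using lc[of 1 h 1 k] by simp
    show "U (r *\<^sub>R h) = r *\<^sub>R U h" for r h using lc[of r h 0 0] by simp
    show "norm (U h) \<le> norm h * gronwall_const C" for h
      unfolding U_def using linear_ode_bound[OF A W, of 1 h] by (simp add: mult.commute)
  qed
  \<comment> \<open>C bounds the Taylor remainder of the field, K the distance between the two
    solutions, and the Gronwall constant the growth of the error.\<close>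
  moreover define M where "M = gronwall_const C * (C * K\<^sup>2)"
  have M: "M \<ge> 0" using C(1) gronwall_const_pos[of C] by (simp add: M_def)
  have quad: "norm (time_one y - time_one x - U (y - x)) \<le> M * (norm (y - x))\<^sup>2" if y: "norm (y - x) < \<delta>" for y
  proof -
    obtain c where c: "is_sol f y c" "\<And>t. t \<in> {0..1} \<Longrightarrow> norm (c t) \<le> R"
      "\<And>t. t \<in> {0..1} \<Longrightarrow> norm (c t - b t) \<le> K * norm (y - x)"
      using near[OF y] by blast
    have cc: "continuous_on {0..1} c" using c(1) by (simp add: is_sol_def)
    define w where "w = W (y - x)"
    have w: "is_sol A (y - x) w" unfolding w_def by (rule W)
    have cw: "continuous_on {0..1} w" using w by (simp add: is_sol_def)
    have int: "u integrable_on {0..t}" if "continuous_on {0..1} u" "t \<in> {0..1}" for t and u :: "real \<Rightarrow> 'a"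
      using that by (intro integrable_continuous_interval continuous_on_subset[OF that(1)]) auto
    have "norm (c 1 - b 1 - w 1) \<le> gronwall_const C * (norm (0 :: 'a) + C * (K * norm (y - x))\<^sup>2)"
    proof (rule gronwall_integral_eq[of "\<lambda>t. c t - b t - w t" "\<lambda>\<tau>. f \<tau> (c \<tau>) - f \<tau> (b \<tau>) - A \<tau> (w \<tau>)"])
      show "continuous_on {0..1} (\<lambda>t. c t - b t - w t)"
        "continuous_on {0..1} (\<lambda>\<tau>. f \<tau> (c \<tau>) - f \<tau> (b \<tau>) - A \<tau> (w \<tau>))"
        by (intro continuous_intros cont A cb cc cw)+
      fix t :: real assume t: "t \<in> {0..1}"
      have 1: "A t (c t - b t) - A t (w t) = A t (c t - b t - w t)"
        by (simp add: linear_diff[OF A(2)[OF t]])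
      have "f t (c t) - f t (b t) - A t (w t) = (f t (c t) - f t (b t) - f' t (b t) (c t - b t)) + A t (c t - b t - w t)"
        unfolding 1[symmetric] by (simp add: A_def)
      also have "norm \<dots> \<le> C * (norm (c t - b t))\<^sup>2 + C * norm (c t - b t - w t)"
        by (intro norm_triangle_mono C A t bR c)
      also have "\<dots> \<le> C * (K * norm (y - x))\<^sup>2 + C * norm (c t - b t - w t)"
        using C(1) c(3)[OF t] by (intro add_right_mono mult_left_mono power_mono) auto
      finally show "norm (f t (c t) - f t (b t) - A t (w t)) \<le> C * norm (c t - b t - w t) + C * (K * norm (y - x))\<^sup>2"
        by simp
      have "integral {0..t} (\<lambda>\<tau>. f \<tau> (c \<tau>) - f \<tau> (b \<tau>) - A \<tau> (w \<tau>))
          = integral {0..t} (\<lambda>\<tau>. f \<tau> (c \<tau>)) - integral {0..t} (\<lambda>\<tau>. f \<tau> (b \<tau>)) - integral {0..t} (\<lambda>\<tau>. A \<tau> (w \<tau>))"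
        by (subst integral_diff, (intro int continuous_intros cont A cb cc cw t)+)+ simp
      then show "c t - b t - w t = 0 + integral {0..t} (\<lambda>\<tau>. f \<tau> (c \<tau>) - f \<tau> (b \<tau>) - A \<tau> (w \<tau>))"
        using c(1) b w t unfolding is_sol_def by simp
    qed (use C(1) in auto)
    then show ?thesis
      unfolding time_one_eq[OF c(1)] time_one_eq[OF b] U_def w_def M_def by (simp add: power_mult_distrib mult_ac)
  qed
  ultimately have "(time_one has_derivative U) (at x)"
    unfolding has_derivative_at_alt
  proof (intro conjI allI impI)
    fix e :: real assume e: "e > 0"
    show "\<exists>d>0. \<forall>y. norm (y - x) < d \<longrightarrow> norm (time_one y - time_one x - U (y - x)) \<le> e * norm (y - x)"
    \<comment> \<open>The denominator \<open>M + 1\<close> covers M = 0.\<close>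
    proof (intro exI[of _ "min \<delta> (e / (M + 1))"] conjI allI impI)
      show "min \<delta> (e / (M + 1)) > 0" using \<delta> e M by simp
      fix y assume y: "norm (y - x) < min \<delta> (e / (M + 1))"
      then have "(M + 1) * norm (y - x) \<le> e" using M by (simp add: field_simps)
      then have "M * norm (y - x) \<le> e" by (intro order_trans[OF mult_right_mono[of M "M + 1"]]) auto
      then have "M * norm (y - x) * norm (y - x) \<le> e * norm (y - x)" by (intro mult_right_mono) auto
      with quad[of y] y show "norm (time_one y - time_one x - U (y - x)) \<le> e * norm (y - x)"
        by (simp add: power2_eq_square mult_ac)
    qed
  qed
  moreover have "surj U"
  proof (rule surjI)
    fix z
    obtain h w where "is_sol A h w" "w 1 = z" using linear_ode_surj[OF A] .
    then have "U h = z" unfolding U_def using linear_ode_unique[OF A W, of h w 1] by simp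
    then show "U (SOME h. U h = z) = z" by (rule someI)
  qed
  ultimately show ?thesis using that by blast
qed

end

section \<open>Fourier series with absolutely summable coefficients\<close>

definition ell1_total :: "'k ell1 \<Rightarrow> complex" where
  "ell1_total a = (\<Sum>\<^sub>\<infinity>k. coef a k)"

lemma summable_coef: "coef a summable_on UNIV"
  using abs_summable_summable[OF abs_summable_coef[of a]] by simp

lemma bounded_linear_ell1_total: "bounded_linear ell1_total"
proof (rule bounded_linear_intro[where K=1])
  show "ell1_total (a + b) = ell1_total a + ell1_total b" for a b :: "'a ell1"
    by (simp add: ell1_total_def infsum_add[OF summable_coef summable_coef])
  show "ell1_total (r *\<^sub>R a) = r *\<^sub>R ell1_total a" for r and a :: "'a ell1"
    by (simp add: ell1_total_def infsum_scaleR_right)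
  show "norm (ell1_total a) \<le> norm a * 1" for a :: "'a ell1"
    unfolding ell1_total_def norm_ell1_def using norm_infsum_bound[of "coef a" UNIV] by simp
qed

lemma norm_character [simp]: "norm (character k x) = 1"
  by (simp add: character_def)

lemma lattice_vec_add: "lattice_vec (k + l) = lattice_vec k + lattice_vec l"
  and lattice_vec_minus: "lattice_vec (- k) = - lattice_vec k"
  and lattice_vec_0 [simp]: "lattice_vec 0 = 0"
  by (simp_all add: lattice_vec_def vec_eq_iff)

lemma character_add: "character (k + l) x = character k x * character l x"
  by (simp add: character_def lattice_vec_add inner_add_left distrib_left exp_add)

lemma character_minus: "character (- k) x = cnj (character k x)"
  by (simp add: character_def lattice_vec_minus exp_cnj)

lemma character_diff: "character (k - l) x = character k x * cnj (character l x)"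
  using character_add[of k "- l" x] by (simp add: character_minus)

lemma character_0 [simp]: "character 0 x = 1"
  by (simp add: character_def)

lemma character_shift: "character k (x + y) = character k x * character k y"
  by (simp add: character_def inner_add_right distrib_left exp_add)

lemma character_period: "character k (x + (2 * pi) *\<^sub>R lattice_vec n) = character k x"
proof -
  have "lattice_vec k \<bullet> lattice_vec n = real_of_int (\<Sum>j\<in>UNIV. k $ j * n $ j)"
    by (simp add: inner_vec_def lattice_vec_def)
  then have "character k ((2 * pi) *\<^sub>R lattice_vec n) = exp (complex_of_int (\<Sum>j\<in>UNIV. k $ j * n $ j) * (of_real (2 * pi) * \<i>))"
    by (simp add: character_def mult_ac)
  also have "\<dots> = 1"
    using exp_integer_2pi[of "real_of_int (\<Sum>j\<in>UNIV. k $ j * n $ j)"] by (simp add: mult_ac del: of_int_sum)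
  finally show ?thesis by (simp add: character_shift)
qed

lemma continuous_on_character [continuous_intros]:
  "continuous_on S f \<Longrightarrow> continuous_on S (\<lambda>x. character k (f x))"
  unfolding character_def by (intro continuous_intros)

definition synth :: "(int ^ 3) ell1 \<Rightarrow> real ^ 3 \<Rightarrow> complex" where
  "synth a x = (\<Sum>\<^sub>\<infinity>k. coef a k * character k x)"

text \<open>In this form joint continuity in the coefficients and the point is an instance of
  \<open>continuous_on_mult_coef\<close>.\<close>

lemma synth_altdef: "synth a x = ell1_total (mult_coef (\<lambda>k. character k x) a)"
  unfolding synth_def ell1_total_def
  by (intro infsum_cong) (simp add: coef_mult_coef[of _ 1] mult.commute)

lemma bounded_linear_synth: "bounded_linear (\<lambda>a. synth a x)"
  unfolding synth_altdef
  by (intro bounded_linear_compose[OF bounded_linear_ell1_total] bounded_linear_mult_coef[of _ 1]) simp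

lemma norm_synth_le: "norm (synth a x) \<le> norm a"
proof -
  have "norm (synth a x) \<le> (\<Sum>\<^sub>\<infinity>k. norm (coef a k * character k x))"
    unfolding synth_def by (rule norm_infsum_bound) (simp add: norm_mult)
  then show ?thesis by (simp add: norm_ell1_def norm_mult)
qed

lemma continuous_on_synth: "continuous_on S b \<Longrightarrow> continuous_on S y \<Longrightarrow> continuous_on S (\<lambda>t. synth (b t) (y t))"
  unfolding synth_altdef
  by (rule bounded_linear.continuous_on[OF bounded_linear_ell1_total], rule continuous_on_mult_coef[where B=1])
     (auto intro: continuous_on_character)

lemma synth_single: "synth (ell1_single k z) x = z * character k x"
  unfolding synth_def by (subst infsum_cong_neutral[where T="{k}"]) auto

lemma synth_periodic: "torus_periodic (synth a)"
  by (simp add: torus_periodic_def synth_def character_period)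

section \<open>The convolution algebra\<close>

definition shift :: "'k::ab_group_add \<Rightarrow> 'k ell1 \<Rightarrow> 'k ell1" where
  "shift j b = Ell1 (\<lambda>k. coef b (k - j))"

lemma bij_diff: "bij (\<lambda>k :: 'k::ab_group_add. k - j)"
  by (rule bij_betw_byWitness[where f'="\<lambda>k. k + j"]) auto

lemma coef_shift [simp]: "coef (shift j b) k = coef b (k - j)"
  unfolding shift_def
  using summable_on_reindex_bij_betw[OF bij_diff, of "\<lambda>k. norm (coef b k)"] by (subst coef_Ell1) auto

lemma norm_shift [simp]: "norm (shift j b) = norm b"
  unfolding norm_ell1_def using infsum_reindex_bij_betw[OF bij_diff, of "\<lambda>k. norm (coef b k)"] by simp

lemma synth_shift: "synth (shift j b) x = character j x * synth b x"
proof -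
  have "synth (shift j b) x = (\<Sum>\<^sub>\<infinity>k. coef b (k - j) * character (k - j) x * character j x)"
    unfolding synth_def by (intro infsum_cong) (simp add: mult.assoc character_add[symmetric])
  also have "\<dots> = (\<Sum>\<^sub>\<infinity>k. coef b k * character k x * character j x)"
    by (rule infsum_reindex_bij_betw[OF bij_diff])
  also have "\<dots> = synth b x * character j x"
    unfolding synth_def by (rule infsum_cmult_left')
  finally show ?thesis by (simp add: mult.commute)
qed

definition cscale :: "complex \<Rightarrow> 'k ell1 \<Rightarrow> 'k ell1" where
  "cscale z = mult_coef (\<lambda>_. z)"

lemma coef_cscale [simp]: "coef (cscale z a) k = z * coef a k"
  unfolding cscale_def by (rule coef_mult_coef[of _ "norm z"]) simp

lemma norm_cscale [simp]: "norm (cscale z a) = norm z * norm a"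
  by (simp add: norm_ell1_def norm_mult infsum_cmult_right')

lemma synth_cscale: "synth (cscale z a) x = z * synth a x"
  by (simp add: synth_def mult.assoc infsum_cmult_right')

text \<open>Summing shifted copies of \<open>b\<close> in the Banach space itself avoids all double series.\<close>

definition conv :: "'k::ab_group_add ell1 \<Rightarrow> 'k ell1 \<Rightarrow> 'k ell1" where
  "conv a b = (\<Sum>\<^sub>\<infinity>j. cscale (coef a j) (shift j b))"

lemma norm_summable_conv: "(\<lambda>j. norm (cscale (coef a j) (shift j b))) summable_on UNIV"
  by (simp add: summable_on_cmult_left)

lemma summable_conv: "(\<lambda>j. cscale (coef a j) (shift j b)) summable_on UNIV"
  by (rule abs_summable_summable[OF norm_summable_conv])

lemma norm_conv_le: "norm (conv a b) \<le> norm a * norm b"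
  unfolding conv_def using norm_infsum_bound[OF norm_summable_conv[of a b]]
  by (simp add: infsum_cmult_left' norm_ell1_def[of a])

lemma bounded_bilinear_conv: "bounded_bilinear conv"
proof
  fix a a' b b' :: "'a ell1" and r :: real
  show "conv (a + a') b = conv a b + conv a' b"
    unfolding conv_def infsum_add[OF summable_conv summable_conv, symmetric]
    by (intro infsum_cong ell1_eqI) (simp add: distrib_right)
  show "conv a (b + b') = conv a b + conv a b'"
    unfolding conv_def infsum_add[OF summable_conv summable_conv, symmetric]
    by (intro infsum_cong ell1_eqI) (simp add: distrib_left)
  show "conv (r *\<^sub>R a) b = r *\<^sub>R conv a b"
    unfolding conv_def infsum_scaleR_right[symmetric]
    by (intro infsum_cong ell1_eqI) simp
  show "conv a (r *\<^sub>R b) = r *\<^sub>R conv a b"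
    unfolding conv_def infsum_scaleR_right[symmetric]
    by (intro infsum_cong ell1_eqI) simp
  have "norm (conv a b) \<le> norm a * norm b * 1" for a b :: "'a ell1"
    using norm_conv_le[of a b] by simp
  then show "\<exists>K. \<forall>a b. norm (conv a b :: 'a ell1) \<le> norm a * norm b * K" by blast
qed

text \<open>Evaluation at x is bounded and linear, so it passes through the sum of shifted copies;
  each shift by j becomes multiplication by \<open>character j x\<close>.\<close>

lemma synth_conv: "synth (conv a b) x = synth a x * synth b x"
proof -
  have "synth (conv a b) x = (\<Sum>\<^sub>\<infinity>j. synth (cscale (coef a j) (shift j b)) x)"
    unfolding conv_def
    by (rule infsumI[symmetric, THEN sym, OF has_sum_bounded_linear[OF bounded_linear_synth has_sum_infsum[OF summable_conv]], symmetric])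
  also have "\<dots> = (\<Sum>\<^sub>\<infinity>j. coef a j * character j x * synth b x)"
    by (simp add: synth_cscale synth_shift mult.assoc)
  finally show ?thesis by (simp add: infsum_cmult_left' synth_def[of a])
qed

text \<open>Coefficients of the complex conjugate of a function: the frequency is reflected. This
  map is conjugate linear, which is why derivatives are taken over the reals throughout.\<close>

definition ell1_cnj :: "'k::ab_group_add ell1 \<Rightarrow> 'k ell1" where
  "ell1_cnj a = Ell1 (\<lambda>k. cnj (coef a (- k)))"

lemma bij_minus: "bij (uminus :: 'k::ab_group_add \<Rightarrow> 'k)"
  by (rule bij_betw_byWitness[where f'=uminus]) auto

lemma coef_ell1_cnj [simp]: "coef (ell1_cnj a) k = cnj (coef a (- k))"
  unfolding ell1_cnj_def
  using summable_on_reindex_bij_betw[OF bij_minus, of "\<lambda>k. norm (coef a k)"] by (subst coef_Ell1) auto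

lemma norm_ell1_cnj [simp]: "norm (ell1_cnj a) = norm a"
  unfolding norm_ell1_def using infsum_reindex_bij_betw[OF bij_minus, of "\<lambda>k. norm (coef a k)"] by simp

lemma bounded_linear_ell1_cnj: "bounded_linear ell1_cnj"
  by (rule bounded_linear_intro[where K=1]) (auto intro!: ell1_eqI)

lemma synth_cnj: "synth (ell1_cnj a) x = cnj (synth a x)"
proof -
  have "synth (ell1_cnj a) x = (\<Sum>\<^sub>\<infinity>k. cnj (coef a (- k) * character (- k) x))"
    unfolding synth_def by (intro infsum_cong) (simp add: character_minus)
  also have "\<dots> = (\<Sum>\<^sub>\<infinity>k. cnj (coef a k * character k x))"
    by (rule infsum_reindex_bij_betw[OF bij_minus])
  finally show ?thesis by (simp add: synth_def del: complex_cnj_mult)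
qed

section \<open>Integration over the cell and orthogonality of characters\<close>

lemma compact_torus_cell: "compact torus_cell"
  by (simp add: torus_cell_def)

lemma mem_torus_cell: "x \<in> torus_cell \<longleftrightarrow> (\<forall>j. 0 \<le> x $ j \<and> x $ j \<le> 2 * pi)"
  by (simp add: torus_cell_def mem_box_cart)

text \<open>Fourier coefficients integrate with respect to \<open>lebesgue\<close>; for continuous
  functions the integrand cut off to the cell is Borel, so the integral can be moved to
  \<open>lborel\<close> and its product structure.\<close>

lemma torus_cell_continuous:
  fixes f :: "real ^ 3 \<Rightarrow> 'b::euclidean_space"
  assumes "continuous_on UNIV f"
  shows set_integrable_torus_cell: "set_integrable lebesgue torus_cell f"
    and integrable_torus_cell_lborel: "integrable lborel (\<lambda>x. indicator torus_cell x *\<^sub>R f x)"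
    and integral_torus_cell_lborel:
      "(LINT x:torus_cell|lebesgue. f x) = (LINT x|lborel. indicator torus_cell x *\<^sub>R f x)"
proof -
  show i: "integrable lborel (\<lambda>x. indicator torus_cell x *\<^sub>R f x)"
    by (rule borel_integrable_compact[OF compact_torus_cell continuous_on_subset[OF assms]]) simp
  then have m: "(\<lambda>x. indicator torus_cell x *\<^sub>R f x) \<in> borel_measurable lborel" by auto
  show "set_integrable lebesgue torus_cell f"
    unfolding set_integrable_def by (simp add: integrable_completion[OF m] i)
  show "(LINT x:torus_cell|lebesgue. f x) = (LINT x|lborel. indicator torus_cell x *\<^sub>R f x)"
    unfolding set_lebesgue_integral_def by (rule integral_completion[OF m])
qed

lemma integral_exp_period:
  fixes m :: int
  shows "(LINT t|lborel. indicator {0..2 * pi} t *\<^sub>R exp (\<i> * of_real (of_int m * t))) = (if m = 0 then of_real (2 * pi) else 0)"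
    (is "?I = _")
proof -
  have "set_integrable lborel {0..2 * pi} (\<lambda>t. exp (\<i> * of_real (of_int m * t)))"
    by (intro borel_integrable_atLeastAtMost' continuous_intros)
  then have I: "?I = integral {0..2 * pi} (\<lambda>t. exp (\<i> * of_real (of_int m * t)))"
    using set_borel_integral_eq_integral(2) by (fastforce simp: set_lebesgue_integral_def)
  show ?thesis
  proof (cases "m = 0")
    case True
    then show ?thesis unfolding I by (simp add: scaleR_conv_of_real)
  next
    case False
    let ?F = "\<lambda>t. exp (\<i> * of_real (of_int m * t)) / (\<i> * of_int m)"
    have "((\<lambda>z. exp (\<i> * (of_int m * z)) / (\<i> * of_int m)) has_field_derivative exp (\<i> * (of_int m * of_real t))) (at (of_real t))" for t
      using False by (auto intro!: derivative_eq_intros simp: mult.left_commute[of _ _ \<i>] mult.commute[of _ \<i>])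
    from has_vector_derivative_real_field[OF this]
    have "((\<lambda>t. exp (\<i> * of_real (of_int m * t))) has_integral (?F (2 * pi) - ?F 0)) {0..2 * pi}"
      by (intro fundamental_theorem_of_calculus) auto
    moreover have "exp (\<i> * of_real (of_int m * (2 * pi))) = 1"
      using exp_integer_2pi[of "real_of_int m"] by (simp add: mult_ac)
    ultimately show ?thesis unfolding I using False by (simp add: integral_unique)
  qed
qed

text \<open>The character and the indicator of the cell both factor over the coordinates, so Fubini
  reduces the integral to three integrals over one period.\<close>

lemma integral_character:
  "(LINT x:torus_cell|lebesgue. character k x) = (if k = 0 then complex_of_real ((2 * pi) ^ 3) else 0)"
proof -
  define h where "h b t = indicator {0..2 * pi} t *\<^sub>R exp (\<i> * complex_of_real ((lattice_vec k \<bullet> b) * t))" for b and t :: real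
  have ih: "integrable lborel (h b)" for b
    unfolding h_def by (intro borel_integrable_compact continuous_intros) auto
  have mh [measurable]: "h b \<in> borel_measurable borel" for b
    using borel_measurable_integrable[OF ih] by simp
  interpret product_sigma_finite "\<lambda>_ :: real ^ 3. lborel :: real measure" ..
  have prod: "indicator torus_cell x *\<^sub>R character k x = (\<Prod>b\<in>Basis. h b (x \<bullet> b))" for x
  proof -
    have "(\<Prod>b\<in>Basis. h b (x \<bullet> b)) = (\<Prod>b\<in>Basis. indicator {0..2*pi} (x \<bullet> b)) *\<^sub>R
        (\<Prod>b\<in>Basis. exp (\<i> * complex_of_real ((lattice_vec k \<bullet> b) * (x \<bullet> b))))"
      by (simp add: h_def scaleR_conv_of_real prod.distrib)
    also have "(\<Prod>b\<in>Basis. exp (\<i> * complex_of_real ((lattice_vec k \<bullet> b) * (x \<bullet> b)))) = character k x"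
      unfolding character_def euclidean_inner[of "lattice_vec k" x]
      by (simp add: exp_sum[symmetric] sum_distrib_left of_real_sum)
    also have "(\<Prod>b\<in>Basis. indicator {0..2*pi} (x \<bullet> b)) = (indicator torus_cell x :: real)"
    proof (cases "x \<in> torus_cell")
      case True
      then show ?thesis by (auto simp: mem_torus_cell Basis_vec_def inner_axis intro!: prod.neutral)
    next
      case False
      then obtain j where "x \<bullet> axis j 1 \<notin> {0..2*pi}" by (auto simp: mem_torus_cell inner_axis)
      then have "\<exists>b\<in>Basis. (indicator {0..2*pi} (x \<bullet> b) :: real) = 0"
        by (intro bexI[of _ "axis j 1"]) (auto simp: Basis_vec_def)
      then show ?thesis using False by (simp add: prod_zero_iff)
    qed
    finally show ?thesis by simp
  qed
  have "(LINT x:torus_cell|lebesgue. character k x) = (LINT x|lborel. (\<Prod>b\<in>Basis. h b (x \<bullet> b)))"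
    by (subst integral_torus_cell_lborel) (auto intro!: continuous_intros simp: prod)
  also have "\<dots> = (LINT f|(\<Pi>\<^sub>M b\<in>(Basis :: (real ^ 3) set). lborel). (\<Prod>b\<in>Basis. h b ((\<Sum>b\<in>Basis. f b *\<^sub>R b) \<bullet> b)))"
    by (subst lborel_eq, subst integral_distr) (auto simp: borel_measurable_prod)
  also have "\<dots> = (LINT f|(\<Pi>\<^sub>M b\<in>(Basis :: (real ^ 3) set). lborel). (\<Prod>b\<in>Basis. h b (f b)))"
    by (intro Bochner_Integration.integral_cong prod.cong refl) (simp add: inner_sum_left_Basis)
  also have "\<dots> = (\<Prod>b\<in>(Basis :: (real ^ 3) set). integral\<^sup>L lborel (h b))"
    by (rule product_integral_prod) (auto simp: ih)
  also have "\<dots> = (\<Prod>j\<in>(UNIV :: 3 set). if k $ j = 0 then complex_of_real (2 * pi) else 0)"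
  proof -
    have Basis_eq: "(Basis :: (real ^ 3) set) = (\<lambda>j. axis j 1) ` UNIV" by (auto simp: Basis_vec_def)
    have inj: "inj (\<lambda>j :: 3. axis j (1 :: real))" by (auto simp: inj_on_def axis_eq_axis)
    have "integral\<^sup>L lborel (h (axis j 1)) = (if k $ j = 0 then complex_of_real (2 * pi) else 0)" for j :: 3
      using integral_exp_period[of "k $ j"] by (simp add: h_def[abs_def] inner_axis lattice_vec_def)
    then show ?thesis unfolding Basis_eq prod.reindex[OF inj] by simp
  qed
  also have "\<dots> = (if k = 0 then complex_of_real ((2 * pi) ^ 3) else 0)"
    by (auto simp: vec_eq_iff prod_zero_iff)
  finally show ?thesis .
qed

lemma fourier_coeff_bounded_linear: "bounded_linear (\<lambda>a. fourier_coeff (synth a) k)"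
proof (rule bounded_linear_intro)
  have c: "continuous_on UNIV (\<lambda>x. synth a x * cnj (character k x))" for a
    by (intro continuous_intros continuous_on_synth)
  show "fourier_coeff (synth (a + b)) k = fourier_coeff (synth a) k + fourier_coeff (synth b) k" for a b
    unfolding fourier_coeff_def add_divide_distrib[symmetric]
    using set_integral_add(2)[OF set_integrable_torus_cell[OF c] set_integrable_torus_cell[OF c], of a b]
    by (simp add: bounded_linear.linear[OF bounded_linear_synth, THEN linear_add] distrib_right)
  show "fourier_coeff (synth (r *\<^sub>R a)) k = r *\<^sub>R fourier_coeff (synth a) k" for r a
    unfolding fourier_coeff_def
    by (simp add: bounded_linear.linear[OF bounded_linear_synth, THEN linear_scale] scaleR_conv_of_real mult.assoc)
  show "norm (fourier_coeff (synth a) k) \<le> norm a * (measure lebesgue torus_cell / (2 * pi) ^ 3)" for a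
  proof -
    have "norm (LINT x:torus_cell|lebesgue. synth a x * cnj (character k x)) \<le> (LINT x:torus_cell|lebesgue. norm (synth a x * cnj (character k x)))"
      by (rule set_integral_norm_bound[OF set_integrable_torus_cell[OF c]])
    also have "\<dots> \<le> (LINT x:torus_cell|lebesgue. norm a)"
      by (intro set_integral_mono set_integrable_torus_cell continuous_intros continuous_on_synth)
         (simp add: norm_mult norm_synth_le)
    also have "\<dots> = norm a * measure lebesgue torus_cell"
      by (simp add: set_lebesgue_integral_def torus_cell_def mult.commute)
    finally have "norm (LINT x:torus_cell|lebesgue. synth a x * cnj (character k x)) \<le> norm a * measure lebesgue torus_cell" .
    moreover have "norm (complex_of_real ((2 * pi) ^ 3)) = (2 * pi) ^ 3"
      by (simp only: norm_of_real) simp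
    ultimately show ?thesis
      unfolding fourier_coeff_def norm_divide by (simp only: times_divide_eq_right) (intro divide_right_mono, auto)
  qed
qed

text \<open>Both sides are bounded linear in a, so it suffices to compare them on one coefficient,
  where the claim is orthogonality of characters.\<close>

lemma fourier_coeff_synth: "fourier_coeff (synth a) k = coef a k"
proof -
  have "fourier_coeff (synth a) k - coef a k = 0"
  proof (rule bounded_linear_ell1_eq_0[where T="\<lambda>a. fourier_coeff (synth a) k - coef a k"])
    show "bounded_linear (\<lambda>a. fourier_coeff (synth a) k - coef a k)"
      by (intro bounded_linear_sub fourier_coeff_bounded_linear bounded_linear_coef)
    fix l z
    have "(LINT x:torus_cell|lebesgue. synth (ell1_single l z) x * cnj (character k x))
        = (LINT x:torus_cell|lebesgue. z * character (l - k) x)"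
      by (simp add: synth_single character_diff mult.assoc)
    also have "\<dots> = z * (LINT x:torus_cell|lebesgue. character (l - k) x)"
      by simp
    finally show "fourier_coeff (synth (ell1_single l z)) k - coef (ell1_single l z) k = 0"
      by (auto simp: fourier_coeff_def integral_character)
  qed
  then show ?thesis by simp
qed

lemma synth_inject: "synth a = synth b \<Longrightarrow> a = b"
  by (metis ell1_eqI fourier_coeff_synth)

section \<open>Continuous periodic functions are determined by their Fourier coefficients\<close>

definition char_free :: "(real ^ 3 \<Rightarrow> complex) \<Rightarrow> bool" where
  "char_free f \<longleftrightarrow> continuous_on UNIV f \<and> (\<forall>k. (LINT x:torus_cell|lebesgue. f x * character k x) = 0)"

lemma character_axis: "character (axis j 1) x = exp (\<i> * of_real (x $ j))"
proof -
  have "lattice_vec (axis j 1) = axis j 1"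
    by (auto simp: lattice_vec_def axis_def vec_eq_iff)
  then show ?thesis by (simp add: character_def inner_axis' )
qed

lemma cos_character:
  "complex_of_real ((1 + cos (x $ j - y)) / 2) =
    1 / 2 + exp (- (\<i> * of_real y)) / 4 * character (axis j 1) x + exp (\<i> * of_real y) / 4 * character (- axis j 1) x"
proof -
  have "complex_of_real (cos (x $ j - y)) = (exp (\<i> * of_real (x $ j - y)) + exp (- (\<i> * of_real (x $ j - y)))) / 2"
    by (simp add: cos_of_real[symmetric] cos_exp_eq)
  also have "exp (\<i> * of_real (x $ j - y)) = exp (- (\<i> * of_real y)) * character (axis j 1) x"
    by (simp add: character_axis exp_add[symmetric] algebra_simps)
  also have "exp (- (\<i> * of_real (x $ j - y))) = exp (\<i> * of_real y) * character (- axis j 1) x"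
    by (simp add: character_minus character_axis exp_cnj exp_add[symmetric] algebra_simps)
  finally have "complex_of_real (cos (x $ j - y)) =
    (exp (- (\<i> * of_real y)) * character (axis j 1) x + exp (\<i> * of_real y) * character (- axis j 1) x) / 2" .
  moreover have "complex_of_real ((1 + cos (x $ j - y)) / 2) = 1 / 2 + complex_of_real (cos (x $ j - y)) / 2"
    by (simp add: add_divide_distrib)
  ultimately show ?thesis by (simp add: add_divide_distrib)
qed

text \<open>The cosine factor combines the characters of frequency 0 and plus or minus
  \<open>axis j 1\<close>; multiplying by a character shifts the index k, and the vanishing is
  assumed for every index.\<close>

lemma char_free_mult_cos:
  assumes f: "char_free f"
  shows "char_free (\<lambda>x. f x * complex_of_real ((1 + cos (x $ j - y)) / 2))"
  unfolding char_free_def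
proof (intro conjI allI)
  have cf: "continuous_on UNIV f" using f by (simp add: char_free_def)
  then show "continuous_on UNIV (\<lambda>x. f x * complex_of_real ((1 + cos (x $ j - y)) / 2))"
    by (intro continuous_intros) auto
  fix k
  have i: "set_integrable lebesgue torus_cell (\<lambda>x. c * (f x * character l x))" for c l
    by (intro set_integrable_torus_cell continuous_intros cf)
  have "f x * complex_of_real ((1 + cos (x $ j - y)) / 2) * character k x =
      1 / 2 * (f x * character k x) + (exp (- (\<i> * of_real y)) / 4 * (f x * character (k + axis j 1) x)
      + exp (\<i> * of_real y) / 4 * (f x * character (k + (- axis j 1)) x))" for x
    unfolding cos_character by (simp only: character_add) (simp add: algebra_simps)
  then show "(LINT x:torus_cell|lebesgue. f x * complex_of_real ((1 + cos (x $ j - y)) / 2) * character k x) = 0"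
    using f
    by (simp only: set_integral_add[OF i set_integral_add(1)[OF i i]] set_integral_add(2)[OF i i] set_integral_mult_right char_free_def)
       simp
qed

text \<open>Up to normalisation the factor is a product of three de la Vallee Poussin kernels
  centred at y. The inner induction multiplies in one coordinate at a time.\<close>

lemma char_free_mult_kernel:
  assumes "char_free f"
  shows "char_free (\<lambda>x. f x * complex_of_real ((\<Prod>j\<in>UNIV. (1 + cos (x $ j - y $ j)) / 2) ^ n))"
proof (induction n)
  case 0
  then show ?case using assms by simp
next
  case (Suc n)
  have "char_free (\<lambda>x. f x * complex_of_real ((\<Prod>j\<in>UNIV. (1 + cos (x $ j - y $ j)) / 2) ^ n)
      * complex_of_real (\<Prod>j\<in>J. (1 + cos (x $ j - y $ j)) / 2))" for J :: "3 set"
  proof (induction J rule: finite_induct[OF finite])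
    case 1
    then show ?case using Suc by simp
  next
    case (2 j J)
    from char_free_mult_cos[OF 2(3), of j "y $ j"] 2(1,2) show ?case
      by (simp add: mult_ac)
  qed
  from this[of UNIV] show ?case by (simp add: mult_ac)
qed

text \<open>Coordinate differences within the cell may come close to 2 pi, where the cosine is again
  near 1; so |t| is kept away from both 0 and 2 pi.\<close>

lemma cos_le_cos_away:
  assumes "0 < d" "d \<le> \<bar>t\<bar>" "\<bar>t\<bar> \<le> 2 * pi - d"
  shows "cos t \<le> cos d"
proof (cases "\<bar>t\<bar> \<le> pi")
  case True
  then show ?thesis using cos_monotone_0_pi_le[of d "\<bar>t\<bar>"] assms by simp
next
  case False
  then have "cos (2 * pi - \<bar>t\<bar>) \<le> cos d"
    using assms by (intro cos_monotone_0_pi_le) auto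
  then show ?thesis by (simp add: cos_diff)
qed

text \<open>The kernel \<open>r ^ n\<close> below concentrates at \<open>y\<close>, while \<open>f\<close> is orthogonal to it.\<close>

lemma char_free_interior_eq_0:
  assumes f: "char_free f" and y: "\<And>j. 0 < y $ j" "\<And>j. y $ j < 2 * pi"
  shows "f y = 0"
proof (rule ccontr)
  assume nz: "f y \<noteq> 0"
  \<comment> \<open>A real function whose value at y is the squared modulus of f y, hence positive
    near y.\<close>
  define g where "g x = Re (cnj (f y) * f x)" for x
  have cf: "continuous_on UNIV f" using f by (simp add: char_free_def)
  then have cg: "continuous_on UNIV g" unfolding g_def by (intro continuous_intros)
  define \<epsilon> where "\<epsilon> = g y / 2"
  have "g y = (norm (f y))\<^sup>2" unfolding g_def cmod_power2 by (simp add: power2_eq_square)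
  then have \<epsilon>: "\<epsilon> > 0" "\<epsilon> < g y" using nz by (auto simp: \<epsilon>_def)
  have "bounded (g ` torus_cell)"
    by (intro compact_imp_bounded compact_continuous_image compact_torus_cell continuous_on_subset[OF cg]) simp
  then obtain G where G: "G > 0" "\<And>x. x \<in> torus_cell \<Longrightarrow> \<bar>g x\<bar> \<le> G"
    unfolding bounded_pos by auto
  define r where "r x = (\<Prod>j\<in>UNIV. (1 + cos (x $ j - y $ j)) / 2)" for x :: "real ^ 3"
  have cr: "continuous_on UNIV r" unfolding r_def by (intro continuous_intros) auto
  have fac: "0 \<le> (1 + cos t) / 2" "(1 + cos t) / 2 \<le> 1" for t :: real
    using cos_ge_minus_one[of t] cos_le_one[of t] by (simp_all del: cos_ge_minus_one cos_le_one)
  have r01: "0 \<le> r x" "r x \<le> 1" for x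
    unfolding r_def by (intro prod_nonneg prod_le_1 conjI fac ballI)+
  have "open {x. \<epsilon> < g x}"
    by (intro open_Collect_less continuous_intros cg)
  then obtain d0 where d0: "d0 > 0" "ball y d0 \<subseteq> {x. \<epsilon> < g x}"
    using \<epsilon>(2) by (meson openE mem_Collect_eq)
  define Y where "Y = (\<lambda>j. y $ j) ` UNIV \<union> (\<lambda>j. 2 * pi - y $ j) ` UNIV"
  \<comment> \<open>The entry d0 / 4 makes three coordinate deviations add up to less than d0; the
    entry 1 keeps cos d positive; Y keeps the cube of half-width d inside the cell and all
    differences within 2 pi - d.\<close>
  define d where "d = Min (insert (d0 / 4) (insert 1 Y))"
  have finY: "finite Y" by (simp add: Y_def)
  have d_pos: "d > 0"
    unfolding d_def using finY d0(1) y by (subst Min_gr_iff) (auto simp: Y_def)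
  have "d \<le> a" if "a \<in> insert (d0 / 4) (insert 1 Y)" for a
    unfolding d_def using finY that by (intro Min_le) auto
  note d = d_pos this[of "d0 / 4", simplified] this[of 1, simplified]
    this[of "y $ j" for j, unfolded Y_def, simplified] this[of "2 * pi - y $ j" for j, unfolded Y_def, simplified]
  have near: "\<epsilon> < g x" "x \<in> torus_cell" if x: "\<And>j. \<bar>x $ j - y $ j\<bar> < d" for x
  proof -
    have "norm (x - y) \<le> (\<Sum>j\<in>UNIV. \<bar>(x - y) $ j\<bar>)" by (rule norm_le_l1_cart)
    also have "\<dots> \<le> (\<Sum>j\<in>(UNIV :: 3 set). d)"
      using x by (intro sum_mono) (auto intro: less_imp_le)
    also have "\<dots> < d0" using d(2) d0(1) by simp
    finally have "x \<in> ball y d0" by (simp add: dist_norm norm_minus_commute)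
    then show "\<epsilon> < g x" using d0(2) by blast
    show "x \<in> torus_cell" unfolding mem_torus_cell
    proof
      fix j show "0 \<le> x $ j \<and> x $ j \<le> 2 * pi" using x[of j] d(4,5)[of j] by linarith
    qed
  qed
  define q where "q = (1 + cos d) / 2"
  have "cos d < 1" using cos_monotone_0_pi[of 0 d] d(1,3) pi_gt3 by simp
  moreover have "cos d > 0" using d(1,3) pi_gt3 by (intro cos_gt_zero_pi) linarith+
  ultimately have q: "0 < q" "q < 1" by (auto simp: q_def)
  have far: "r x \<le> q" if "x \<in> torus_cell" "d \<le> \<bar>x $ j - y $ j\<bar>" for x j
  proof -
    have "\<bar>x $ j - y $ j\<bar> \<le> 2 * pi - d"
      using that(1) d(4,5)[of j] unfolding mem_torus_cell by (smt (verit))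
    then have "cos (x $ j - y $ j) \<le> cos d"
      using cos_le_cos_away[OF d(1) that(2)] by simp
    then have 1: "(1 + cos (x $ j - y $ j)) / 2 \<le> q" by (simp add: q_def)
    have "r x = (1 + cos (x $ j - y $ j)) / 2 * (\<Prod>i\<in>UNIV - {j}. (1 + cos (x $ i - y $ i)) / 2)"
      unfolding r_def by (rule prod.remove) auto
    also have "\<dots> \<le> q * 1"
      using q by (intro mult_mono 1 prod_le_1 conjI fac prod_nonneg ballI) auto
    finally show ?thesis by simp
  qed
  \<comment> \<open>q bounds the kernel off the cube around y. The number p, strictly between q and
    the value 1 of the kernel at y, bounds it from below on the smaller cube B.\<close>
  define p where "p = (1 + q) / 2"
  have p: "q < p" "p < 1" using q by (auto simp: p_def)
  have "open {x. p < r x}" by (intro open_Collect_less continuous_intros cr)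
  moreover have "r y = 1" by (simp add: r_def)
  ultimately obtain d1 where d1: "d1 > 0" "ball y d1 \<subseteq> {x. p < r x}"
    using p(2) by (metis openE mem_Collect_eq)
  define e where "e = min d d1 / 4"
  have e: "e > 0" "e < d" "4 * e \<le> d1" using d(1) d1(1) by (auto simp: e_def)
  define B where "B = cbox (y - (\<chi> j. e)) (y + (\<chi> j. e))"
  have Bmem: "\<bar>x $ j - y $ j\<bar> \<le> e" if "x \<in> B" for x j
    using that unfolding B_def mem_box_cart by (auto simp: abs_le_iff algebra_simps dest!: spec[of _ j])
  have B: "p < r x" "\<epsilon> < g x" "x \<in> torus_cell" if x: "x \<in> B" for x
  proof -
    have "norm (x - y) \<le> (\<Sum>j\<in>UNIV. \<bar>(x - y) $ j\<bar>)" by (rule norm_le_l1_cart)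
    also have "\<dots> \<le> (\<Sum>j\<in>(UNIV :: 3 set). e)"
      using Bmem[OF x] by (intro sum_mono) auto
    also have "\<dots> < d1" using e by simp
    finally have "x \<in> ball y d1" by (simp add: dist_norm norm_minus_commute)
    then show "p < r x" using d1(2) by blast
    show "\<epsilon> < g x" "x \<in> torus_cell"
      using near[of x] Bmem[OF x] e(2) by (meson le_less_trans)+
  qed
  define v where "v = measure lborel B"
  have v: "v > 0"
    unfolding v_def B_def using e(1) by (intro content_pos_lt) (auto simp: Basis_vec_def inner_axis)
  define V where "V = measure lborel torus_cell"
  have zero: "(LINT x|lborel. indicator torus_cell x *\<^sub>R (g x * r x ^ n)) = 0" for n
  proof -
    have c: "continuous_on UNIV (\<lambda>x. f x * complex_of_real (r x ^ n))"
      by (intro continuous_intros cf cr)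
    have "(LINT x:torus_cell|lebesgue. f x * complex_of_real (r x ^ n)) = 0"
      using char_free_mult_kernel[OF f, of y n] unfolding char_free_def r_def[symmetric]
      by (auto dest: spec[of _ 0])
    then have 0: "(LINT x|lborel. indicator torus_cell x *\<^sub>R (f x * complex_of_real (r x ^ n))) = 0"
      by (simp only: integral_torus_cell_lborel[OF c])
    have Re_eq: "Re (c * (i *\<^sub>R (z * complex_of_real s))) = i *\<^sub>R (Re (c * z) * s)" for c z and i s :: real
      by (simp add: algebra_simps)
    have "(LINT x|lborel. indicator torus_cell x *\<^sub>R (g x * r x ^ n)) = (LINT x|lborel. Re (cnj (f y) * (indicator torus_cell x *\<^sub>R (f x * complex_of_real (r x ^ n)))))"
      unfolding Re_eq g_def ..
    also have "\<dots> = Re (cnj (f y) * (LINT x|lborel. indicator torus_cell x *\<^sub>R (f x * complex_of_real (r x ^ n))))"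
      by (simp only: integral_Re[OF integrable_mult_right[OF integrable_torus_cell_lborel[OF c]]] integral_mult_right_zero)
    finally show ?thesis using 0 by simp
  qed
  \<comment> \<open>The vanishing integral is bounded below: the integrand is at least
    \<open>\<epsilon> * p ^ n\<close> on B, nonnegative on the rest of the larger cube, and at least
    \<open>- G * q ^ n\<close> elsewhere in the cell. As p > q, this is impossible for large
    n.\<close>
  have ineq: "\<epsilon> * p ^ n * v \<le> G * q ^ n * V" for n
  proof -
    have le: "\<epsilon> * p ^ n * indicator B x - G * q ^ n * indicator torus_cell x \<le> indicator torus_cell x *\<^sub>R (g x * r x ^ n)" for x
    proof (cases "x \<in> torus_cell")
      case False
      then show ?thesis using B(3) by (auto simp: indicator_def)
    next
      case cell: True
      show ?thesis
      proof (cases "\<forall>j. \<bar>x $ j - y $ j\<bar> < d")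
        case True
        then have gx: "\<epsilon> < g x" using near(1) by blast
        have "\<epsilon> * p ^ n * indicator B x \<le> g x * r x ^ n"
        proof (cases "x \<in> B")
          case True
          have "\<epsilon> * p ^ n \<le> g x * r x ^ n"
            using gx B(1)[OF True] \<epsilon> p q by (intro mult_mono power_mono) auto
          then show ?thesis using True by simp
        next
          case False
          then show ?thesis using gx \<epsilon> r01[of x] by simp
        qed
        moreover have "0 \<le> G * q ^ n" using G(1) q(1) by simp
        ultimately show ?thesis using cell by simp
      next
        case False
        then obtain j where j: "d \<le> \<bar>x $ j - y $ j\<bar>" by (meson not_le)
        then have "x \<notin> B" using Bmem[of x j] e(2) by auto
        moreover have "\<bar>g x * r x ^ n\<bar> \<le> G * q ^ n"
          unfolding abs_mult using G cell far[OF cell j] r01[of x]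
          by (intro mult_mono) (auto simp: power_abs intro!: power_mono)
        ultimately show ?thesis using cell by simp
      qed
    qed
    have iB: "integrable lborel (\<lambda>x. \<epsilon> * p ^ n * indicator B x - G * q ^ n * indicator torus_cell x :: real)"
      by (intro Bochner_Integration.integrable_diff integrable_mult_right integrable_real_indicator)
         (auto simp: B_def torus_cell_def emeasure_lborel_cbox_eq)
    have "\<epsilon> * p ^ n * v - G * q ^ n * V = (LINT x|lborel. \<epsilon> * p ^ n * indicator B x - G * q ^ n * indicator torus_cell x)"
      unfolding v_def V_def
      by (subst Bochner_Integration.integral_diff)
         (auto simp: B_def torus_cell_def emeasure_lborel_cbox_eq intro!: integrable_mult_right integrable_real_indicator)
    also have "\<dots> \<le> (LINT x|lborel. indicator torus_cell x *\<^sub>R (g x * r x ^ n))"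
      by (intro integral_mono iB le integrable_torus_cell_lborel continuous_intros cg cr)
    finally show ?thesis unfolding zero by simp
  qed
  have "p / q > 1" using p q by simp
  then obtain n where n: "G * V / (\<epsilon> * v) < (p / q) ^ n"
    using real_arch_pow by blast
  have "G * V < (p / q) ^ n * (\<epsilon> * v)"
    using n \<epsilon> v by (simp add: pos_divide_less_eq)
  then have "G * V * q ^ n < p ^ n * (\<epsilon> * v)"
    using q by (simp add: power_divide field_simps)
  with ineq[of n] show False by (simp add: mult_ac)
qed

text \<open>A period moves x into the closed cell, and continuity carries the vanishing from the
  open box to its boundary.\<close>

lemma torus_periodic_eq_0:
  assumes c: "continuous_on UNIV f" and p: "torus_periodic f"
    and z: "\<And>y. (\<And>j. 0 < y $ j) \<Longrightarrow> (\<And>j. y $ j < 2 * pi) \<Longrightarrow> f y = 0"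
  shows "f x = (0 :: complex)"
proof -
  define n :: "int ^ 3" where "n = (\<chi> j. \<lfloor>x $ j / (2 * pi)\<rfloor>)"
  define y where "y = x + (2 * pi) *\<^sub>R lattice_vec (- n)"
  have yj: "0 \<le> y $ j \<and> y $ j \<le> 2 * pi" for j
  proof -
    have "y $ j = 2 * pi * frac (x $ j / (2 * pi))"
      by (simp add: y_def lattice_vec_def n_def frac_def field_simps)
    moreover have "0 \<le> frac (x $ j / (2 * pi))" "frac (x $ j / (2 * pi)) \<le> 1"
      by (auto intro: less_imp_le frac_lt_1)
    ultimately show ?thesis by (simp add: mult_left_le)
  qed
  let ?b = "\<chi> j. 2 * pi :: real ^ 3"
  have ne: "box 0 ?b \<noteq> {}"
    by (simp add: interval_ne_empty_cart)
  have "y \<in> cbox 0 ?b" using yj by (simp add: mem_box_cart)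
  then have "y \<in> closure (box 0 ?b)" using closure_box[OF ne] by simp
  then have "f y = 0"
    by (rule continuous_constant_on_closure[rotated 2]) (use z in \<open>auto simp: mem_box_cart intro: continuous_on_subset[OF c]\<close>)
  moreover have "f y = f x" using p unfolding torus_periodic_def y_def by blast
  ultimately show ?thesis by simp
qed

text \<open>Both functions are continuous and periodic with the same coefficients, so their
  difference vanishes; uniqueness takes the place of a study of partial sums.\<close>

theorem fourier_inversion:
  assumes c: "continuous_on UNIV f" and p: "torus_periodic f"
    and s: "(\<lambda>k. norm (fourier_coeff f k)) summable_on UNIV"
  shows "f = synth (Ell1 (fourier_coeff f))"
proof
  fix x
  define a where "a = Ell1 (fourier_coeff f)"
  have a: "coef a k = fourier_coeff f k" for k unfolding a_def by (rule coef_Ell1[OF s])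
  have cd: "continuous_on UNIV (\<lambda>x. f x - synth a x)"
    by (intro continuous_intros c continuous_on_synth)
  have "char_free (\<lambda>x. f x - synth a x)"
    unfolding char_free_def
  proof (intro conjI allI cd)
    fix k
    have "(LINT x:torus_cell|lebesgue. f x * cnj (character (- k) x)) = (LINT x:torus_cell|lebesgue. synth a x * cnj (character (- k) x))"
      using fourier_coeff_synth[of a "- k"] unfolding a[of "- k"] fourier_coeff_def by simp
    moreover have "cnj (character (- k) x) = character k x" for x by (simp add: character_minus)
    moreover have "(LINT x:torus_cell|lebesgue. (f x - synth a x) * character k x) =
        (LINT x:torus_cell|lebesgue. f x * character k x) - (LINT x:torus_cell|lebesgue. synth a x * character k x)"
      unfolding left_diff_distrib
      by (intro set_integral_diff(2) set_integrable_torus_cell continuous_intros c continuous_on_synth)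
    ultimately show "(LINT x:torus_cell|lebesgue. (f x - synth a x) * character k x) = 0"
      by simp
  qed
  moreover have "torus_periodic (\<lambda>x. f x - synth a x)"
    using p synth_periodic[of a] by (simp add: torus_periodic_def)
  ultimately have "f x - synth a x = 0"
    using torus_periodic_eq_0[OF cd] char_free_interior_eq_0 by blast
  then show "f x = synth a x" by simp
qed

section \<open>Sobolev spaces of high order\<close>

text \<open>The square of the Japanese bracket, i.e. the symbol of 1 - Laplacian.\<close>

definition bracket2 :: "int ^ 3 \<Rightarrow> real" where
  "bracket2 k = 1 + (norm (lattice_vec k))\<^sup>2"

lemma bracket2_ge_1: "bracket2 k \<ge> 1"
  by (simp add: bracket2_def)

lemma bracket2_pos [simp]: "bracket2 k > 0" and bracket2_nonzero [simp]: "bracket2 k \<noteq> 0"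
  using bracket2_ge_1[of k] by linarith+

lemma norm_lattice_vec_squared: "(norm (lattice_vec k))\<^sup>2 = (\<Sum>j\<in>UNIV. (real_of_int (k $ j))\<^sup>2)"
  by (simp add: norm_vec_def L2_set_def lattice_vec_def sum_nonneg)

lemma sum_int_inverse_bounded:
  obtains B where "\<And>A. finite A \<Longrightarrow> (\<Sum>n\<in>A. 1 / (1 + (real_of_int n)\<^sup>2)) \<le> B"
proof -
  let ?h = "\<lambda>n :: int. 1 / (1 + (real_of_int n)\<^sup>2)"
  have "summable (\<lambda>n. 1 / (1 + (real n)\<^sup>2))"
  proof (rule summable_comparison_test')
    show "summable (\<lambda>n. inverse (real n ^ 2))" by (rule inverse_power_summable) simp
    show "norm (1 / (1 + (real n)\<^sup>2)) \<le> inverse (real n ^ 2)" if "n \<ge> 1" for n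
      using that by (simp add: inverse_eq_divide frac_le)
  qed
  then have nat: "(\<lambda>n. 1 / (1 + (real n)\<^sup>2)) summable_on UNIV"
    by (subst summable_on_UNIV_nonneg_real_iff) auto
  have "?h summable_on range int"
    by (subst summable_on_reindex) (auto simp: comp_def nat)
  moreover have "?h summable_on range (\<lambda>n. - int n)"
    by (subst summable_on_reindex) (auto simp: comp_def nat inj_on_def)
  ultimately have "?h summable_on (range int \<union> range (\<lambda>n. - int n))"
    by (rule summable_on_union)
  also have "range int \<union> range (\<lambda>n. - int n) = UNIV"
  proof -
    have "n \<in> range int \<union> range (\<lambda>n. - int n)" for n
      by (cases n rule: int_cases2) auto
    then show ?thesis by blast
  qed
  finally show ?thesis
    using finite_sum_le_infsum[of ?h UNIV] that[of "infsum ?h UNIV"] by auto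
qed

text \<open>Each factor 1 + k_j^2 is at most \<open>bracket2 k\<close>; this splits the lattice sum
  into sums over the integers.\<close>

lemma inverse_bracket2_le:
  "1 / bracket2 k ^ 3 \<le> (\<Prod>j\<in>UNIV. 1 / (1 + (real_of_int (k $ j))\<^sup>2))"
proof -
  have "(\<Prod>j\<in>UNIV. 1 + (real_of_int (k $ j))\<^sup>2) \<le> (\<Prod>j\<in>(UNIV :: 3 set). bracket2 k)"
    unfolding bracket2_def norm_lattice_vec_squared
    by (intro prod_mono) (auto intro!: member_le_sum)
  then have "(\<Prod>j\<in>UNIV. 1 + (real_of_int (k $ j))\<^sup>2) \<le> bracket2 k ^ 3" by simp
  moreover have "(\<Prod>j\<in>UNIV. 1 + (real_of_int (k $ j))\<^sup>2) > 0"
    by (intro prod_pos) (auto intro: add_pos_nonneg)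
  ultimately show ?thesis
    by (simp add: prod_dividef frac_le)
qed

text \<open>A finite set of frequencies lies in the product of its coordinate projections, over
  which a sum of products is a product of sums.\<close>

lemma sum_inverse_bracket2_bounded:
  obtains B where "B \<ge> 0" "\<And>F. finite F \<Longrightarrow> (\<Sum>k\<in>F. 1 / bracket2 k ^ 3) \<le> B"
proof -
  obtain B where B: "\<And>A. finite A \<Longrightarrow> (\<Sum>n\<in>A. 1 / (1 + (real_of_int n)\<^sup>2)) \<le> B"
    by (rule sum_int_inverse_bounded) blast
  have B0: "B \<ge> 0" using B[of "{}"] by simp
  have "(\<Sum>k\<in>F. 1 / bracket2 k ^ 3) \<le> B ^ 3" if F: "finite F" for F
  proof -
    define A where "A j = (\<lambda>k. k $ j) ` F" for j
    let ?h = "\<lambda>n :: int. 1 / (1 + (real_of_int n)\<^sup>2)"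
    have "(\<Sum>k\<in>F. 1 / bracket2 k ^ 3) \<le> (\<Sum>k\<in>F. \<Prod>j\<in>UNIV. ?h (k $ j))"
      by (intro sum_mono inverse_bracket2_le)
    also have "\<dots> = (\<Sum>g\<in>vec_nth ` F. \<Prod>j\<in>UNIV. ?h (g j))"
      by (subst sum.reindex) (auto simp: inj_on_def vec_nth_inject)
    also have "\<dots> \<le> (\<Sum>g\<in>PiE UNIV A. \<Prod>j\<in>UNIV. ?h (g j))"
      using F by (intro sum_mono2 finite_PiE) (auto simp: A_def intro!: prod_nonneg)
    also have "\<dots> = (\<Prod>j\<in>UNIV. \<Sum>n\<in>A j. ?h n)"
      using F by (intro prod_sum_PiE[symmetric]) (auto simp: A_def)
    also have "\<dots> \<le> (\<Prod>j\<in>(UNIV :: 3 set). B)"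
      using F by (intro prod_mono conjI B sum_nonneg) (auto simp: A_def)
    finally show ?thesis by simp
  qed
  then show ?thesis using that[of "B ^ 3"] B0 by simp
qed

text \<open>Write \<open>bracket2\<close> as \<open>bracket2^(-3) * bracket2^4\<close>:
  Cauchy-Schwarz pairs a square summable weight with the terms of the order 8 norm. The factor
  \<open>bracket2 k\<close> in the result provides for the two derivatives of the Laplacian, and C
  is uniform in f so that continuity in time follows too.\<close>

lemma sobolev_8_ell1:
  obtains C where "C \<ge> 0" "\<And>f. sobolev_weight 8 f summable_on UNIV \<Longrightarrow>
      (\<lambda>k. norm (complex_of_real (bracket2 k) * fourier_coeff f k)) summable_on UNIV \<and>
      norm (Ell1 (\<lambda>k. complex_of_real (bracket2 k) * fourier_coeff f k)) \<le> C * sobolev_norm 8 f"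
proof -
  obtain B where B: "B \<ge> 0" "\<And>F. finite F \<Longrightarrow> (\<Sum>k\<in>F. 1 / bracket2 k ^ 3) \<le> B"
    by (rule sum_inverse_bracket2_bounded) blast
  have "(\<lambda>k. norm (complex_of_real (bracket2 k) * fourier_coeff f k)) summable_on UNIV \<and>
      norm (Ell1 (\<lambda>k. complex_of_real (bracket2 k) * fourier_coeff f k)) \<le> sqrt B * sobolev_norm 8 f"
    if s: "sobolev_weight 8 f summable_on UNIV" for f
  proof -
    let ?a = "\<lambda>k. complex_of_real (bracket2 k) * fourier_coeff f k"
    have bd: "(\<Sum>k\<in>F. norm (?a k)) \<le> sqrt B * sobolev_norm 8 f" if F: "finite F" for F
    proof -
      have p: "bracket2 k > 0" for k by simp
      have w: "sobolev_weight 8 f k = (bracket2 k ^ 4 * norm (fourier_coeff f k))\<^sup>2" for k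
        by (simp add: sobolev_weight_def bracket2_def[symmetric] powr_numeral[OF less_imp_le[OF p]] power_mult_distrib power_mult[symmetric])
      have eq: "(\<Sum>k\<in>F. norm (?a k)) = (\<Sum>k\<in>F. 1 / bracket2 k ^ 3 * (bracket2 k ^ 4 * norm (fourier_coeff f k)))"
      proof (intro sum.cong refl)
        fix k
        have "bracket2 k ^ 4 = bracket2 k ^ 3 * bracket2 k" by (simp add: power4_eq_xxxx power3_eq_cube)
        then show "norm (?a k) = 1 / bracket2 k ^ 3 * (bracket2 k ^ 4 * norm (fourier_coeff f k))"
          by (simp add: norm_mult abs_of_pos)
      qed
      have "(\<Sum>k\<in>F. norm (?a k))\<^sup>2 \<le> (\<Sum>k\<in>F. (1 / bracket2 k ^ 3)\<^sup>2) * (\<Sum>k\<in>F. sobolev_weight 8 f k)"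
        unfolding eq w by (rule Cauchy_Schwarz_ineq_sum)
      also have "\<dots> \<le> B * (\<Sum>\<^sub>\<infinity>k. sobolev_weight 8 f k)"
      proof (rule mult_mono)
        have "(1 / bracket2 k ^ 3)\<^sup>2 \<le> 1 / bracket2 k ^ 3" for k
        proof -
          have "0 \<le> 1 / bracket2 k ^ 3" "1 / bracket2 k ^ 3 \<le> 1"
            using bracket2_ge_1[of k] p[of k] by (auto simp: one_le_power)
          then show ?thesis unfolding power2_eq_square by (intro mult_left_le)
        qed
        then have "(\<Sum>k\<in>F. (1 / bracket2 k ^ 3)\<^sup>2) \<le> (\<Sum>k\<in>F. 1 / bracket2 k ^ 3)" by (rule sum_mono)
        also note B(2)[OF F]
        finally show "(\<Sum>k\<in>F. (1 / bracket2 k ^ 3)\<^sup>2) \<le> B" .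
        show "(\<Sum>k\<in>F. sobolev_weight 8 f k) \<le> (\<Sum>\<^sub>\<infinity>k. sobolev_weight 8 f k)"
          by (rule finite_sum_le_infsum[OF s F]) (auto simp: w)
      qed (auto simp: B w sum_nonneg)
      also have "\<dots> = (sqrt B * sobolev_norm 8 f)\<^sup>2"
        using B(1) by (simp add: sobolev_norm_def power_mult_distrib infsum_nonneg w)
      finally show ?thesis
        by (rule power2_le_imp_le) (use B(1) in \<open>simp add: sobolev_norm_def infsum_nonneg w\<close>)
    qed
    then have s: "(\<lambda>k. norm (?a k)) summable_on UNIV" by (rule abs_summable_onI_bound)
    moreover have "norm (Ell1 ?a) \<le> sqrt B * sobolev_norm 8 f"
      by (rule norm_ell1_leI) (simp only: coef_Ell1[OF s] bd)
    ultimately show ?thesis by blast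
  qed
  then show ?thesis using that[of "sqrt B"] B(1) by auto
qed

lemma fourier_coeff_diff:
  assumes "continuous_on UNIV f" "continuous_on UNIV h"
  shows "fourier_coeff (\<lambda>x. f x - h x) k = fourier_coeff f k - fourier_coeff h k"
proof -
  have "(LINT x:torus_cell|lebesgue. f x * cnj (character k x) - h x * cnj (character k x))
      = (LINT x:torus_cell|lebesgue. f x * cnj (character k x)) - (LINT x:torus_cell|lebesgue. h x * cnj (character k x))"
    by (intro set_integral_diff(2) set_integrable_torus_cell continuous_intros assms)
  then show ?thesis
    by (simp add: fourier_coeff_def left_diff_distrib diff_divide_distrib)
qed

lemma sobolev_weight_diff_summable:
  assumes c: "continuous_on UNIV f" "continuous_on UNIV h"
    and s: "sobolev_weight \<sigma> f summable_on UNIV" "sobolev_weight \<sigma> h summable_on UNIV"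
  shows "sobolev_weight \<sigma> (\<lambda>x. f x - h x) summable_on UNIV"
proof (rule summable_on_comparison_test)
  show "(\<lambda>k. 2 * sobolev_weight \<sigma> f k + 2 * sobolev_weight \<sigma> h k) summable_on UNIV"
    by (intro summable_on_add summable_on_cmult_right s)
  fix k
  have "(norm (a - b))\<^sup>2 \<le> 2 * (norm a)\<^sup>2 + 2 * (norm b)\<^sup>2" for a b :: complex
  proof -
    have "(norm (a - b))\<^sup>2 \<le> (norm a + norm b)\<^sup>2"
      by (intro power_mono norm_triangle_ineq4) simp
    also have "\<dots> \<le> 2 * (norm a)\<^sup>2 + 2 * (norm b)\<^sup>2"
      using sum_squares_ge_zero[of "norm a - norm b" 0] by (simp add: power2_eq_square algebra_simps)
    finally show ?thesis .
  qed
  then have "(1 + (norm (lattice_vec k))\<^sup>2) powr \<sigma> * (norm (fourier_coeff f k - fourier_coeff h k))\<^sup>2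
      \<le> (1 + (norm (lattice_vec k))\<^sup>2) powr \<sigma> * (2 * (norm (fourier_coeff f k))\<^sup>2 + 2 * (norm (fourier_coeff h k))\<^sup>2)"
    by (intro mult_left_mono) auto
  then show "sobolev_weight \<sigma> (\<lambda>x. f x - h x) k \<le> 2 * sobolev_weight \<sigma> f k + 2 * sobolev_weight \<sigma> h k"
    by (simp add: sobolev_weight_def fourier_coeff_diff[OF c] algebra_simps)
  show "0 \<le> sobolev_weight \<sigma> (\<lambda>x. f x - h x) k" by (simp add: sobolev_weight_def)
qed

text \<open>A collects the coefficients of (1 - Laplacian) v. From this one curve both v and its
  Laplacian are obtained by bounded multipliers, hence continuously in time.\<close>

lemma sobolev_curve_ell1:
  assumes v: "continuous_into_sobolev 8 v" and c: "\<And>t. continuous_on UNIV (v t)"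
  obtains A :: "real \<Rightarrow> (int ^ 3) ell1" where "continuous_on UNIV A"
    "\<And>t k. coef (A t) k = complex_of_real (bracket2 k) * fourier_coeff (v t) k"
proof -
  obtain C where C: "C \<ge> 0" "\<And>f. sobolev_weight 8 f summable_on UNIV \<Longrightarrow>
      (\<lambda>k. norm (complex_of_real (bracket2 k) * fourier_coeff f k)) summable_on UNIV \<and>
      norm (Ell1 (\<lambda>k. complex_of_real (bracket2 k) * fourier_coeff f k)) \<le> C * sobolev_norm 8 f"
    by (rule sobolev_8_ell1) blast
  define E where "E f = Ell1 (\<lambda>k. complex_of_real (bracket2 k) * fourier_coeff f k)" for f
  have s: "sobolev_weight 8 (v t) summable_on UNIV" for t
    using v by (auto simp: continuous_into_sobolev_def sobolev_def)
  have E: "coef (E f) k = complex_of_real (bracket2 k) * fourier_coeff f k" if "sobolev_weight 8 f summable_on UNIV" for f k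
    unfolding E_def using C(2)[OF that] by (intro coef_Ell1) blast
  have "continuous_on UNIV (\<lambda>t. E (v t))"
    unfolding continuous_on_def
  proof
    fix t
    have diff: "E (v \<tau>) - E (v t) = E (\<lambda>x. v \<tau> x - v t x)" for \<tau>
      by (rule ell1_eqI)
         (simp add: E[OF s] E[OF sobolev_weight_diff_summable[OF c c s s]] fourier_coeff_diff[OF c c] right_diff_distrib)
    have "((\<lambda>\<tau>. norm (E (v \<tau>) - E (v t))) \<longlongrightarrow> 0) (at t)"
    proof (rule tendsto_sandwich)
      show "\<forall>\<^sub>F \<tau> in at t. 0 \<le> norm (E (v \<tau>) - E (v t))" by simp
      show "\<forall>\<^sub>F \<tau> in at t. norm (E (v \<tau>) - E (v t)) \<le> C * sobolev_norm 8 (\<lambda>x. v \<tau> x - v t x)"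
        unfolding diff unfolding E_def
        using C(2)[OF sobolev_weight_diff_summable[OF c c s s]] by (intro always_eventually) blast
      have "((\<lambda>\<tau>. sobolev_norm 8 (\<lambda>x. v \<tau> x - v t x)) \<longlongrightarrow> 0) (at t)"
        using v by (simp add: continuous_into_sobolev_def)
      from tendsto_mult_left[OF this, of C]
      show "((\<lambda>\<tau>. C * sobolev_norm 8 (\<lambda>x. v \<tau> x - v t x)) \<longlongrightarrow> 0) (at t)" by simp
    qed simp
    then show "((\<lambda>\<tau>. E (v \<tau>)) \<longlongrightarrow> E (v t)) (at t)"
      by (simp add: tendsto_norm_zero_iff LIM_zero_iff)
  qed
  then show ?thesis using that[of "\<lambda>t. E (v t)"] E[OF s] by blast
qed

section \<open>The quintic Schroedinger equation in Fourier coefficients\<close>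

text \<open>Integrating the scalar identities shows that every functional agrees on b and on a
  primitive of c. Separation makes the two equal, and continuity of c makes the primitive
  differentiable in norm: a weak derivative becomes a strong one.\<close>

lemma has_vector_derivative_by_functionals:
  fixes b c :: "real \<Rightarrow> 'a::banach" and \<Lambda> :: "'i \<Rightarrow> 'a \<Rightarrow> 'b::banach"
  assumes c: "continuous_on UNIV c" and lin: "\<And>i. bounded_linear (\<Lambda> i)"
    and sep: "\<And>x y. (\<And>i. \<Lambda> i x = \<Lambda> i y) \<Longrightarrow> x = y"
    and deriv: "\<And>i t. ((\<lambda>\<tau>. \<Lambda> i (b \<tau>)) has_vector_derivative \<Lambda> i (c t)) (at t)"
  shows "(b has_vector_derivative c t) (at t)"
proof -
  define a where "a = t - 1"
  have eq: "b \<tau> = b a + integral {a..\<tau>} c" if "\<tau> \<in> {a..t + 1}" for \<tau>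
  proof (rule sep)
    fix i
    have "(c has_integral integral {a..\<tau>} c) {a..\<tau>}"
      by (intro integrable_integral integrable_continuous_interval continuous_on_subset[OF c]) simp
    from has_integral_linear[OF this lin]
    have "((\<lambda>\<tau>. \<Lambda> i (c \<tau>)) has_integral \<Lambda> i (integral {a..\<tau>} c)) {a..\<tau>}" by (simp add: comp_def)
    moreover have "((\<lambda>\<tau>. \<Lambda> i (c \<tau>)) has_integral (\<Lambda> i (b \<tau>) - \<Lambda> i (b a))) {a..\<tau>}"
      using that by (intro fundamental_theorem_of_calculus has_vector_derivative_at_within[OF deriv]) auto
    ultimately have "\<Lambda> i (b \<tau>) - \<Lambda> i (b a) = \<Lambda> i (integral {a..\<tau>} c)"
      by (rule has_integral_unique[symmetric])
    then show "\<Lambda> i (b \<tau>) = \<Lambda> i (b a + integral {a..\<tau>} c)"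
      by (simp add: linear_add[OF bounded_linear.linear[OF lin]] algebra_simps)
  qed
  have "((\<lambda>\<tau>. b a + integral {a..\<tau>} c) has_vector_derivative (0 + c t)) (at t within {a..t + 1})"
    by (intro has_vector_derivative_add has_vector_derivative_const integral_has_vector_derivative continuous_on_subset[OF c])
       (auto simp: a_def)
  then have "(b has_vector_derivative c t) (at t within {a..t + 1})"
    by (intro has_vector_derivative_transform[of t "{a..t + 1}" b, OF _ eq]) (auto simp: a_def)
  then have "(b has_vector_derivative c t) (at t within {a<..<t + 1})"
    by (rule has_vector_derivative_within_subset) auto
  then show ?thesis
    by (subst (asm) has_vector_derivative_within_open) (auto simp: a_def)
qed

section \<open>Classical space derivatives of Fourier series\<close>

lemma synth_translate:
  "synth (mult_coef (\<lambda>k. exp (\<i> * complex_of_real (real_of_int (k $ j) * h))) a) x = synth a (x + h *\<^sub>R axis j 1)"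
proof -
  have "character k (h *\<^sub>R axis j 1) = exp (\<i> * complex_of_real (real_of_int (k $ j) * h))" for k
    by (simp add: character_def inner_axis lattice_vec_def mult_ac)
  then show ?thesis
    unfolding synth_def by (intro infsum_cong) (simp add: coef_mult_coef[of _ 1] character_shift mult_ac)
qed

text \<open>Translation acts on coefficients by phases. Its orbit through a is differentiable in the
  coefficient space because the formal derivative a' is again summable; evaluation at x then gives
  the partial derivative.\<close>

lemma has_partial_deriv_synth:
  assumes a': "\<And>k. coef a' k = \<i> * of_int (k $ j) * coef a k"
  shows "has_partial_deriv j (synth a) (synth a')"
  unfolding has_partial_deriv_def
proof
  fix x
  define T where "T h = mult_coef (\<lambda>k. exp (\<i> * complex_of_real (real_of_int (k $ j) * h)))" for h
  have coef_T: "coef (T h a) k = exp (\<i> * complex_of_real (real_of_int (k $ j) * h)) * coef a k" for h a k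
    unfolding T_def by (rule coef_mult_coef[of _ 1]) simp
  have "((\<lambda>h. T h a) has_vector_derivative T 0 a') (at 0)"
  proof (rule has_vector_derivative_by_functionals[where \<Lambda>="\<lambda>k a. coef a k" and b="\<lambda>h. T h a" and c="\<lambda>h. T h a'"])
    show "continuous_on UNIV (\<lambda>h. T h a')"
      unfolding T_def by (rule continuous_on_mult_coef[where B=1]) (auto intro!: continuous_intros)
    show "x = y" if "\<And>k. coef x k = coef y k" for x y :: "(int ^ 3) ell1" using that by (rule ell1_eqI)
    fix k :: "int ^ 3" and t :: real
    have "((\<lambda>z. exp (\<i> * (of_int (k $ j) * z)) * coef a k) has_field_derivative
        exp (\<i> * (of_int (k $ j) * of_real t)) * (\<i> * of_int (k $ j) * coef a k)) (at (of_real t))"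
      by (auto intro!: derivative_eq_intros simp: mult_ac)
    from has_vector_derivative_real_field[OF this]
    show "((\<lambda>\<tau>. coef (T \<tau> a) k) has_vector_derivative coef (T t a') k) (at t)"
      by (simp add: coef_T a')
  qed (rule bounded_linear_coef)
  from bounded_linear.has_vector_derivative[OF bounded_linear_synth this]
  have "((\<lambda>h. synth (T h a) x) has_vector_derivative synth (T 0 a') x) (at 0)" .
  then show "((\<lambda>h. synth a (x + h *\<^sub>R axis j 1)) has_vector_derivative synth a' x) (at 0)"
    unfolding T_def synth_translate by simp
qed

lemma has_partial_deriv_unique:
  assumes "has_partial_deriv j f g" "has_partial_deriv j f h"
  shows "g = h"
  using assms unfolding has_partial_deriv_def by (auto intro!: ext vector_derivative_unique_at)

definition laplace_symbol :: "int ^ 3 \<Rightarrow> real" where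
  "laplace_symbol k = (norm (lattice_vec k))\<^sup>2"

text \<open>\<open>has_laplacian\<close> merely asserts that some partial derivatives exist; their
  uniqueness identifies them with termwise derivatives. These are obtained from A by multipliers of
  modulus at most 1, since k_j and k_j^2 are dominated by \<open>bracket2 k\<close>.\<close>

lemma has_laplacian_synth:
  assumes L: "has_laplacian (synth a) L"
    and A: "\<And>k. coef A k = complex_of_real (bracket2 k) * coef a k"
  shows "L = synth (mult_coef (\<lambda>k. - complex_of_real (laplace_symbol k / bracket2 k)) A)"
proof -
  have pos: "bracket2 k > 0" for k by simp
  have sq: "(real_of_int (k $ j))\<^sup>2 \<le> laplace_symbol k" for k j
    unfolding laplace_symbol_def norm_lattice_vec_squared by (intro member_le_sum) auto
  have le1: "\<bar>real_of_int (k $ j)\<bar> \<le> bracket2 k" for k j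
  proof -
    have "\<bar>real_of_int (k $ j)\<bar> \<le> 1 + (real_of_int (k $ j))\<^sup>2"
      using sum_squares_ge_zero[of "\<bar>real_of_int (k $ j)\<bar> - 1" 0] zero_le_power2[of "real_of_int (k $ j)"]
      by (simp add: algebra_simps power2_eq_square)
    then show ?thesis using sq[of k j] by (simp add: bracket2_def laplace_symbol_def)
  qed
  have le2: "(real_of_int (k $ j))\<^sup>2 \<le> bracket2 k" for k j
    using sq[of k j] by (simp add: bracket2_def laplace_symbol_def)
  define d where "d j = mult_coef (\<lambda>k. \<i> * complex_of_real (real_of_int (k $ j) / bracket2 k)) A" for j
  define d2 where "d2 j = mult_coef (\<lambda>k. - complex_of_real ((real_of_int (k $ j))\<^sup>2 / bracket2 k)) A" for j
  have coef_d: "coef (d j) k = \<i> * of_int (k $ j) * coef a k" for j k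
    unfolding d_def using pos[of k]
    by (subst coef_mult_coef[of _ 1]) (auto simp: norm_mult norm_divide le1 pos A less_imp_le)
  have coef_d2: "coef (d2 j) k = - (of_int (k $ j))\<^sup>2 * coef a k" for j k
    unfolding d2_def using pos[of k]
    by (subst coef_mult_coef[of _ 1]) (auto simp: norm_mult norm_divide norm_power le2 pos A less_imp_le)
  obtain D D2 where D: "\<And>j. has_partial_deriv j (synth a) (D j)" "\<And>j. has_partial_deriv j (D j) (D2 j)"
    and L_eq: "L = (\<lambda>x. \<Sum>j\<in>UNIV. D2 j x)"
    using L unfolding has_laplacian_def by blast
  have Dj: "D j = synth (d j)" for j
    by (rule has_partial_deriv_unique[OF D(1) has_partial_deriv_synth]) (rule coef_d)
  have "has_partial_deriv j (synth (d j)) (synth (d2 j))" for j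
  proof (rule has_partial_deriv_synth)
    fix k
    have "\<i> * of_int (k $ j) * (\<i> * of_int (k $ j) * coef a k) = (\<i> * \<i>) * (of_int (k $ j) * of_int (k $ j) * coef a k)"
      by (simp only: mult_ac)
    then show "coef (d2 j) k = \<i> * of_int (k $ j) * coef (d j) k"
      by (simp add: coef_d coef_d2 power2_eq_square)
  qed
  then have "D2 j = synth (d2 j)" for j
    using D(2)[of j] unfolding Dj by (intro has_partial_deriv_unique)
  then have "L x = synth (\<Sum>j\<in>UNIV. d2 j) x" for x
    by (simp add: L_eq linear_sum[OF bounded_linear.linear[OF bounded_linear_synth]])
  moreover have "(\<Sum>j\<in>UNIV. d2 j) = mult_coef (\<lambda>k. - complex_of_real (laplace_symbol k / bracket2 k)) A"
  proof (rule ell1_eqI)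
    fix k
    have "coef (mult_coef (\<lambda>k. - complex_of_real (laplace_symbol k / bracket2 k)) A) k = - complex_of_real (laplace_symbol k) * coef a k"
      using pos by (subst coef_mult_coef[of _ 1]) (auto simp: norm_divide A less_imp_le laplace_symbol_def bracket2_def less_imp_neq[OF pos, unfolded bracket2_def, symmetric] abs_of_pos[OF pos, unfolded bracket2_def] simp del: of_real_add of_real_power)
    also have "\<dots> = (\<Sum>j\<in>UNIV. - (of_int (k $ j))\<^sup>2 * coef a k)"
      by (simp add: laplace_symbol_def norm_lattice_vec_squared sum_distrib_right sum_negf)
    finally show "coef (\<Sum>j\<in>UNIV. d2 j) k = coef (mult_coef (\<lambda>k. - complex_of_real (laplace_symbol k / bracket2 k)) A) k"
      by (simp add: coef_sum coef_d2)
  qed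
  ultimately show ?thesis by auto
qed

text \<open>The factorisation of |u|^4 u as u^3 times the square of the conjugate, so that only
  convolution and conjugation occur.\<close>

definition quintic :: "(int ^ 3) ell1 \<Rightarrow> (int ^ 3) ell1" where
  "quintic a = conv a (conv a (conv a (conv (ell1_cnj a) (ell1_cnj a))))"

lemma synth_quintic: "synth (quintic a) x = complex_of_real (norm (synth a x) ^ 4) * synth a x"
proof -
  let ?z = "synth a x"
  have "synth (quintic a) x = ?z * ((?z * cnj ?z) * (?z * cnj ?z))"
    by (simp add: quintic_def synth_conv synth_cnj mult_ac)
  also have "?z * cnj ?z = complex_of_real ((norm ?z)\<^sup>2)"
    by (rule complex_norm_square[symmetric])
  also have "complex_of_real ((norm ?z)\<^sup>2) * complex_of_real ((norm ?z)\<^sup>2) = complex_of_real (norm ?z ^ 4)"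
    by (simp add: power_add[symmetric])
  finally show ?thesis by (simp add: mult.commute)
qed

lemma continuous_on_quintic: "continuous_on S a \<Longrightarrow> continuous_on S (\<lambda>t. quintic (a t))"
  unfolding quintic_def
  by (intro bounded_bilinear.continuous_on[OF bounded_bilinear_conv] bounded_linear.continuous_on[OF bounded_linear_ell1_cnj])

definition schroedinger :: "real \<Rightarrow> (int ^ 3) ell1 \<Rightarrow> (int ^ 3) ell1" where
  "schroedinger t = mult_coef (\<lambda>k. exp (\<i> * complex_of_real (- laplace_symbol k * t)))"

lemma coef_schroedinger: "coef (schroedinger t a) k = exp (\<i> * complex_of_real (- laplace_symbol k * t)) * coef a k"
  unfolding schroedinger_def by (rule coef_mult_coef[of _ 1]) simp

lemma bounded_linear_schroedinger: "bounded_linear (schroedinger t)"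
  unfolding schroedinger_def by (rule bounded_linear_mult_coef[of _ 1]) simp

lemma norm_schroedinger [simp]: "norm (schroedinger t a) = norm a"
  by (simp add: norm_ell1_def coef_schroedinger norm_mult)

lemma schroedinger_group: "schroedinger t (schroedinger s a) = schroedinger (t + s) a"
  by (rule ell1_eqI, unfold coef_schroedinger mult.assoc[symmetric] exp_add[symmetric]) (simp add: algebra_simps)

lemma schroedinger_0 [simp]: "schroedinger 0 a = a"
  by (rule ell1_eqI) (simp add: coef_schroedinger)

lemma continuous_on_schroedinger:
  "continuous_on S t \<Longrightarrow> continuous_on S b \<Longrightarrow> continuous_on S (\<lambda>x. schroedinger (t x) (b x))"
  unfolding schroedinger_def by (rule continuous_on_mult_coef[where B=1]) (auto intro!: continuous_intros)

lemma bounded_linear_cscale: "bounded_linear (cscale z)"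
  unfolding cscale_def by (rule bounded_linear_mult_coef[of _ "norm z"]) simp

text \<open>The equation for the Fourier coefficients of \<open>e\<^sup>-\<^sup>i\<^sup>t\<^sup>\<Delta> u(t)\<close>, with time rescaled so that \<open>t\<^sub>0\<close>,
  which may be negative or zero, becomes 1.\<close>

definition nls_field :: "real \<Rightarrow> real \<Rightarrow> (int ^ 3) ell1 \<Rightarrow> (int ^ 3) ell1" where
  "nls_field t0 \<theta> x = t0 *\<^sub>R cscale (- \<i>) (schroedinger (- (t0 * \<theta>)) (quintic (schroedinger (t0 * \<theta>) x)))"

text \<open>Along the given solution the Laplacian yields a continuous curve l of coefficients, so
  the equation can be read in the coefficient space; passing to the interaction picture then cancels
  l.\<close>

theorem nls_solution_ell1_curve:
  assumes sol: "nls_solution \<sigma>max \<phi> v" and \<sigma>: "8 < \<sigma>max"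
  obtains a where "\<And>t. v t = synth (a t)"
    "is_sol (nls_field t0) (a 0) (\<lambda>\<theta>. schroedinger (- (t0 * \<theta>)) (a (t0 * \<theta>)))"
proof -
  have sob: "continuous_into_sobolev 8 v" and cv: "\<And>t. continuous_on UNIV (v t)" and nls: "quintic_nls v"
    using sol \<sigma> by (auto simp: nls_solution_def)
  obtain A where A: "continuous_on UNIV A" "\<And>t k. coef (A t) k = complex_of_real (bracket2 k) * fourier_coeff (v t) k"
    by (rule sobolev_curve_ell1[OF sob cv]) blast
  have pos: "bracket2 k > 0" for k by simp
  have m1: "norm (complex_of_real (1 / bracket2 k)) \<le> 1" for k
    using bracket2_ge_1[of k] by (simp add: norm_divide)
  have m2: "norm (- complex_of_real (laplace_symbol k / bracket2 k)) \<le> 1" for k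
    using pos[of k] by (simp only: norm_minus_cancel norm_of_real) (simp add: laplace_symbol_def bracket2_def)
  define a where "a t = mult_coef (\<lambda>k. complex_of_real (1 / bracket2 k)) (A t)" for t
  have coef_a: "coef (a t) k = fourier_coeff (v t) k" for t k
    unfolding a_def coef_mult_coef[of "\<lambda>k. complex_of_real (1 / bracket2 k)", OF m1] A(2) using pos[of k] by simp
  have ca: "continuous_on UNIV a"
    unfolding a_def by (rule continuous_on_mult_coef[OF A(1) continuous_on_const m1])
  have va: "v t = synth (a t)" for t
  proof -
    have "fourier_coeff (v t) = coef (a t)" by (simp add: coef_a fun_eq_iff)
    then show ?thesis
      using fourier_inversion[OF cv[of t]] sob abs_summable_coef[of "a t"]
      by (simp add: continuous_into_sobolev_def sobolev_def torus_L2_def coef_inverse)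
  qed
  define l where "l t = mult_coef (\<lambda>k. - complex_of_real (laplace_symbol k / bracket2 k)) (A t)" for t
  have coef_l: "coef (l t) k = - complex_of_real (laplace_symbol k) * coef (a t) k" for t k
    unfolding l_def coef_mult_coef[of "\<lambda>k. - complex_of_real (laplace_symbol k / bracket2 k)", OF m2] A(2) coef_a using pos[of k] by simp
  have cl: "continuous_on UNIV l"
    unfolding l_def by (rule continuous_on_mult_coef[OF A(1) continuous_on_const m2])
  define c where "c t = cscale \<i> (l t - quintic (a t))" for t
  have cc: "continuous_on UNIV c"
    unfolding c_def by (intro bounded_linear.continuous_on[OF bounded_linear_cscale] continuous_intros cl continuous_on_quintic ca)
  \<comment> \<open>The equation is known pointwise in x, so point evaluations serve as separating
    functionals; injectivity of synthesis is what separates.\<close>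
  have da: "(a has_vector_derivative c t) (at t)" for t
  proof (rule has_vector_derivative_by_functionals[where \<Lambda>="\<lambda>x a. synth a x", OF cc])
    fix x t
    obtain vt L where L: "has_laplacian (v t) L"
      and vt: "((\<lambda>\<tau>. v \<tau> x) has_vector_derivative vt x) (at t)"
      and eq: "\<i> * vt x + L x = complex_of_real ((norm (v t x)) ^ 4) * v t x"
      using nls unfolding quintic_nls_def by metis
    have "L = synth (l t)"
      unfolding l_def by (rule has_laplacian_synth[OF L[unfolded va]]) (simp add: A(2) coef_a)
    with eq have "\<i> * vt x = synth (quintic (a t)) x - synth (l t) x"
      by (simp add: synth_quintic va algebra_simps)
    then have "- (\<i> * (\<i> * vt x)) = \<i> * (synth (l t) x - synth (quintic (a t)) x)"
      by (simp only: right_diff_distrib) simp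
    then have "vt x = synth (c t) x"
      by (simp add: c_def synth_cscale linear_diff[OF bounded_linear.linear[OF bounded_linear_synth]])
    with vt show "((\<lambda>\<tau>. synth (a \<tau>) x) has_vector_derivative synth (c t) x) (at t)"
      by (simp add: va)
  qed (auto intro: bounded_linear_synth synth_inject)
  define b where "b \<theta> = schroedinger (- (t0 * \<theta>)) (a (t0 * \<theta>))" for \<theta>
  have cb: "continuous_on UNIV b"
    unfolding b_def by (intro continuous_on_schroedinger continuous_intros continuous_on_compose2[OF ca]) auto
  have fb: "nls_field t0 \<theta> (b \<theta>) = t0 *\<^sub>R cscale (- \<i>) (schroedinger (- (t0 * \<theta>)) (quintic (a (t0 * \<theta>))))" for \<theta>
    by (simp add: nls_field_def b_def schroedinger_group)
  \<comment> \<open>Here the coefficients are the functionals: for fixed k the product rule is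
    scalar, and the derivative of the phase cancels the Laplacian term.\<close>
  have db: "(b has_vector_derivative nls_field t0 \<theta> (b \<theta>)) (at \<theta>)" for \<theta>
  proof (rule has_vector_derivative_by_functionals[where \<Lambda>="\<lambda>k a. coef a k" and c="\<lambda>\<theta>. nls_field t0 \<theta> (b \<theta>)"])
    show "continuous_on UNIV (\<lambda>\<theta>. nls_field t0 \<theta> (b \<theta>))"
      unfolding fb
      by (intro continuous_on_scaleR continuous_on_const bounded_linear.continuous_on[OF bounded_linear_cscale] continuous_on_schroedinger
          continuous_on_quintic continuous_intros continuous_on_compose2[OF ca]) auto
    fix k \<theta>
    define m where "m = laplace_symbol k"
    have "((\<lambda>\<theta>. a (t0 * \<theta>)) has_vector_derivative t0 *\<^sub>R c (t0 * \<theta>)) (at \<theta>)"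
    proof -
      have "((\<lambda>\<theta>. t0 * \<theta>) has_vector_derivative t0) (at \<theta>)"
        by (auto intro!: derivative_eq_intros)
      from vector_diff_chain_at[OF this da] show ?thesis by (simp add: comp_def)
    qed
    from bounded_linear.has_vector_derivative[OF bounded_linear_coef this]
    have 1: "((\<lambda>\<theta>. coef (a (t0 * \<theta>)) k) has_vector_derivative t0 *\<^sub>R coef (c (t0 * \<theta>)) k) (at \<theta>)" by simp
    have "((\<lambda>z. exp (\<i> * (of_real m * (of_real t0 * z)))) has_field_derivative
        exp (\<i> * (of_real m * (of_real t0 * of_real \<theta>))) * (\<i> * of_real m * of_real t0)) (at (of_real \<theta>))"
      by (auto intro!: derivative_eq_intros simp: mult_ac)
    from has_vector_derivative_real_field[OF this]
    have 2: "((\<lambda>\<theta>. exp (\<i> * (of_real m * (of_real t0 * of_real \<theta>)))) has_vector_derivative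
        exp (\<i> * (of_real m * (of_real t0 * of_real \<theta>))) * (\<i> * of_real m * of_real t0)) (at \<theta>)" .
    have "((\<lambda>\<theta>. exp (\<i> * (of_real m * (of_real t0 * of_real \<theta>))) * coef (a (t0 * \<theta>)) k) has_vector_derivative
        (exp (\<i> * (of_real m * (of_real t0 * of_real \<theta>))) * (t0 *\<^sub>R coef (c (t0 * \<theta>)) k) +
         exp (\<i> * (of_real m * (of_real t0 * of_real \<theta>))) * (\<i> * of_real m * of_real t0) * coef (a (t0 * \<theta>)) k)) (at \<theta>)"
      by (rule has_vector_derivative_mult[OF 2 1])
    then show "((\<lambda>\<theta>. coef (b \<theta>) k) has_vector_derivative coef (nls_field t0 \<theta> (b \<theta>)) k) (at \<theta>)"
      unfolding fb
      by (simp add: b_def coef_schroedinger c_def coef_l m_def scaleR_conv_of_real algebra_simps)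
  qed (auto intro: ell1_eqI bounded_linear_coef)
  have "is_sol (nls_field t0) (b 0) b"
    by (rule is_solI) (rule has_vector_derivative_at_within[OF db])
  then show ?thesis
    using that[of a] va by (simp add: b_def[abs_def])
qed

section \<open>Differentiability of the quintic map and of the field\<close>

definition c11_map :: "('a::banach \<Rightarrow> 'a) \<Rightarrow> ('a \<Rightarrow> 'a \<Rightarrow> 'a) \<Rightarrow> bool" where
  "c11_map N N' \<longleftrightarrow>
    (\<forall>(b :: real \<Rightarrow> 'a). continuous_on {0..1} b \<longrightarrow> continuous_on {0..1} (\<lambda>t. N (b t))) \<and>
    (\<forall>(b :: real \<Rightarrow> 'a) w. continuous_on {0..1} b \<longrightarrow> continuous_on {0..1} w \<longrightarrow> continuous_on {0..1} (\<lambda>t. N' (b t) (w t))) \<and>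
    (\<forall>x. linear (N' x)) \<and>
    (\<forall>R. \<exists>C\<ge>0. \<forall>x y w. norm x \<le> R \<longrightarrow> norm y \<le> R \<longrightarrow>
      norm (N x) \<le> C \<and> norm (N' x w) \<le> C * norm w \<and> norm (N y - N x - N' x (y - x)) \<le> C * (norm (y - x))\<^sup>2)"

lemma c11_map_bounded_linear:
  fixes T :: "'a::banach \<Rightarrow> 'a"
  assumes "bounded_linear T"
  shows "c11_map T (\<lambda>_. T)"
  unfolding c11_map_def
proof (intro conjI allI impI)
  obtain K where K: "K > 0" "\<And>x. norm (T x) \<le> norm x * K"
    using bounded_linear.pos_bounded[OF assms] by blast
  show "\<exists>C\<ge>0. \<forall>x y w. norm x \<le> R \<longrightarrow> norm y \<le> R \<longrightarrow>
      norm (T x) \<le> C \<and> norm (T w) \<le> C * norm w \<and> norm (T y - T x - T (y - x)) \<le> C * (norm (y - x))\<^sup>2" for R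
  proof (intro exI[of _ "K + \<bar>R\<bar> * K"] conjI allI impI)
    fix x y w :: 'a assume x: "norm x \<le> R"
    have "norm x * K \<le> \<bar>R\<bar> * K" using x K(1) by (intro mult_right_mono) auto
    then show "norm (T x) \<le> K + \<bar>R\<bar> * K" using K(2)[of x] K(1) by linarith
    have "norm (T w) \<le> K * norm w" using K(2)[of w] by (simp add: mult.commute)
    also have "\<dots> \<le> (K + \<bar>R\<bar> * K) * norm w" using K(1) by (intro mult_right_mono) auto
    finally show "norm (T w) \<le> (K + \<bar>R\<bar> * K) * norm w" .
    show "norm (T y - T x - T (y - x)) \<le> (K + \<bar>R\<bar> * K) * (norm (y - x))\<^sup>2"
      using K(1) by (simp add: linear_diff[OF bounded_linear.linear[OF assms]])
  qed (use K in auto)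
qed (auto intro: bounded_linear.continuous_on[OF assms] bounded_linear.linear[OF assms])

text \<open>The remainder of a product is
  \<open>pr rN (M y) + (pr (N' x d) (M' x d) + pr (N x + N' x d) rM)\<close>, with rN and rM the
  remainders of the factors. Its estimate involves the size of the factors, which is why
  \<open>c11_map\<close> bounds N as well.\<close>

lemma c11_map_bilinear:
  fixes N M :: "'a::banach \<Rightarrow> 'a"
  assumes bil: "bounded_bilinear pr" and le: "\<And>a b. norm (pr a b) \<le> norm a * norm b"
    and N: "c11_map N N'" and M: "c11_map M M'"
  shows "c11_map (\<lambda>x. pr (N x) (M x)) (\<lambda>x w. pr (N' x w) (M x) + pr (N x) (M' x w))"
proof -
  interpret bounded_bilinear pr by (rule bil)
  show ?thesis
    unfolding c11_map_def
  proof (intro conjI allI impI)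
    fix b w :: "real \<Rightarrow> 'a"
    assume b: "continuous_on {0..1} b"
    show "continuous_on {0..1} (\<lambda>t. pr (N (b t)) (M (b t)))"
      using N M b by (intro continuous_on) (auto simp: c11_map_def)
    assume w: "continuous_on {0..1} w"
    show "continuous_on {0..1} (\<lambda>t. pr (N' (b t) (w t)) (M (b t)) + pr (N (b t)) (M' (b t) (w t)))"
      using N M b w by (intro continuous_on continuous_on_add) (auto simp: c11_map_def)
  next
    fix x
    have lin: "linear (N' x)" "linear (M' x)" using N M by (auto simp: c11_map_def)
    show "linear (\<lambda>w. pr (N' x w) (M x) + pr (N x) (M' x w))"
      by (rule linearI) (simp_all add: linear_add[OF lin(1)] linear_add[OF lin(2)] linear_scale[OF lin(1)] linear_scale[OF lin(2)]
          add_left add_right scaleR_left scaleR_right algebra_simps)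
  next
    fix R
    obtain C where C: "C \<ge> 0" "\<forall>x y w. norm x \<le> R \<longrightarrow> norm y \<le> R \<longrightarrow>
      norm (N x) \<le> C \<and> norm (N' x w) \<le> C * norm w \<and> norm (N y - N x - N' x (y - x)) \<le> C * (norm (y - x))\<^sup>2"
      using N unfolding c11_map_def by blast
    obtain D where D: "D \<ge> 0" "\<forall>x y w. norm x \<le> R \<longrightarrow> norm y \<le> R \<longrightarrow>
      norm (M x) \<le> D \<and> norm (M' x w) \<le> D * norm w \<and> norm (M y - M x - M' x (y - x)) \<le> D * (norm (y - x))\<^sup>2"
      using M unfolding c11_map_def by blast
    \<comment> \<open>The three remainder terms contribute C * D, C * D and (C + 2 |R| C) * D, where
      \<open>norm d\<close> is at most 2 |R|.\<close>
    define E where "E = 3 * (C * D) + C * (2 * \<bar>R\<bar>) * D"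
    have CD: "C * D \<ge> 0" "C * (2 * \<bar>R\<bar>) * D \<ge> 0" using C(1) D(1) by auto
    show "\<exists>E\<ge>0. \<forall>x y w. norm x \<le> R \<longrightarrow> norm y \<le> R \<longrightarrow>
        norm (pr (N x) (M x)) \<le> E \<and> norm (pr (N' x w) (M x) + pr (N x) (M' x w)) \<le> E * norm w \<and>
        norm (pr (N y) (M y) - pr (N x) (M x) - (pr (N' x (y - x)) (M x) + pr (N x) (M' x (y - x)))) \<le> E * (norm (y - x))\<^sup>2"
    proof (intro exI[of _ E] conjI allI impI)
      show "E \<ge> 0" using CD by (simp add: E_def)
      fix x y w :: 'a assume x: "norm x \<le> R" and y: "norm y \<le> R"
      have n: "norm (N x) \<le> C" "norm (M x) \<le> D" "norm (M y) \<le> D" "norm (N' x w) \<le> C * norm w" "norm (M' x w) \<le> D * norm w"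
        using C(2) D(2) x y by blast+
      have "norm (pr (N x) (M x)) \<le> C * D"
        by (rule order_trans[OF le]) (intro mult_mono n C D norm_ge_zero)
      then show "norm (pr (N x) (M x)) \<le> E" using CD unfolding E_def by linarith
      have "norm (pr (N' x w) (M x) + pr (N x) (M' x w)) \<le> (C * norm w) * D + C * (D * norm w)"
        by (intro norm_triangle_mono order_trans[OF le] mult_mono n C D mult_nonneg_nonneg norm_ge_zero)
      also have "\<dots> = 2 * (C * D) * norm w" by simp
      also have "\<dots> \<le> E * norm w" using CD by (intro mult_right_mono) (auto simp: E_def)
      finally show "norm (pr (N' x w) (M x) + pr (N x) (M' x w)) \<le> E * norm w" .
      define d where "d = y - x"
      define rN where "rN = N y - N x - N' x d"
      define rM where "rM = M y - M x - M' x d"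
      have r: "norm rN \<le> C * (norm d)\<^sup>2" "norm rM \<le> D * (norm d)\<^sup>2" "norm (N' x d) \<le> C * norm d" "norm (M' x d) \<le> D * norm d"
        unfolding rN_def rM_def d_def using C(2) D(2) x y by blast+
      have d2R: "norm d \<le> 2 * \<bar>R\<bar>" unfolding d_def using norm_triangle_ineq4[of y x] x y by linarith
      have nd: "norm (N x + N' x d) \<le> C + C * (2 * \<bar>R\<bar>)"
        by (intro norm_triangle_mono n order_trans[OF r(3)] mult_left_mono d2R C)
      have "N y = N x + N' x d + rN" "M y = M x + M' x d + rM" by (simp_all add: rN_def rM_def)
      then have "pr (N y) (M y) - pr (N x) (M x) - (pr (N' x d) (M x) + pr (N x) (M' x d))
          = pr rN (M y) + (pr (N' x d) (M' x d) + pr (N x + N' x d) rM)"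
        by (simp add: add_left add_right)
      also have "norm \<dots> \<le> (C * (norm d)\<^sup>2) * D + ((C * norm d) * (D * norm d) + (C + C * (2 * \<bar>R\<bar>)) * (D * (norm d)\<^sup>2))"
        by (intro norm_triangle_mono order_trans[OF le] mult_mono n r nd C D mult_nonneg_nonneg add_nonneg_nonneg norm_ge_zero) auto
      also have "\<dots> = E * (norm d)\<^sup>2" by (simp add: E_def power2_eq_square algebra_simps)
      finally show "norm (pr (N y) (M y) - pr (N x) (M x) - (pr (N' x (y - x)) (M x) + pr (N x) (M' x (y - x)))) \<le> E * (norm (y - x))\<^sup>2"
        by (simp add: d_def)
    qed
  qed
qed

lemma c11_map_quintic: "\<exists>N'. c11_map quintic N'"
proof -
  note pr = c11_map_bilinear[OF bounded_bilinear_conv norm_conv_le]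
  note id = c11_map_bounded_linear[OF bounded_linear_ident]
  note cnj = c11_map_bounded_linear[OF bounded_linear_ell1_cnj]
  show ?thesis
    unfolding quintic_def[abs_def] by (rule exI, rule pr[OF id pr[OF id pr[OF id pr[OF cnj cnj]]]])
qed

text \<open>Conjugation with isometries preserves all bounds for \<open>quintic\<close> uniformly in
  time, and the rescaling contributes |t0|.\<close>

theorem nls_field_c11: "\<exists>f'. c11_field (nls_field t0) f'"
proof -
  obtain N' where N': "c11_map quintic N'" using c11_map_quintic by blast
  define f' where "f' \<theta> x w = t0 *\<^sub>R cscale (- \<i>) (schroedinger (- (t0 * \<theta>)) (N' (schroedinger (t0 * \<theta>) x) (schroedinger (t0 * \<theta>) w)))" for \<theta> x w
  have lin: "linear (N' x)" for x using N' by (simp add: c11_map_def)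
  note linear_schroedinger = bounded_linear.linear[OF bounded_linear_schroedinger]
  note linear_cscale = bounded_linear.linear[OF bounded_linear_cscale]
  have linear_rot: "linear (\<lambda>z. t0 *\<^sub>R cscale (- \<i>) (schroedinger s z))" for s
    by (rule linearI) (simp_all add: linear_add[OF linear_schroedinger] linear_add[OF linear_cscale]
        linear_scale[OF linear_schroedinger] linear_scale[OF linear_cscale] scaleR_add_right)
  have "c11_field (nls_field t0) f'"
  proof (rule c11_field.intro)
    fix b w :: "real \<Rightarrow> (int ^ 3) ell1" assume b: "continuous_on {0..1} b"
    have sb: "continuous_on {0..1} (\<lambda>\<theta>. schroedinger (t0 * \<theta>) (b \<theta>))"
      by (intro continuous_on_schroedinger continuous_intros b)
    show "continuous_on {0..1} (\<lambda>\<theta>. nls_field t0 \<theta> (b \<theta>))"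
      unfolding nls_field_def
      by (intro continuous_on_scaleR continuous_on_const bounded_linear.continuous_on[OF bounded_linear_cscale]
          continuous_on_schroedinger continuous_on_quintic[OF sb] continuous_intros)
    assume w: "continuous_on {0..1} w"
    have sw: "continuous_on {0..1} (\<lambda>\<theta>. schroedinger (t0 * \<theta>) (w \<theta>))"
      by (intro continuous_on_schroedinger continuous_intros w)
    have "continuous_on {0..1} (\<lambda>\<theta>. N' (schroedinger (t0 * \<theta>) (b \<theta>)) (schroedinger (t0 * \<theta>) (w \<theta>)))"
      using N' sb sw by (simp add: c11_map_def)
    then show "continuous_on {0..1} (\<lambda>\<theta>. f' \<theta> (b \<theta>) (w \<theta>))"
      unfolding f'_def
      by (intro continuous_on_scaleR continuous_on_const bounded_linear.continuous_on[OF bounded_linear_cscale]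
          continuous_on_schroedinger continuous_intros)
  next
    fix \<theta> :: real and x :: "(int ^ 3) ell1"
    show "linear (f' \<theta> x)"
      unfolding f'_def
      using linear_compose[OF linear_compose[OF linear_schroedinger lin] linear_rot] by (simp add: comp_def)
  next
    fix R
    obtain C where C: "C \<ge> 0" "\<forall>x y w. norm x \<le> R \<longrightarrow> norm y \<le> R \<longrightarrow>
      norm (quintic x) \<le> C \<and> norm (N' x w) \<le> C * norm w \<and> norm (quintic y - quintic x - N' x (y - x)) \<le> C * (norm (y - x))\<^sup>2"
      using N' unfolding c11_map_def by blast
    show "\<exists>C\<ge>0. \<forall>\<theta>\<in>{0..1}. \<forall>x y w. norm x \<le> R \<longrightarrow> norm y \<le> R \<longrightarrow>
      norm (f' \<theta> x w) \<le> C * norm w \<and> norm (nls_field t0 \<theta> y - nls_field t0 \<theta> x - f' \<theta> x (y - x)) \<le> C * (norm (y - x))\<^sup>2"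
    proof (intro exI[of _ "\<bar>t0\<bar> * C"] conjI allI impI ballI)
      show "\<bar>t0\<bar> * C \<ge> 0" using C(1) by simp
      fix \<theta> :: real and x y w :: "(int ^ 3) ell1"
      assume x: "norm x \<le> R" and y: "norm y \<le> R"
      let ?S = "schroedinger (t0 * \<theta>)"
      have "norm (N' (?S x) (?S w)) \<le> C * norm (?S w)" using C(2) x y by (metis norm_schroedinger)
      then show "norm (f' \<theta> x w) \<le> \<bar>t0\<bar> * C * norm w"
        by (simp add: f'_def mult.assoc mult_left_mono)
      define r where "r = quintic (?S y) - quintic (?S x) - N' (?S x) (?S (y - x))"
      have Sd: "?S (y - x) = ?S y - ?S x" by (rule linear_diff[OF linear_schroedinger])
      have "norm r \<le> C * (norm (?S y - ?S x))\<^sup>2"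
        unfolding r_def Sd using C(2) x y by (metis norm_schroedinger)
      then have "norm r \<le> C * (norm (y - x))\<^sup>2" by (simp flip: Sd)
      moreover have "nls_field t0 \<theta> y - nls_field t0 \<theta> x - f' \<theta> x (y - x) = t0 *\<^sub>R cscale (- \<i>) (schroedinger (- (t0 * \<theta>)) r)"
        unfolding nls_field_def f'_def r_def
        by (simp add: linear_diff[OF linear_schroedinger] linear_diff[OF linear_cscale] scaleR_diff_right)
      ultimately show "norm (nls_field t0 \<theta> y - nls_field t0 \<theta> x - f' \<theta> x (y - x)) \<le> \<bar>t0\<bar> * C * (norm (y - x))\<^sup>2"
        by (simp add: mult.assoc mult_left_mono)
    qed
  qed
  then show ?thesis by blast
qed

section \<open>Preimages of null sets\<close>

text \<open>A complex number serves as a pair of real coordinates, so the plane carries Lebesgue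
  measure on the very space in which F takes its values.\<close>

definition plane_step :: "'a::real_vector \<Rightarrow> 'a \<Rightarrow> complex \<Rightarrow> 'a" where
  "plane_step h h' y = Re y *\<^sub>R h + Im y *\<^sub>R h'"

lemma plane_step_add: "plane_step h h' (y + z) = plane_step h h' y + plane_step h h' z"
  and plane_step_diff: "plane_step h h' (y - z) = plane_step h h' y - plane_step h h' z"
  and plane_step_scaleR: "plane_step h h' (r *\<^sub>R y) = r *\<^sub>R plane_step h h' y"
  by (simp_all add: plane_step_def algebra_simps)

lemma linear_plane_step: "linear (plane_step h h')"
  by (rule linearI) (simp_all add: plane_step_add plane_step_scaleR)

lemma continuous_on_plane_step [continuous_intros]:
  "continuous_on S f \<Longrightarrow> continuous_on S (\<lambda>x. plane_step (h :: 'a::real_normed_vector) h' (f x))"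
  unfolding plane_step_def by (intro continuous_intros)

lemma norm_plane_step_le: "norm (plane_step h h' y) \<le> (norm h + norm h') * norm y"
proof -
  have "norm (plane_step h h' y) \<le> \<bar>Re y\<bar> * norm h + \<bar>Im y\<bar> * norm h'"
    unfolding plane_step_def by (rule norm_triangle_le) simp
  also have "\<dots> \<le> norm y * norm h + norm y * norm h'"
    by (intro add_mono mult_right_mono abs_Re_le_cmod abs_Im_le_cmod) auto
  finally show ?thesis by (simp add: algebra_simps)
qed

text \<open>Im (cnj p * q) is the determinant of p and q as real vectors. If it vanished for all
  pairs of coordinate directions, then for each such image e it would vanish on e and any value of
  U, by density; surjectivity forces e = 0, and then U = 0.\<close>

lemma ell1_surj_independent_directions:
  fixes U :: "'k ell1 \<Rightarrow> complex"
  assumes lin: "bounded_linear U" and surj: "surj U"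
  obtains k z k' z' where "z \<in> {1, \<i>}" "z' \<in> {1, \<i>}"
    "Im (cnj (U (ell1_single k z)) * U (ell1_single k' z')) \<noteq> 0"
proof (rule ccontr)
  assume "\<not> thesis"
  with that have dep: "Im (cnj (U (ell1_single k z)) * U (ell1_single k' z')) = 0"
    if "z \<in> {1, \<i>}" "z' \<in> {1, \<i>}" for k z k' z'
    using that by blast
  have span: "ell1_single k z = Re z *\<^sub>R ell1_single k 1 + Im z *\<^sub>R ell1_single k \<i>" for k :: 'k and z
    by (rule ell1_eqI) (simp add: complex_eq_iff)
  have zero: "U (ell1_single k z) = 0" if z: "z \<in> {1, \<i>}" for k z
  proof -
    define e where "e = U (ell1_single k z)"
    have "bounded_linear (\<lambda>q. Im (cnj e * U q))"
      by (intro bounded_linear_compose[OF bounded_linear_Im] bounded_linear_compose[OF bounded_linear_mult_right] lin)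
    moreover have "Im (cnj e * U (ell1_single k' w)) = 0" for k' w
    proof -
      have "cnj e * U (ell1_single k' w) = Re w *\<^sub>R (cnj e * U (ell1_single k' 1)) + Im w *\<^sub>R (cnj e * U (ell1_single k' \<i>))"
        by (subst span) (simp add: linear_add[OF bounded_linear.linear[OF lin]] linear_scale[OF bounded_linear.linear[OF lin]] algebra_simps)
      then show ?thesis using dep[OF z, of 1 k k'] dep[OF z, of \<i> k k'] by (simp only: e_def) simp
    qed
    ultimately have 0: "Im (cnj e * U q) = 0" for q by (rule bounded_linear_ell1_eq_0)
    \<comment> \<open>The determinant of e and i * e is |e|^2.\<close>
    obtain q where "U q = \<i> * e" using surj by (metis surjD)
    with 0[of q] have "Re e * Re e + Im e * Im e = 0" by simp
    then show ?thesis by (simp add: e_def[symmetric] complex_eq_iff)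
  qed
  have "U (ell1_single k z) = 0" for k z
    by (subst span) (simp add: zero linear_add[OF bounded_linear.linear[OF lin]] linear_scale[OF bounded_linear.linear[OF lin]])
  with lin have "U q = 0" for q by (rule bounded_linear_ell1_eq_0)
  with surj show False by (metis surjD zero_neq_one)
qed

text \<open>A measurable substitute for the set of points at which the derivative of \<open>F\<close> along the plane of
  \<open>h\<close> and \<open>h'\<close> is invertible: on a slice, \<open>F\<close> has a locally Lipschitz inverse.\<close>

definition expansion_set :: "'a::real_normed_vector set \<Rightarrow> ('a \<Rightarrow> complex) \<Rightarrow> 'a \<Rightarrow> 'a \<Rightarrow> nat \<Rightarrow> 'a set" where
  "expansion_set D F h h' n = {a \<in> D. \<forall>y. norm y \<le> 1 / real (Suc n) \<and> a + plane_step h h' y \<in> D \<longrightarrow>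
     norm y / real (Suc n) \<le> norm (F (a + plane_step h h' y) - F a)}"

text \<open>On the plane of two independent directions the derivative is injective, hence bounded
  below by some B. Near a the Taylor error is at most half of that, and n is chosen so large that
  \<open>1 / real (Suc n)\<close> lies below both B / 2 and the admissible step.\<close>

lemma mem_expansion_set:
  fixes F :: "'k ell1 \<Rightarrow> complex"
  assumes a: "a \<in> D" and F: "(F has_derivative U) (at a)" and surj: "surj U"
  obtains k z k' z' n where "z \<in> {1, \<i>}" "z' \<in> {1, \<i>}"
    "a \<in> expansion_set D F (ell1_single k z) (ell1_single k' z') n"
proof -
  have lin: "bounded_linear U" by (rule has_derivative_bounded_linear[OF F])
  obtain k z k' z' where z: "z \<in> {1, \<i>}" "z' \<in> {1, \<i>}" and ind: "Im (cnj (U (ell1_single k z)) * U (ell1_single k' z')) \<noteq> 0"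
    by (rule ell1_surj_independent_directions[OF lin surj]) blast
  define h where "h = ell1_single k z"
  define h' where "h' = ell1_single k' z'"
  let ?p = "plane_step h h'"
  have linUp: "linear (\<lambda>y. U (?p y))"
    using linear_compose[OF linear_plane_step bounded_linear.linear[OF lin]] by (simp add: comp_def)
  have "inj (\<lambda>y. U (?p y))"
  proof (rule linear_injective_0[OF linUp, THEN iffD2], intro allI impI)
    fix y assume "U (?p y) = 0"
    then have 0: "Re y *\<^sub>R U h + Im y *\<^sub>R U h' = 0"
      by (simp add: plane_step_def linear_add[OF bounded_linear.linear[OF lin]] linear_scale[OF bounded_linear.linear[OF lin]])
    define p where "p = U h"
    define q where "q = U h'"
    have pq: "Re p * Im q - Im p * Re q \<noteq> 0" using ind by (simp add: h_def h'_def p_def q_def algebra_simps)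
    have "Re y * Re p + Im y * Re q = 0" "Re y * Im p + Im y * Im q = 0"
      using 0 by (simp_all add: p_def q_def complex_eq_iff)
    then have "Re y * (Re p * Im q - Im p * Re q) = 0" "Im y * (Re p * Im q - Im p * Re q) = 0"
      by algebra+
    with pq show "y = 0" by (simp add: complex_eq_iff)
  qed
  then obtain B where B: "B > 0" "\<And>y. B * norm y \<le> norm (U (?p y))"
    using linear_inj_bounded_below_pos[OF linUp] by metis
  define K where "K = norm h + norm h' + 1"
  have K: "K > 0" "norm (?p y) \<le> K * norm y" for y
    using norm_plane_step_le[of h h' y] by (auto simp: K_def algebra_simps add_pos_nonneg intro: order_trans)
  \<comment> \<open>K bounds the plane map, so the Taylor error on a step y is at most B / 2 * norm
    y.\<close>
  define e where "e = B / (2 * K)"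
  have e: "e > 0" using B K by (simp add: e_def)
  obtain d where d: "d > 0" "\<And>v. norm (v - a) < d \<Longrightarrow> norm (F v - F a - U (v - a)) \<le> e * norm (v - a)"
    using F e unfolding has_derivative_at_alt by metis
  have "min (B / 2) (d / K) > 0" using B d K by simp
  then obtain n where n: "1 / real (Suc n) < min (B / 2) (d / K)"
    using nat_approx_posE by blast
  have "a \<in> expansion_set D F h h' n"
    unfolding expansion_set_def
  proof (intro CollectI conjI a allI impI)
    fix y assume y: "norm y \<le> 1 / real (Suc n) \<and> a + ?p y \<in> D"
    then have "norm y < d / K" using n by linarith
    then have "K * norm y < d" using K(1) by (simp add: field_simps)
    then have "norm (F (a + ?p y) - F a - U (?p y)) \<le> e * norm (?p y)"
      using d(2)[of "a + ?p y"] K(2)[of y] by simp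
    also have "\<dots> \<le> e * (K * norm y)" using e K(2)[of y] by (intro mult_left_mono) auto
    also have "\<dots> = B / 2 * norm y" using K(1) by (simp add: e_def)
    finally have "B * norm y - B / 2 * norm y \<le> norm (F (a + ?p y) - F a)"
      using B(2)[of y] norm_triangle_ineq2[of "U (?p y)" "U (?p y) - (F (a + ?p y) - F a)"]
      by (simp add: norm_minus_commute)
    moreover have "norm y / real (Suc n) \<le> B / 2 * norm y"
      using mult_right_mono[of "1 / real (Suc n)" "B / 2" "norm y"] n by simp
    ultimately show "norm y / real (Suc n) \<le> norm (F (a + ?p y) - F a)" by linarith
  qed
  then show ?thesis using that z unfolding h_def h'_def by blast
qed

text \<open>For fixed y, violation of the inequality is an open condition on a; the union over all
  y, though uncountable, is open, and removing it from D leaves a Borel set.\<close>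

lemma expansion_set_borel:
  fixes F :: "'a::real_normed_vector \<Rightarrow> complex"
  assumes D: "open D" and F: "continuous_on D F"
  shows "expansion_set D F h h' n \<in> sets borel"
proof -
  define A where "A y = {a \<in> D \<inter> (\<lambda>a. a + plane_step h h' y) -` D. norm (F (a + plane_step h h' y) - F a) < norm y / real (Suc n)}" for y
  have "open (A y)" for y
  proof -
    have o: "open (D \<inter> (\<lambda>a. a + plane_step h h' y) -` D)"
      by (intro open_Int D open_vimage continuous_intros)
    have "continuous_on (D \<inter> (\<lambda>a. a + plane_step h h' y) -` D) (\<lambda>a. norm (F (a + plane_step h h' y) - F a))"
      by (intro continuous_intros continuous_on_compose2[OF F] continuous_on_subset[OF F]) auto
    from continuous_open_preimage[OF this o, of "{..< norm y / real (Suc n)}"]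
    have "open ((D \<inter> (\<lambda>a. a + plane_step h h' y) -` D) \<inter> (\<lambda>a. norm (F (a + plane_step h h' y) - F a)) -` {..< norm y / real (Suc n)})"
      by simp
    also have "\<dots> = A y" by (auto simp: A_def)
    finally show ?thesis .
  qed
  then have "open (\<Union>y\<in>{y. norm y \<le> 1 / real (Suc n)}. A y)" by auto
  moreover have "expansion_set D F h h' n = D - (\<Union>y\<in>{y. norm y \<le> 1 / real (Suc n)}. A y)"
    by (auto simp: expansion_set_def A_def not_less)
  ultimately show ?thesis using D by auto
qed

text \<open>On a piece of small diameter the expansion estimate makes F injective along the slice,
  with a Lipschitz inverse. The piece is the image under this inverse of a subset of B, and
  Lipschitz maps of the plane preserve null sets.\<close>

lemma expansion_set_slice_negligible:
  assumes B: "negligible B"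
  shows "negligible {y. a + plane_step h h' y \<in> expansion_set D F h h' n \<and> F (a + plane_step h h' y) \<in> B}"
    (is "negligible ?S")
proof -
  define f where "f y = F (a + plane_step h h' y)" for y
  have exp: "norm (y - z) \<le> real (Suc n) * norm (f y - f z)" if "y \<in> ?S" "z \<in> ?S" "norm (y - z) \<le> 1 / real (Suc n)" for y z
  proof -
    have *: "(a + plane_step h h' z) + plane_step h h' (y - z) = a + plane_step h h' y"
      by (simp add: plane_step_diff)
    have "a + plane_step h h' z \<in> expansion_set D F h h' n" "(a + plane_step h h' z) + plane_step h h' (y - z) \<in> D"
      unfolding * using that by (auto simp: expansion_set_def)
    then have "norm (y - z) / real (Suc n) \<le> norm (F ((a + plane_step h h' z) + plane_step h h' (y - z)) - f z)"
      unfolding expansion_set_def f_def using that(3) by (auto dest!: spec[of _ "y - z"])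
    then have "norm (y - z) / real (Suc n) \<le> norm (f y - f z)"
      unfolding * f_def .
    then show ?thesis by (simp add: field_simps)
  qed
  show ?thesis
    unfolding locally_negligible_alt[of ?S]
  proof
    fix x assume x: "x \<in> ?S"
    \<comment> \<open>The halved radius keeps mutual distances in T within the range where the
      expansion estimate applies.\<close>
    define T where "T = ?S \<inter> ball x (1 / (2 * real (Suc n)))"
    have close: "norm (y - z) \<le> 1 / real (Suc n)" if "y \<in> T" "z \<in> T" for y z
    proof -
      have "dist y z \<le> dist x y + dist x z" by (metis dist_commute dist_triangle)
      also have "\<dots> \<le> 1 / (2 * real (Suc n)) + 1 / (2 * real (Suc n))"
        using that by (intro add_mono) (auto simp: T_def)
      also have "\<dots> = 1 / real (Suc n)" by (simp add: field_simps)
      finally show ?thesis by (simp add: dist_norm)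
    qed
    have lip: "norm (y - z) \<le> real (Suc n) * norm (f y - f z)" if "y \<in> T" "z \<in> T" for y z
      using exp[of y z] close[OF that] that by (auto simp: T_def)
    have inj: "inj_on f T"
    proof (rule inj_onI)
      fix y z assume "y \<in> T" "z \<in> T" "f y = f z"
      with lip[of y z] show "y = z" by simp
    qed
    have fT: "negligible (f ` T)"
      by (rule negligible_subset[OF B]) (auto simp: T_def f_def)
    have lip_inv: "\<exists>V C. open V \<and> w \<in> V \<and> (\<forall>v\<in>f ` T \<inter> V. norm (the_inv_into T f v - the_inv_into T f w) \<le> C * norm (v - w))"
      if "w \<in> f ` T" for w
      using that lip by (intro exI[of _ UNIV] exI[of _ "real (Suc n)"]) (auto simp: the_inv_into_f_f[OF inj])
    have "negligible (the_inv_into T f ` (f ` T))"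
      by (rule negligible_locally_Lipschitz_image[OF _ fT lip_inv]) simp_all
    also have "the_inv_into T f ` (f ` T) = T"
      using inj by (force simp: image_image the_inv_into_f_f)
    finally have "negligible T" .
    moreover have "openin (top_of_set ?S) T" unfolding T_def by (intro openin_open_Int) simp
    moreover have "x \<in> T" using x by (simp add: T_def)
    ultimately show "\<exists>U. openin (top_of_set ?S) U \<and> x \<in> U \<and> negligible U" by blast
  qed
qed

lemma borel_measurable_ell1_single [measurable]: "ell1_single k \<in> borel_measurable borel"
  by (intro borel_measurable_continuous_onI bounded_linear.continuous_on[OF bounded_linear_ell1_single] continuous_on_id)

text \<open>Tonelli exchanges the order: for every base point almost every y avoids X, so for almost
  every y the translated datum avoids X almost surely. One such y is enough for
  quasi-invariance.\<close>

lemma AE_plane_slices: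
  fixes X :: "'k::countable ell1 set"
  assumes M: "prob_space M" and X: "X \<in> sets borel" and a: "a \<in> borel_measurable M"
    and null: "\<And>x. negligible {y. x + plane_step h h' y \<in> X}"
  shows "\<exists>y. AE \<omega> in M. a \<omega> + plane_step h h' y \<notin> X"
proof -
  interpret prob_space M by fact
  interpret P: pair_sigma_finite M "lborel :: complex measure" ..
  note [measurable] = X a
  have [measurable]: "plane_step h h' \<in> borel_measurable borel"
    by (intro borel_measurable_continuous_onI continuous_intros continuous_on_id)
  have "AE y in lborel. x + plane_step h h' y \<notin> X" for x
  proof -
    have "{y. x + plane_step h h' y \<in> X} \<in> sets lborel" by measurable
    then have "{y. x + plane_step h h' y \<in> X} \<in> null_sets lborel"
      using null[of x] by (simp add: negligible_iff_null_sets null_sets_completion_iff)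
    then show ?thesis by (auto dest: AE_not_in)
  qed
  then have "AE \<omega> in M. AE y in lborel. a \<omega> + plane_step h h' y \<notin> X" by simp
  moreover have "{x \<in> space (M \<Otimes>\<^sub>M lborel). a (fst x) + plane_step h h' (snd x) \<notin> X} \<in> sets (M \<Otimes>\<^sub>M lborel)"
    by measurable
  ultimately have ae: "AE y in lborel. AE \<omega> in M. a \<omega> + plane_step h h' y \<notin> X"
    using P.AE_commute[of "\<lambda>\<omega> y. a \<omega> + plane_step h h' y \<notin> X"] by simp
  \<comment> \<open>Lebesgue measure is not zero, so a statement valid for almost every y has a
    witness.\<close>
  have "\<not> (AE y in (lborel :: complex measure). False)"
    by (simp add: AE_iff_measurable[OF _ refl])
  with ae show ?thesis by (metis (mono_tags, lifting) eventually_mono)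
qed

lemma continuous_on_if_has_derivative:
  assumes "\<And>x. x \<in> D \<Longrightarrow> \<exists>U. (F has_derivative U) (at x) \<and> P U"
  shows "continuous_on D F"
proof (intro continuous_at_imp_continuous_on ballI)
  fix x assume "x \<in> D"
  then obtain U where "(F has_derivative U) (at x)" using assms by blast
  then show "isCont F x" by (rule has_derivative_continuous)
qed

theorem AE_not_in_null_set:
  fixes F :: "'k::countable ell1 \<Rightarrow> complex"
  assumes M: "prob_space M" and a: "a \<in> borel_measurable M"
    and quasi: "\<And>k z V. V \<in> sets borel \<Longrightarrow> AE \<omega> in M. a \<omega> + ell1_single k z \<notin> V \<Longrightarrow> AE \<omega> in M. a \<omega> \<notin> V"
    and D: "open D" "AE \<omega> in M. a \<omega> \<in> D"
    and F: "\<And>x. x \<in> D \<Longrightarrow> \<exists>U. (F has_derivative U) (at x) \<and> surj U"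
    and B: "B \<in> null_sets lborel"
  shows "AE \<omega> in M. F (a \<omega>) \<notin> B"
proof -
  have cF: "continuous_on D F" by (rule continuous_on_if_has_derivative[OF F])
  have neg: "negligible B" and Bb: "B \<in> sets borel"
    using B by (auto simp: negligible_iff_null_sets null_sets_completionI)
  have FB: "D \<inter> F -` B \<in> sets borel"
  proof -
    have "(\<lambda>x. indicator D x *\<^sub>R F x) \<in> borel_measurable borel"
      using D(1) by (intro borel_measurable_continuous_on_indicator cF) auto
    from measurable_sets[OF this Bb] have "D \<inter> ((\<lambda>x. indicator D x *\<^sub>R F x) -` B) \<in> sets borel"
      using D(1) by auto
    also have "D \<inter> ((\<lambda>x. indicator D x *\<^sub>R F x) -` B) = D \<inter> F -` B" by auto
    finally show ?thesis .
  qed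
  define X where "X k z k' z' n = expansion_set D F (ell1_single k z) (ell1_single k' z') n \<inter> F -` B" for k z k' z' n
  have Xb: "X k z k' z' n \<in> sets borel" for k z k' z' n
  proof -
    have "X k z k' z' n = expansion_set D F (ell1_single k z) (ell1_single k' z') n \<inter> (D \<inter> F -` B)"
      by (auto simp: X_def expansion_set_def)
    then show ?thesis using expansion_set_borel[OF D(1) cF] FB by auto
  qed
  have "AE \<omega> in M. a \<omega> \<notin> X k z k' z' n" for k z k' z' n
  proof -
    let ?p = "plane_step (ell1_single k z) (ell1_single k' z')"
    have "negligible {y. x + ?p y \<in> X k z k' z' n}" for x
      using expansion_set_slice_negligible[OF neg] by (simp add: X_def)
    from AE_plane_slices[OF M Xb a this]
    obtain y where y: "AE \<omega> in M. a \<omega> + ?p y \<notin> X k z k' z' n" by blast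
    \<comment> \<open>A plane step is a sum of two translations of single coefficients, possibly at
      the same index; \<open>quasi\<close> undoes them one after the other.\<close>
    have p: "?p y = ell1_single k (Re y *\<^sub>R z) + ell1_single k' (Im y *\<^sub>R z')"
      by (rule ell1_eqI) (simp add: plane_step_def)
    define V where "V = (\<lambda>x. x + ell1_single k (Re y *\<^sub>R z)) -` X k z k' z' n"
    have "(\<lambda>x. x + ell1_single k (Re y *\<^sub>R z)) \<in> borel_measurable borel"
      by (intro borel_measurable_continuous_onI continuous_intros)
    from measurable_sets[OF this Xb] have "V \<in> sets borel" by (simp add: V_def)
    moreover have "AE \<omega> in M. a \<omega> + ell1_single k' (Im y *\<^sub>R z') \<notin> V"
      using y by (simp add: V_def p add_ac)
    ultimately have "AE \<omega> in M. a \<omega> \<notin> V" by (rule quasi)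
    then have "AE \<omega> in M. a \<omega> + ell1_single k (Re y *\<^sub>R z) \<notin> X k z k' z' n" by (simp add: V_def)
    then show ?thesis by (rule quasi[OF Xb])
  qed
  \<comment> \<open>Only countably many exceptional sets occur, and \<open>mem_expansion_set\<close>
    shows that they cover the part of D that F sends into B.\<close>
  then have "AE \<omega> in M. \<forall>k k' n. \<forall>z\<in>{1, \<i>}. \<forall>z'\<in>{1, \<i>}. a \<omega> \<notin> X k z k' z' n"
    by (simp add: AE_all_countable AE_ball_countable)
  with D(2) show ?thesis
  proof eventually_elim
    case (elim \<omega>)
    obtain U where "(F has_derivative U) (at (a \<omega>))" "surj U" using F[OF elim(1)] by blast
    then obtain k z k' z' n where z: "z \<in> {1, \<i>}" "z' \<in> {1, \<i>}"
      and mem: "a \<omega> \<in> expansion_set D F (ell1_single k z) (ell1_single k' z') n"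
      by (rule mem_expansion_set[OF elim(1)]) blast
    from elim(2)[rule_format, OF z, of k k' n] mem show ?case by (simp add: X_def)
  qed
qed

section \<open>Independence and translation of one coordinate\<close>

lemma (in prob_space) AE_indep_pair_iff:
  fixes X R :: "'a \<Rightarrow> 'b::second_countable_topology"
  assumes ind: "indep_var borel X borel R" and V: "V \<in> sets (borel \<Otimes>\<^sub>M borel)"
  shows "(AE \<omega> in M. (X \<omega>, R \<omega>) \<notin> V) \<longleftrightarrow> (AE r in distr M borel R. AE x in distr M borel X. (x, r) \<notin> V)"
proof -
  have rv [measurable]: "X \<in> borel_measurable M" "R \<in> borel_measurable M"
    and eq: "distr M borel X \<Otimes>\<^sub>M distr M borel R = distr M (borel \<Otimes>\<^sub>M borel) (\<lambda>\<omega>. (X \<omega>, R \<omega>))"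
    using ind unfolding indep_var_distribution_eq by auto
  interpret DX: prob_space "distr M borel X" by (rule prob_space_distr) simp
  interpret DR: prob_space "distr M borel R" by (rule prob_space_distr) simp
  interpret P: pair_sigma_finite "distr M borel X" "distr M borel R" ..
  note [measurable] = V
  have Vc: "{x \<in> space (distr M borel X \<Otimes>\<^sub>M distr M borel R). (fst x, snd x) \<notin> V} \<in> sets (distr M borel X \<Otimes>\<^sub>M distr M borel R)"
    using sets.compl_sets[OF V] by (simp add: space_pair_measure set_diff_eq cong: sets_pair_measure_cong)
  have "(AE \<omega> in M. (X \<omega>, R \<omega>) \<notin> V) \<longleftrightarrow> (AE x in distr M (borel \<Otimes>\<^sub>M borel) (\<lambda>\<omega>. (X \<omega>, R \<omega>)). x \<notin> V)"
    by (subst AE_distr_iff) auto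
  also have "\<dots> \<longleftrightarrow> (AE x in distr M borel X. AE r in distr M borel R. (x, r) \<notin> V)"
    unfolding eq[symmetric] using P.AE_pair_iff[of "\<lambda>x r. (x, r) \<notin> V", OF Vc] by simp
  \<comment> \<open>The remainder is put outside, so that for fixed r only the law of one coordinate
    is compared with its translate.\<close>
  also have "\<dots> \<longleftrightarrow> (AE r in distr M borel R. AE x in distr M borel X. (x, r) \<notin> V)"
    by (rule P.AE_commute[OF Vc])
  finally show ?thesis .
qed

lemma AE_lborel_translate:
  fixes c :: "'a::euclidean_space"
  assumes "{x. P x} \<in> sets borel"
  shows "(AE x in lborel. P (c + x)) \<longleftrightarrow> (AE x in lborel. P x)"
proof -
  have "(AE x in lborel. P x) \<longleftrightarrow> (AE x in distr lborel borel ((+) c). P x)"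
    by (subst lborel_distr_plus) (rule refl)
  also have "\<dots> \<longleftrightarrow> (AE x in lborel. P (c + x))"
    by (rule AE_distr_iff) (use assms in auto)
  finally show ?thesis by simp
qed

text \<open>The constant \<^const>\<open>prob_space.indep_var\<close> needs both variables in the same type, hence the embedding of \<open>X\<close>.\<close>

lemma (in prob_space) AE_translate_indep:
  fixes X :: "'a \<Rightarrow> complex" and R :: "'a \<Rightarrow> 'k::countable ell1"
  assumes ind: "indep_var borel (\<lambda>\<omega>. ell1_single k (c * X \<omega>)) borel R"
    and Xm: "X \<in> borel_measurable M" and X: "distr M borel X = density lborel p"
    and p: "p \<in> borel_measurable borel" "\<And>x. p x > 0"
    and V: "V \<in> sets borel" and c: "c \<noteq> 0"
    and ae: "AE \<omega> in M. ell1_single k (c * X \<omega>) + R \<omega> + ell1_single k z \<notin> V"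
  shows "AE \<omega> in M. ell1_single k (c * X \<omega>) + R \<omega> \<notin> V"
proof -
  note [measurable] = V Xm p(1)
  define V0 where "V0 = {xr. fst xr + snd xr \<in> V}"
  define V1 where "V1 = {xr. fst xr + snd xr + ell1_single k z \<in> V}"
  have "{xr \<in> space (borel \<Otimes>\<^sub>M borel). fst xr + snd xr \<in> V} \<in> sets (borel \<Otimes>\<^sub>M borel)"
    "{xr \<in> space (borel \<Otimes>\<^sub>M borel). fst xr + snd xr + ell1_single k z \<in> V} \<in> sets (borel \<Otimes>\<^sub>M borel)"
    by measurable
  then have V0: "V0 \<in> sets (borel \<Otimes>\<^sub>M borel)" and V1: "V1 \<in> sets (borel \<Otimes>\<^sub>M borel)"
    by (simp_all add: V0_def V1_def space_pair_measure)
  \<comment> \<open>A positive density gives X the same null sets as Lebesgue measure.\<close>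
  have D: "(AE x in distr M borel (\<lambda>\<omega>. ell1_single k (c * X \<omega>)). Q x) \<longleftrightarrow> (AE x in lborel. Q (ell1_single k (c * x)))"
    if Q: "{x. Q x} \<in> sets borel" for Q
  proof -
    have eq: "distr M borel (\<lambda>\<omega>. ell1_single k (c * X \<omega>)) = distr (density lborel p) borel (\<lambda>x. ell1_single k (c * x))"
      unfolding X[symmetric] by (subst distr_distr) (auto simp: comp_def)
    show ?thesis unfolding eq
      by (subst AE_distr_iff) (use Q p in \<open>auto simp: AE_density\<close>)
  qed
  have "(AE x in distr M borel (\<lambda>\<omega>. ell1_single k (c * X \<omega>)). (x, r) \<notin> V1)
      \<longleftrightarrow> (AE x in distr M borel (\<lambda>\<omega>. ell1_single k (c * X \<omega>)). (x, r) \<notin> V0)" for r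
  proof -
    have m: "{x. (x, r) \<notin> V0} \<in> sets borel" "{x. (x, r) \<notin> V1} \<in> sets borel" "{x. (ell1_single k (c * x), r) \<notin> V0} \<in> sets borel"
      unfolding V0_def V1_def by simp_all
    \<comment> \<open>Adding z to the coefficient c * X translates X by z / c.\<close>
    have "(ell1_single k (c * x), r) \<in> V1 \<longleftrightarrow> (ell1_single k (c * (z / c + x)), r) \<in> V0" for x
    proof -
      have "ell1_single k (c * x) + r + ell1_single k z = ell1_single k (c * (z / c + x)) + r"
        using c by (intro ell1_eqI) (simp add: algebra_simps)
      then show ?thesis by (simp only: V0_def V1_def mem_Collect_eq fst_conv snd_conv)
    qed
    then show ?thesis
      using AE_lborel_translate[of "\<lambda>x. (ell1_single k (c * x), r) \<notin> V0" "z / c"] m by (simp add: D)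
  qed
  moreover have "AE r in distr M borel R. AE x in distr M borel (\<lambda>\<omega>. ell1_single k (c * X \<omega>)). (x, r) \<notin> V1"
    using AE_indep_pair_iff[OF ind V1] ae by (simp add: V1_def)
  ultimately have "AE r in distr M borel R. AE x in distr M borel (\<lambda>\<omega>. ell1_single k (c * X \<omega>)). (x, r) \<notin> V0" by simp
  then show ?thesis using AE_indep_pair_iff[OF ind V0] by (simp add: V0_def)
qed

text \<open>An increasing sequence of finite sets absorbing every finite set; it turns conditions on
  all finite sets into countable ones.\<close>

definition enum_below :: "nat \<Rightarrow> 'k::countable set" where
  "enum_below n = {k. to_nat k < n}"

lemma finite_enum_below: "finite (enum_below n)"
  unfolding enum_below_def by (rule finite_imageD[of to_nat]) (auto intro: finite_subset[of _ "{..<n}"])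

lemma enum_below_mono: "m \<le> n \<Longrightarrow> enum_below m \<subseteq> enum_below n"
  by (auto simp: enum_below_def)

lemma finite_subset_enum_below:
  assumes "finite F"
  obtains n where "F \<subseteq> enum_below n"
proof -
  obtain n where "\<forall>i\<in>to_nat ` F. i < n"
    using finite_nat_set_iff_bounded[of "to_nat ` F"] assms by auto
  then show ?thesis using that[of n] by (auto simp: enum_below_def)
qed

text \<open>The map is the pointwise limit of finite sums of its coordinates along the sets
  \<open>enum_below n\<close>.\<close>

lemma borel_measurable_ell1I:
  fixes h :: "'a \<Rightarrow> 'k::countable ell1"
  assumes [measurable]: "\<And>k. (\<lambda>x. coef (h x) k) \<in> borel_measurable M"
  shows "h \<in> borel_measurable M"
proof (rule borel_measurable_LIMSEQ_metric)
  show "(\<lambda>x. \<Sum>k\<in>enum_below n. ell1_single k (coef (h x) k)) \<in> borel_measurable M" for n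
    by measurable
  fix x
  have "filterlim enum_below (finite_subsets_at_top (UNIV :: 'k set)) sequentially"
    unfolding filterlim_finite_subsets_at_top
  proof (intro allI impI)
    fix Y :: "'k set" assume "finite Y \<and> Y \<subseteq> UNIV"
    then obtain N where N: "Y \<subseteq> enum_below N" using finite_subset_enum_below by blast
    show "\<forall>\<^sub>F n in sequentially. finite (enum_below n :: 'k set) \<and> Y \<subseteq> enum_below n \<and> enum_below n \<subseteq> (UNIV :: 'k set)"
      using eventually_ge_at_top[of N]
      by eventually_elim (use N enum_below_mono finite_enum_below in blast)
  qed
  from filterlim_compose[OF has_sum_ell1_single[of "h x", unfolded has_sum_def] this]
  show "(\<lambda>n. \<Sum>k\<in>enum_below n. ell1_single k (coef (h x) k)) \<longlonglongrightarrow> h x" .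
qed

section \<open>Gaussian data\<close>

text \<open>The default 0 off the event of summability makes the datum a measurable function of all
  samples.\<close>

definition ell1_data :: "('k \<Rightarrow> complex) \<Rightarrow> 'k ell1" where
  "ell1_data \<alpha> = (if (\<lambda>k. norm (\<alpha> k)) summable_on UNIV then Ell1 \<alpha> else 0)"

lemma coef_ell1_data:
  "coef (ell1_data \<alpha>) k = (if (\<lambda>k. norm (\<alpha> k)) summable_on UNIV then \<alpha> k else 0)"
  by (simp add: ell1_data_def coef_Ell1)

lemma sets_abs_summable:
  fixes X :: "'a \<Rightarrow> 'k::countable \<Rightarrow> complex"
  assumes [measurable]: "\<And>k. (\<lambda>\<omega>. X \<omega> k) \<in> borel_measurable M"
  shows "Measurable.pred M (\<lambda>\<omega>. (\<lambda>k. norm (X \<omega> k)) summable_on UNIV)"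
proof -
  have "(\<lambda>k. norm (X \<omega> k)) summable_on UNIV \<longleftrightarrow> (\<exists>N::nat. \<forall>n. (\<Sum>k\<in>enum_below n. norm (X \<omega> k)) \<le> real N)" for \<omega>
  proof
    assume s: "(\<lambda>k. norm (X \<omega> k)) summable_on UNIV"
    obtain N :: nat where N: "(\<Sum>\<^sub>\<infinity>k. norm (X \<omega> k)) \<le> real N" using real_arch_simple by blast
    have "(\<Sum>k\<in>enum_below n. norm (X \<omega> k)) \<le> real N" for n
      by (rule order_trans[OF finite_sum_le_infsum[OF s finite_enum_below] N]) auto
    then show "\<exists>N::nat. \<forall>n. (\<Sum>k\<in>enum_below n. norm (X \<omega> k)) \<le> real N" by blast
  next
    assume "\<exists>N::nat. \<forall>n. (\<Sum>k\<in>enum_below n. norm (X \<omega> k)) \<le> real N"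
    then obtain N :: nat where N: "\<And>n. (\<Sum>k\<in>enum_below n. norm (X \<omega> k)) \<le> real N" by blast
    show "(\<lambda>k. norm (X \<omega> k)) summable_on UNIV"
    proof (rule abs_summable_onI_bound)
      fix F :: "'k set" assume F: "finite F"
      then obtain n where "F \<subseteq> enum_below n" by (rule finite_subset_enum_below)
      then have "(\<Sum>k\<in>F. norm (X \<omega> k)) \<le> (\<Sum>k\<in>enum_below n. norm (X \<omega> k))"
        by (intro sum_mono2 finite_enum_below) auto
      also note N
      finally show "(\<Sum>k\<in>F. norm (X \<omega> k)) \<le> real N" .
    qed
  qed
  then show ?thesis by simp
qed

lemma measurable_ell1_data:
  fixes X :: "'a \<Rightarrow> 'k::countable \<Rightarrow> complex"
  assumes X: "\<And>k. (\<lambda>\<omega>. X \<omega> k) \<in> borel_measurable M"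
  shows "(\<lambda>\<omega>. ell1_data (X \<omega>)) \<in> borel_measurable M"
proof (rule borel_measurable_ell1I)
  note [measurable] = X sets_abs_summable[OF X]
  show "(\<lambda>\<omega>. coef (ell1_data (X \<omega>)) k) \<in> borel_measurable M" for k
    unfolding coef_ell1_data by measurable
qed

text \<open>The datum splits into its k-th coefficient and a remainder R that depends only on the
  other variables, hence is independent of it. The splitting holds almost surely, namely on the
  event of summability.\<close>

lemma (in prob_space) ell1_data_quasi_invariant:
  fixes g :: "'k::countable \<Rightarrow> 'a \<Rightarrow> complex"
  assumes ind: "indep_vars (\<lambda>_. borel) g UNIV" and law: "\<And>k. distr M borel (g k) = density lborel p"
    and p: "p \<in> borel_measurable borel" "\<And>x. p x > 0" and c: "\<And>k. c k \<noteq> 0"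
    and summ: "AE \<omega> in M. (\<lambda>k. norm (c k * g k \<omega>)) summable_on UNIV"
    and V: "V \<in> sets borel"
    and ae: "AE \<omega> in M. ell1_data (\<lambda>k. c k * g k \<omega>) + ell1_single k z \<notin> V"
  shows "AE \<omega> in M. ell1_data (\<lambda>k. c k * g k \<omega>) \<notin> V"
proof -
  define R where "R \<omega> = ell1_data (\<lambda>j. if j = k then 0 else c j * g j \<omega>)" for \<omega>
  have split: "ell1_data (\<lambda>k. c k * g k \<omega>) = ell1_single k (c k * g k \<omega>) + R \<omega>"
    if s: "(\<lambda>k. norm (c k * g k \<omega>)) summable_on UNIV" for \<omega>
  proof -
    have s': "(\<lambda>j. norm (if j = k then 0 else c j * g j \<omega>)) summable_on UNIV"
      by (rule summable_on_comparison_test[OF s]) auto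
    show ?thesis unfolding R_def
      by (rule ell1_eqI) (simp add: coef_ell1_data s s' del: norm_mult)
  qed
  have gm: "g j \<in> borel_measurable M" for j using ind by (simp add: indep_vars_def)
  let ?Y1 = "\<lambda>f. ell1_single k (c k * f k)"
  let ?Y2 = "\<lambda>f. ell1_data (\<lambda>j. if j = k then 0 else c j * f j)"
  have "indep_var borel (?Y1 \<circ> (\<lambda>\<omega>. restrict (\<lambda>i. g i \<omega>) {k})) borel (?Y2 \<circ> (\<lambda>\<omega>. restrict (\<lambda>i. g i \<omega>) (UNIV - {k})))"
  proof (rule indep_var_compose)
    show "indep_var (PiM {k} (\<lambda>_. borel)) (\<lambda>\<omega>. restrict (\<lambda>i. g i \<omega>) {k}) (PiM (UNIV - {k}) (\<lambda>_. borel)) (\<lambda>\<omega>. restrict (\<lambda>i. g i \<omega>) (UNIV - {k}))"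
      by (rule indep_var_restrict[OF ind]) auto
    have "(\<lambda>f. f k) \<in> borel_measurable (PiM {k} (\<lambda>_. borel))" by (rule measurable_component_singleton) simp
    then show "?Y1 \<in> borel_measurable (PiM {k} (\<lambda>_. borel))"
      by (intro measurable_compose[OF _ borel_measurable_ell1_single] borel_measurable_times) auto
    show "?Y2 \<in> borel_measurable (PiM (UNIV - {k}) (\<lambda>_. borel))"
    proof (rule measurable_ell1_data)
      fix j
      show "(\<lambda>f. if j = k then 0 else c j * f j) \<in> borel_measurable (PiM (UNIV - {k}) (\<lambda>_. borel))"
      proof (cases "j = k")
        case False
        then have "(\<lambda>f. f j) \<in> borel_measurable (PiM (UNIV - {k}) (\<lambda>_. borel))"
          by (intro measurable_component_singleton) simp
        then show ?thesis using False by auto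
      qed simp
    qed
  qed
  moreover have "?Y1 \<circ> (\<lambda>\<omega>. restrict (\<lambda>i. g i \<omega>) {k}) = (\<lambda>\<omega>. ell1_single k (c k * g k \<omega>))"
    by (simp add: fun_eq_iff)
  moreover have "?Y2 \<circ> (\<lambda>\<omega>. restrict (\<lambda>i. g i \<omega>) (UNIV - {k})) = R"
    unfolding R_def by (auto simp: fun_eq_iff intro!: arg_cong[of _ _ ell1_data])
  ultimately have ind': "indep_var borel (\<lambda>\<omega>. ell1_single k (c k * g k \<omega>)) borel R" by simp
  have "AE \<omega> in M. ell1_single k (c k * g k \<omega>) + R \<omega> + ell1_single k z \<notin> V"
    using ae summ by eventually_elim (simp add: split)
  from AE_translate_indep[OF ind' gm law p V c this] summ
  show ?thesis by eventually_elim (simp add: split)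
qed

text \<open>By monotone convergence the sum of the moduli has expectation at most C * m, so it is
  finite almost surely.\<close>

lemma (in prob_space) AE_summable_iid:
  fixes g :: "'k::countable \<Rightarrow> 'a \<Rightarrow> complex" and c :: "'k \<Rightarrow> complex"
  assumes g [measurable]: "\<And>k. g k \<in> borel_measurable M"
    and m: "\<And>k. (\<integral>\<^sup>+\<omega>. ennreal (norm (g k \<omega>)) \<partial>M) \<le> m" "m < \<infinity>"
    and c: "\<And>F. finite F \<Longrightarrow> (\<Sum>k\<in>F. norm (c k)) \<le> C"
  shows "AE \<omega> in M. (\<lambda>k. norm (c k * g k \<omega>)) summable_on UNIV"
proof -
  define S where "S n \<omega> = (\<Sum>k\<in>enum_below n. ennreal (norm (c k * g k \<omega>)))" for n \<omega>
  have Sm [measurable]: "S n \<in> borel_measurable M" for n unfolding S_def by measurable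
  have "incseq S"
    unfolding incseq_def le_fun_def S_def by (intro allI impI sum_mono2 enum_below_mono finite_enum_below) auto
  then have "(\<integral>\<^sup>+\<omega>. (SUP n. S n \<omega>) \<partial>M) = (SUP n. \<integral>\<^sup>+\<omega>. S n \<omega> \<partial>M)"
    by (rule nn_integral_monotone_convergence_SUP) simp
  also have "\<dots> \<le> ennreal C * m"
  proof (rule SUP_least)
    fix n
    have "(\<integral>\<^sup>+\<omega>. S n \<omega> \<partial>M) = (\<Sum>k\<in>enum_below n. ennreal (norm (c k)) * (\<integral>\<^sup>+\<omega>. ennreal (norm (g k \<omega>)) \<partial>M))"
      unfolding S_def by (simp add: nn_integral_sum norm_mult ennreal_mult nn_integral_cmult)
    also have "\<dots> \<le> (\<Sum>k\<in>enum_below n. ennreal (norm (c k)) * m)"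
      by (intro sum_mono mult_left_mono m) auto
    also have "\<dots> = ennreal (\<Sum>k\<in>enum_below n. norm (c k)) * m"
      by (simp add: sum_distrib_right[symmetric] sum_ennreal)
    also have "\<dots> \<le> ennreal C * m"
      by (intro mult_right_mono ennreal_leI c finite_enum_below) auto
    finally show "(\<integral>\<^sup>+\<omega>. S n \<omega> \<partial>M) \<le> ennreal C * m" .
  qed
  also have "\<dots> < \<infinity>" using m(2) by (simp add: ennreal_mult_less_top)
  finally have "AE \<omega> in M. (SUP n. S n \<omega>) \<noteq> \<infinity>"
    by (intro nn_integral_PInf_AE) auto
  then show ?thesis
  proof eventually_elim
    case (elim \<omega>)
    then obtain r where r: "r \<ge> 0" "(SUP n. S n \<omega>) = ennreal r"
      by (cases "SUP n. S n \<omega>") auto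
    show ?case
    proof (rule abs_summable_onI_bound)
      fix F :: "'k set" assume F: "finite F"
      then obtain n where "F \<subseteq> enum_below n" by (rule finite_subset_enum_below)
      then have "(\<Sum>k\<in>F. norm (c k * g k \<omega>)) \<le> (\<Sum>k\<in>enum_below n. norm (c k * g k \<omega>))"
        by (intro sum_mono2 finite_enum_below) auto
      moreover have "ennreal (\<Sum>k\<in>enum_below n. norm (c k * g k \<omega>)) \<le> ennreal r"
        unfolding r(2)[symmetric] by (rule SUP_upper2[of n]) (simp_all add: S_def sum_ennreal)
      ultimately show "(\<Sum>k\<in>F. norm (c k * g k \<omega>)) \<le> r"
        using r(1) by (simp add: ennreal_le_iff)
    qed
  qed
qed

text \<open>The normalisation is read off from the existence of a variable with this density, which
  spares the computation of the Gaussian integral.\<close>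

lemma std_complex_gaussian_nn_integral_1:
  assumes "prob_space M" "distributed M lborel X std_complex_gaussian_density"
  shows "(\<integral>\<^sup>+z. ennreal (std_complex_gaussian_density z) \<partial>lborel) = 1"
proof -
  interpret prob_space M by fact
  have X: "X \<in> measurable M lborel" and eq: "distr M lborel X = density lborel std_complex_gaussian_density"
    and m: "(\<lambda>z. ennreal (std_complex_gaussian_density z)) \<in> borel_measurable lborel"
    using assms(2) by (auto simp: distributed_def)
  have "emeasure (distr M lborel X) UNIV = 1"
    using X by (subst emeasure_distr) (auto simp: emeasure_space_1 measurable_def)
  then show ?thesis unfolding eq using m by (subst (asm) emeasure_density) auto
qed

text \<open>From r <= exp (r^2 / 2) the integrand is dominated by exp (- |z|^2 / 2) / pi. Scaling by
  \<open>sqrt 2\<close>, with Jacobian 2 in the plane, turns this into twice the density.\<close>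

lemma std_complex_gaussian_first_moment:
  assumes I: "(\<integral>\<^sup>+z. ennreal (std_complex_gaussian_density z) \<partial>lborel) = 1"
  shows "(\<integral>\<^sup>+z. ennreal (std_complex_gaussian_density z) * ennreal (norm z) \<partial>lborel) \<le> 2"
proof -
  have dm [measurable]: "std_complex_gaussian_density \<in> borel_measurable borel"
    unfolding std_complex_gaussian_density_def by measurable
  define h where "h z = ennreal (exp (- (norm z)\<^sup>2 / 2) / pi)" for z :: complex
  have hm [measurable]: "h \<in> borel_measurable borel" unfolding h_def by measurable
  have "ennreal (std_complex_gaussian_density z) * ennreal (norm z) \<le> h z" for z
  proof -
    have "norm z \<le> 1 + (norm z)\<^sup>2 / 2"
      using sum_squares_ge_zero[of "norm z - 1" 0] by (simp add: power2_eq_square algebra_simps)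
    also have "\<dots> \<le> exp ((norm z)\<^sup>2 / 2)" by (rule exp_ge_add_one_self)
    finally have "exp (- (norm z)\<^sup>2) * norm z \<le> exp (- (norm z)\<^sup>2) * exp ((norm z)\<^sup>2 / 2)"
      by (intro mult_left_mono) auto
    also have "\<dots> = exp (- (norm z)\<^sup>2 / 2)" by (simp add: exp_add[symmetric])
    finally have "std_complex_gaussian_density z * norm z \<le> exp (- (norm z)\<^sup>2 / 2) / pi"
      by (simp add: std_complex_gaussian_density_def divide_right_mono)
    moreover have "std_complex_gaussian_density z \<ge> 0" by (simp add: std_complex_gaussian_density_def)
    ultimately show ?thesis by (simp add: h_def ennreal_mult''[symmetric] ennreal_leI)
  qed
  then have "(\<integral>\<^sup>+z. ennreal (std_complex_gaussian_density z) * ennreal (norm z) \<partial>lborel) \<le> (\<integral>\<^sup>+z. h z \<partial>lborel)"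
    by (intro nn_integral_mono)
  also have "\<dots> = (\<integral>\<^sup>+z. h z \<partial>density (distr lborel borel (\<lambda>x. 0 + sqrt 2 *\<^sub>R x)) (\<lambda>_. \<bar>sqrt 2\<bar> ^ DIM(complex)))"
    by (subst lborel_affine[of "sqrt 2" "0 :: complex"]) auto
  also have "\<dots> = (\<integral>\<^sup>+z. 2 * h (sqrt 2 *\<^sub>R z) \<partial>lborel)"
    by (subst nn_integral_density, (measurable)[2], subst nn_integral_distr) auto
  also have "\<dots> = (\<integral>\<^sup>+z. 2 * ennreal (std_complex_gaussian_density z) \<partial>lborel)"
    by (simp add: h_def std_complex_gaussian_density_def power_mult_distrib)
  also have "\<dots> = 2 * 1" by (subst nn_integral_cmult) (auto simp: I)
  finally show ?thesis by simp
qed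

section \<open>The density\<close>

definition datum_weight :: "real \<Rightarrow> int ^ 3 \<Rightarrow> complex" where
  "datum_weight s k = 1 / complex_of_real (sqrt (1 + norm (lattice_vec k) powr (2 * s)))"

lemma datum_weight_nonzero: "datum_weight s k \<noteq> 0"
proof -
  have "1 + norm (lattice_vec k) powr (2 * s) > 0" by (intro add_pos_nonneg) auto
  then show ?thesis by (simp add: datum_weight_def)
qed

text \<open>For |k| >= 1 the bracket is at most 2 |k|^2, whose cube gives the 8, and s >= 6 makes
  |k|^(2 s) dominate |k|^12. Otherwise the bracket is at most 2, with cube at most 8.\<close>

lemma norm_datum_weight_le:
  assumes s: "s \<ge> 6"
  shows "norm (datum_weight s k) \<le> 8 * (1 / bracket2 k ^ 3)"
proof -
  define r where "r = norm (lattice_vec k)"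
  have b: "bracket2 k = 1 + r\<^sup>2" by (simp add: bracket2_def r_def)
  have "(bracket2 k ^ 3 / 8)\<^sup>2 \<le> 1 + r powr (2 * s)"
  proof (cases "r \<ge> 1")
    case True
    have "bracket2 k \<le> 2 * r\<^sup>2" using True by (simp add: b)
    then have "bracket2 k ^ 3 \<le> (2 * r\<^sup>2) ^ 3"
      using bracket2_ge_1[of k] by (intro power_mono) auto
    then have "bracket2 k ^ 3 / 8 \<le> r ^ 6" by (simp add: power_mult_distrib flip: power_mult)
    then have "(bracket2 k ^ 3 / 8)\<^sup>2 \<le> (r ^ 6)\<^sup>2"
      by (intro power_mono) (auto simp: less_imp_le)
    also have "\<dots> = r powr 12" using True by (simp add: powr_numeral flip: power_mult)
    also have "\<dots> \<le> r powr (2 * s)" using True s by (intro powr_mono) auto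
    finally show ?thesis by simp
  next
    case False
    then have "bracket2 k \<le> 2" by (simp add: b r_def power_le_one)
    then have "bracket2 k ^ 3 \<le> 2 ^ 3"
      using bracket2_ge_1[of k] by (intro power_mono) auto
    then have "bracket2 k ^ 3 / 8 \<le> 1" by simp
    then have "(bracket2 k ^ 3 / 8)\<^sup>2 \<le> 1"
      by (intro power_le_one) (auto simp: less_imp_le)
    then show ?thesis using powr_ge_zero[of r "2 * s"] by linarith
  qed
  then have le: "bracket2 k ^ 3 / 8 \<le> sqrt (1 + r powr (2 * s))" by (rule real_le_rsqrt)
  have "norm (datum_weight s k) = 1 / sqrt (1 + r powr (2 * s))"
    by (simp add: datum_weight_def norm_divide r_def)
  also have "\<dots> \<le> 1 / (bracket2 k ^ 3 / 8)"
    using le by (intro frac_le) auto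
  finally show ?thesis by simp
qed

lemma sum_datum_weight_bounded:
  assumes s: "s \<ge> 6"
  obtains C where "\<And>F. finite F \<Longrightarrow> (\<Sum>k\<in>F. norm (datum_weight s k)) \<le> C"
proof -
  obtain B where B: "\<And>F. finite F \<Longrightarrow> (\<Sum>k\<in>F. 1 / bracket2 k ^ 3) \<le> B"
    by (rule sum_inverse_bracket2_bounded) blast
  have "(\<Sum>k\<in>F. norm (datum_weight s k)) \<le> 8 * B" if "finite F" for F
  proof -
    have "(\<Sum>k\<in>F. norm (datum_weight s k)) \<le> (\<Sum>k\<in>F. 8 * (1 / bracket2 k ^ 3))"
      by (intro sum_mono norm_datum_weight_le s)
    also have "\<dots> = 8 * (\<Sum>k\<in>F. 1 / bracket2 k ^ 3)" by (rule sum_distrib_left[symmetric])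
    also have "\<dots> \<le> 8 * B" using B[OF that] by simp
    finally show ?thesis .
  qed
  then show ?thesis using that by blast
qed

lemma random_datum_eq_synth:
  assumes "(\<lambda>k. norm (datum_weight s k * g k \<omega>)) summable_on UNIV"
  shows "random_datum s g \<omega> = synth (ell1_data (\<lambda>k. datum_weight s k * g k \<omega>))"
proof -
  have "coef (ell1_data (\<lambda>k. datum_weight s k * g k \<omega>)) k = datum_weight s k * g k \<omega>" for k
    by (simp only: coef_ell1_data assms if_True)
  then show ?thesis
    by (simp add: fun_eq_iff random_datum_def synth_def datum_weight_def)
qed

text \<open>The group at time t0 undoes the interaction picture at the final time.\<close>

definition point_value :: "real \<Rightarrow> real ^ 3 \<Rightarrow> (int ^ 3) ell1 \<Rightarrow> complex" where
  "point_value t0 x0 a = synth (schroedinger t0 a) x0"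

lemma bounded_linear_point_value: "bounded_linear (point_value t0 x0)"
  unfolding point_value_def
  by (rule bounded_linear_compose[OF bounded_linear_synth bounded_linear_schroedinger])

text \<open>Constant functions, whose only frequency is 0, already attain every value.\<close>

lemma surj_point_value: "surj (point_value t0 x0)"
proof (rule surjI)
  show "point_value t0 x0 (schroedinger (- t0) (ell1_single 0 z)) = z" for z
    by (simp add: point_value_def schroedinger_group synth_single)
qed

text \<open>A given solution of the partial differential equation places its datum in the domain of
  the abstract flow; injectivity of synthesis identifies the initial coefficients, and uniqueness of
  the flow identifies the final ones.\<close>

lemma nls_solution_point_value:
  assumes f: "c11_field (nls_field t0) f'" and sol: "nls_solution \<sigma>max (synth a) v" and \<sigma>: "8 < \<sigma>max"
  shows "a \<in> c11_field.flow_dom (nls_field t0)"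
    and "v t0 x0 = point_value t0 x0 (c11_field.time_one (nls_field t0) a)"
proof -
  interpret c11_field "nls_field t0" f' by (rule f)
  obtain \<alpha> where v: "\<And>t. v t = synth (\<alpha> t)"
    and is_sol: "is_sol (nls_field t0) (\<alpha> 0) (\<lambda>\<theta>. schroedinger (- (t0 * \<theta>)) (\<alpha> (t0 * \<theta>)))"
    by (rule nls_solution_ell1_curve[OF sol \<sigma>]) blast
  have "synth (\<alpha> 0) = synth a" using sol v by (simp add: nls_solution_def)
  then have a: "\<alpha> 0 = a" by (rule synth_inject)
  show "a \<in> flow_dom" using is_sol a by (auto simp: flow_dom_def)
  have "time_one a = schroedinger (- t0) (\<alpha> t0)"
    using time_one_eq[OF is_sol] a by simp
  then show "v t0 x0 = point_value t0 x0 (time_one a)"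
    by (simp add: point_value_def schroedinger_group v)
qed

text \<open>The two functions differ on a null set, every relevant subset of which is measurable in
  the completion. This is needed since u may be arbitrary on a null event.\<close>

lemma measurable_completion_AE_eq:
  assumes f: "f \<in> measurable M N" and ae: "AE x in M. f x = h x" and h: "\<And>x. h x \<in> space N"
  shows "h \<in> measurable (completion M) N"
proof (rule measurableI)
  fix A assume A: "A \<in> sets N"
  have "AE x in M. \<not> (f x \<noteq> h x)" using ae by simp
  from sets_completion_AE[OF this]
  have N: "{x \<in> space M. f x \<noteq> h x} \<in> sets (completion M)" by (simp add: pred_def)
  have null: "{x \<in> space M. f x \<noteq> h x \<and> h x \<in> A} \<in> sets (completion M)"
  proof -
    have "AE x in M. \<not> (f x \<noteq> h x \<and> h x \<in> A)" using ae by eventually_elim simp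
    from sets_completion_AE[OF this] show ?thesis by (simp add: pred_def)
  qed
  have "h -` A \<inter> space (completion M) = ((f -` A \<inter> space M) - {x \<in> space M. f x \<noteq> h x}) \<union> {x \<in> space M. f x \<noteq> h x \<and> h x \<in> A}"
    by auto
  then show "h -` A \<inter> space (completion M) \<in> sets (completion M)"
    using measurable_sets[OF f A] N null by auto
qed (rule h)

theorem corollary1p2:
  fixes M :: "'a measure"
    and g :: "int ^ 3 \<Rightarrow> 'a \<Rightarrow> complex"
    and s t0 :: real
    and x0 :: "real ^ 3"
    and u :: "real \<Rightarrow> real ^ 3 \<Rightarrow> 'a \<Rightarrow> complex"
  assumes "prob_space M"
    and "prob_space.indep_vars M (\<lambda>_. borel) g UNIV"
    and "\<And>k. distributed M lborel (g k) std_complex_gaussian_density"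
    and "s \<ge> 10"
    and "AE \<omega> in M. nls_solution (s - 3/2) (random_datum s g \<omega>) (\<lambda>t x. u t x \<omega>)"
  shows "\<exists>f. distributed (completion M) lborel (\<lambda>\<omega>. u t0 x0 \<omega>) f"
proof -
  interpret prob_space M by fact
  have g [measurable]: "g k \<in> borel_measurable M" for k
    using assms(3)[of k] by (simp add: distributed_def)
  have law: "distr M borel (g k) = density lborel std_complex_gaussian_density" for k
    using assms(3)[of k] unfolding distributed_def by (simp cong: distr_cong)
  have dens_m: "(\<lambda>z. ennreal (std_complex_gaussian_density z)) \<in> borel_measurable borel"
    using assms(3)[of undefined] by (simp add: distributed_def)
  have dens_pos: "ennreal (std_complex_gaussian_density z) > 0" for z
    by (simp add: std_complex_gaussian_density_def)
  note moment = std_complex_gaussian_first_moment[OF std_complex_gaussian_nn_integral_1[OF assms(1) assms(3)]]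
  have "(\<integral>\<^sup>+\<omega>. ennreal (norm (g k \<omega>)) \<partial>M) \<le> 2" for k
    using distributed_nn_integral[OF assms(3)[of k], of "\<lambda>z. ennreal (norm z)"] moment by simp
  moreover obtain C where "\<And>F. finite F \<Longrightarrow> (\<Sum>k\<in>F. norm (datum_weight s k)) \<le> C"
    using sum_datum_weight_bounded[of s] assms(4) by auto
  ultimately have summ: "AE \<omega> in M. (\<lambda>k. norm (datum_weight s k * g k \<omega>)) summable_on UNIV"
    by (intro AE_summable_iid[where m=2]) auto
  define a where "a \<omega> = ell1_data (\<lambda>k. datum_weight s k * g k \<omega>)" for \<omega>
  have am: "a \<in> borel_measurable M"
    unfolding a_def[abs_def] by (rule measurable_ell1_data) simp
  obtain f' where f': "c11_field (nls_field t0) f'" using nls_field_c11 by blast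
  interpret flow: c11_field "nls_field t0" f' by (rule f')
  define F where "F x = point_value t0 x0 (flow.time_one x)" for x
  have sol: "AE \<omega> in M. a \<omega> \<in> flow.flow_dom \<and> u t0 x0 \<omega> = F (a \<omega>)"
    using assms(5) summ
  proof eventually_elim
    case (elim \<omega>)
    then have "nls_solution (s - 3/2) (synth (a \<omega>)) (\<lambda>t x. u t x \<omega>)"
      by (simp add: random_datum_eq_synth a_def)
    \<comment> \<open>The hypothesis s >= 10 gives s - 3/2 > 8.\<close>
    from nls_solution_point_value[OF f' this] show ?case
      using assms(4) by (simp add: F_def)
  qed
  have F: "\<exists>U. (F has_derivative U) (at x) \<and> surj U" if x: "x \<in> flow.flow_dom" for x
  proof -
    obtain U where U: "(flow.time_one has_derivative U) (at x)" "surj U"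
      by (rule flow.time_one_has_surj_derivative[OF x]) blast
    have "(F has_derivative (\<lambda>h. point_value t0 x0 (U h))) (at x)"
      unfolding F_def[abs_def] by (rule bounded_linear.has_derivative[OF bounded_linear_point_value U(1)])
    moreover have "surj (\<lambda>h. point_value t0 x0 (U h))"
      using comp_surj[OF U(2) surj_point_value] by (simp add: comp_def)
    ultimately show ?thesis by blast
  qed
  have null: "AE \<omega> in M. u t0 x0 \<omega> \<notin> B" if B: "B \<in> null_sets lborel" for B
  proof -
    have "AE \<omega> in M. F (a \<omega>) \<notin> B"
    proof (rule AE_not_in_null_set[OF assms(1) am _ flow.open_flow_dom _ F B])
      show "AE \<omega> in M. a \<omega> \<in> flow.flow_dom" using sol by auto
      fix k z V
      assume "V \<in> sets borel" "AE \<omega> in M. a \<omega> + ell1_single k z \<notin> V"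
      then show "AE \<omega> in M. a \<omega> \<notin> V"
        unfolding a_def
        by (rule ell1_data_quasi_invariant[OF assms(2) law dens_m dens_pos datum_weight_nonzero summ])
    qed
    with sol show ?thesis by eventually_elim simp
  qed
  have cF: "continuous_on flow.flow_dom F" by (rule continuous_on_if_has_derivative[OF F])
  \<comment> \<open>F is controlled on the open flow domain only; cutting it off by the indicator
    yields a Borel function that agrees with F along almost every datum.\<close>
  have Fm: "(\<lambda>\<omega>. indicator flow.flow_dom (a \<omega>) *\<^sub>R F (a \<omega>)) \<in> borel_measurable M"
    by (rule measurable_compose[OF am borel_measurable_continuous_on_indicator[OF _ cF]])
       (simp add: flow.open_flow_dom)
  have "AE \<omega> in M. indicator flow.flow_dom (a \<omega>) *\<^sub>R F (a \<omega>) = u t0 x0 \<omega>"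
    using sol by eventually_elim simp
  from measurable_completion_AE_eq[OF Fm this]
  have um: "(\<lambda>\<omega>. u t0 x0 \<omega>) \<in> measurable (completion M) lborel"
    by simp
  \<comment> \<open>Absolute continuity is converted into a density by Radon-Nikodym,
    \<open>lborel\<close> being sigma-finite.\<close>
  have "absolutely_continuous lborel (distr (completion M) lborel (\<lambda>\<omega>. u t0 x0 \<omega>))"
    unfolding absolutely_continuous_def
  proof
    fix B :: "complex set" assume B: "B \<in> null_sets lborel"
    have "AE x in distr (completion M) lborel (\<lambda>\<omega>. u t0 x0 \<omega>). x \<notin> B"
      using AE_completion[OF null[OF B]] B by (subst AE_distr_iff[OF um]) auto
    then show "B \<in> null_sets (distr (completion M) lborel (\<lambda>\<omega>. u t0 x0 \<omega>))"
      using B by (subst AE_iff_null_sets) auto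
  qed
  from sigma_finite_measure.Radon_Nikodym[OF sigma_finite_lborel this]
  obtain f where "f \<in> borel_measurable lborel" "density lborel f = distr (completion M) lborel (\<lambda>\<omega>. u t0 x0 \<omega>)"
    by auto
  then have "distributed (completion M) lborel (\<lambda>\<omega>. u t0 x0 \<omega>) f"
    using um by (simp add: distributed_def)
  then show ?thesis by blast
qed

end
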